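(* Let $D\geq2$ and let $\Sigma(D)$ be the set of $\lambda\in\mathbb C$ which are eigenvalues of $f_*:\mathcal Q_f\to\mathcal Q_f$ for some unicritical polynomial $f:\mathbb C\to\mathbb C$ of degree $D$ with periodic critical point. Then the closure of $\Sigma(D)$ contains the annulus $\{\lambda\in\mathbb C : r_D\leq|\lambda|\leq1\}$, where $r_D$ is defined by $$\frac1{r_D}=\begin{cases}2D&\text{if }D\text{ is even},\\ 2D\cos\left(\frac{\pi}{2D}\right)&\text{if }D\text{ is odd}.\end{cases}$$
   Context: A polynomial $\mathbb C\to\mathbb C$ is unicritical if it has a unique critical point in $\mathbb C$; it is regarded as a rational map of the Riemann sphere $\widehat{\mathbb C}$. "Periodic critical point" means this critical point in $\mathbb C$ is periodic under $f$. The postcritical set is $\mathcal P_f=\bigcup_{n\geq1}f^{\circ n}(\mathcal C_f)$, where $\mathcal C_f$ is the set of critical points of $f$ in $\widehat{\mathbb C}$ (including $\infty$). A meromorphic quadratic differential on $\widehat{\mathbb C}$ is $\mathbf q=q(z)\,(\mathrm dz)^2$ with $q$ a rational function (orders at $\infty$ are computed in the coordinate $w=1/z$, so $(\mathrm dz)^2$ has a pole of order $4$ at $\infty$). $\mathcal Q_f$ is the complex vector space of meromorphic quadratic differentials on $\widehat{\mathbb C}$ with at worst simple poles, all contained in $\mathcal P_f$. The pushforward operator is $f_*\mathbf q=r\,(\mathrm dz)^2$ with $r(y)=\sum_{x\in f^{-1}(y)}\frac{q(x)}{f'(x)^2}$ (for generic $y$; this extends to a meromorphic quadratic differential); it maps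 $\mathcal Q_f$ to itself. An eigenvalue is a scalar for which there is a nonzero eigenvector. *)

theory Defs
  imports
    "HOL-Computational_Algebra.Computational_Algebra"
    "HOL-Computational_Algebra.Field_as_Ring"
    "HOL-Complex_Analysis.Complex_Analysis"
begin

text \<open>
  The Riemann sphere is the type \<^typ>\<open>complex option\<close>, where \<^term>\<open>None\<close> is the point at infinity.
  A nonconstant polynomial extends to the sphere by fixing infinity.
\<close>

definition sphere_map :: "complex poly \<Rightarrow> complex option \<Rightarrow> complex option" where
  "sphere_map f = map_option (poly f)"

text \<open>
  Only used for polynomials of degree at least 2, for which infinity is always a critical point.
\<close>

definition sphere_critical_points :: "complex poly \<Rightarrow> complex option set" where
  "sphere_critical_points f = insert None (Some ` {c. poly (pderiv f) c = 0})"

definition postcritical_set :: "complex poly \<Rightarrow> complex option set" where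
  "postcritical_set f = (\<Union>n\<in>{1..}. (sphere_map f ^^ n) ` sphere_critical_points f)"

definition unicritical :: "complex poly \<Rightarrow> bool" where
  "unicritical f \<longleftrightarrow> (\<exists>!c. poly (pderiv f) c = 0)"

definition periodic_point :: "('a \<Rightarrow> 'a) \<Rightarrow> 'a \<Rightarrow> bool" where
  "periodic_point g x \<longleftrightarrow> (\<exists>n\<ge>1. (g ^^ n) x = x)"

definition periodic_critical_point :: "complex poly \<Rightarrow> bool" where
  "periodic_critical_point f \<longleftrightarrow> (\<exists>c. poly (pderiv f) c = 0 \<and> periodic_point (poly f) c)"

text \<open>
  The value of a rational function, computed from its reduced fraction; the value at a pole is 0
  by convention, but every use below disregards finitely many points.
\<close>

definition rat_eval :: "complex poly fract \<Rightarrow> complex \<Rightarrow> complex" where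
  "rat_eval q z = poly (fst (quot_of_fract q)) z / poly (snd (quot_of_fract q)) z"

text \<open>
  A meromorphic quadratic differential \<open>q(z) (dz)^2\<close> on the sphere is represented by the rational
  function \<open>q\<close>. The following is its coefficient near a point in a coordinate \<open>w\<close> vanishing there:
  \<open>z = a + w\<close> near a finite point \<open>a\<close>, and \<open>z = 1/w\<close> near infinity, where
  \<open>(dz)^2 = (dw)^2 / w^4\<close>.
\<close>

fun qd_local :: "complex poly fract \<Rightarrow> complex option \<Rightarrow> complex \<Rightarrow> complex" where
  "qd_local q (Some a) = (\<lambda>w. rat_eval q (a + w))"
| "qd_local q None = (\<lambda>w. rat_eval q (1 / w) / w ^ 4)"

text \<open>The space \<open>Q_f\<close>: all poles are simple and lie in the postcritical set.\<close>

definition quad_diffs :: "complex poly \<Rightarrow> complex poly fract set" where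
  "quad_diffs f =
     {q. \<forall>x. is_pole (qd_local q x) 0 \<longrightarrow> zorder (qd_local q x) 0 = -1 \<and> x \<in> postcritical_set f}"

text \<open>
  For nonconstant \<open>f\<close> such a rational function \<open>r\<close> exists (it is a trace from the field \<open>C(x)\<close> to its
  subfield \<open>C(f(x))\<close>), and it is unique since rational functions agreeing at all but finitely many
  points are equal.
\<close>

definition pushforward :: "complex poly \<Rightarrow> complex poly fract \<Rightarrow> complex poly fract" where
  "pushforward f q =
     (THE r. \<forall>\<^sub>F y in cofinite.
        rat_eval r y = (\<Sum>x | poly f x = y. rat_eval q x / (poly (pderiv f) x)\<^sup>2))"

text \<open>Multiplication by a scalar \<open>l\<close> is multiplication by the constant rational function \<open>l\<close>.\<close>

definition pushforward_eigenvalue :: "complex poly \<Rightarrow> complex \<Rightarrow> bool" where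
  "pushforward_eigenvalue f l \<longleftrightarrow>
     (\<exists>q\<in>quad_diffs f. q \<noteq> 0 \<and> pushforward f q = to_fract [:l:] * q)"

definition Sigma_set :: "nat \<Rightarrow> complex set" where
  "Sigma_set D =
     {l. \<exists>f. degree f = D \<and> unicritical f \<and> periodic_critical_point f \<and> pushforward_eigenvalue f l}"

definition r_radius :: "nat \<Rightarrow> real" where
  "r_radius D = 1 / (if even D then 2 * real D else 2 * real D * cos (pi / (2 * real D)))"

end

theory Submission
  imports Defs
begin

text \<open>
  Normalize the polynomial to \<open>f(z) = z^D + c\<close> with critical orbit \<open>0, x\<^sub>1 = c, x\<^sub>2, \<dots>\<close>, and suppose
  that 0 has period \<open>p\<close>. Eigenvectors of the pushforward with nonzero eigenvalue can be written
  down: they are combinations of the differentials \<open>(dz)^2 / (z - x\<^sub>k)\<close>, and the number \<open>1 / s\<close>,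
  with \<open>s\<close> different from 0 and \<open>D\<close>, is an eigenvalue as soon as \<open>\<Sum>k<p. s^k / (f\<^sup>k)'(x\<^sub>1) = 0\<close>
  (lemma \<open>eigenvalue_criterion\<close>).

  The theorem is thus about zeros of these polynomials in \<open>s\<close> as \<open>c\<close> varies. Let the periodic
  critical orbits become long in such a way that \<open>(f\<^sup>k)'(x\<^sub>1)\<close> grows at least about as fast as
  \<open>\<sigma>^k\<close>, while the derivative along the last \<open>k\<close> steps grows at most about as fast as \<open>\<sigma>^k\<close>. Then
  the zeros accumulate at every point of the circle of radius \<open>\<sigma>\<close>, just as the zeros of the partial
  sums of a power series accumulate at its circle of convergence (lemma
  \<open>zeros_accumulate_on_circle\<close>).

  Such orbits are found near parameters for which the critical point lands on a repelling fixed
  point \<open>\<beta>\<close>. If \<open>\<alpha>\<close> is another repelling fixed point, with a smaller derivative, or is equal to \<open>\<beta>\<close>,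
  then a perturbation of the parameter makes the critical orbit spend prescribed numbers of steps
  first near \<open>\<beta>\<close> and then near \<open>\<alpha>\<close> before it returns to 0. The radius \<open>\<sigma>\<close> is then any geometric
  mean, with rational weights, of the moduli of \<open>f'(\<beta>)\<close> and \<open>f'(\<alpha>)\<close> (lemma
  \<open>eigenvalues_near_circle\<close>).

  It remains to find enough parameters. For radii between 1 and \<open>D\<close> take \<open>\<alpha> = \<beta>\<close>: a normal families
  argument shows that the moduli of the fixed points on which the critical point lands are dense in
  the corresponding interval (lemma \<open>landing_parameters_near_circle\<close>). For radii between \<open>D\<close> and
  \<open>1 / r_radius D\<close> take a parameter for which the critical value is \<open>\<omega> \<beta>\<close>, with \<open>\<omega>\<close> a \<open>D\<close>-th root of
  unity. Then \<open>f'(\<beta>) = D (1 - \<omega>)\<close>, of modulus \<open>1 / r_radius D\<close> when \<open>\<omega>\<close> is as far from 1 as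
  possible, and there is an \<open>\<alpha>\<close> whose derivative has modulus at most \<open>D\<close> (lemma
  \<open>limit_circle_above\<close>).
\<close>

section \<open>Eigenvectors of the pushforward\<close>

definition umap :: "nat \<Rightarrow> complex \<Rightarrow> complex \<Rightarrow> complex" where
  "umap D c z = z ^ D + c"

definition unicritical_poly :: "nat \<Rightarrow> complex \<Rightarrow> complex poly" where
  "unicritical_poly D c = monom 1 D + [:c:]"

definition crit_orbit :: "nat \<Rightarrow> complex \<Rightarrow> nat \<Rightarrow> complex" where
  "crit_orbit D c n = (umap D c ^^ n) 0"

text \<open>
  The derivative at the critical value of the iterate \<open>f\<^sup>k\<close>, by the chain rule.
\<close>

definition orbit_deriv :: "nat \<Rightarrow> complex \<Rightarrow> nat \<Rightarrow> complex" where
  "orbit_deriv D c k = (\<Prod>j=1..k. of_nat D * crit_orbit D c j ^ (D - 1))"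

text \<open>
  Multiplication by a primitive root of unity permutes the fibre, and it multiplies the sum by a
  number different from 1.
\<close>

lemma sum_nth_roots_power:
  fixes W :: complex
  assumes "0 < m" "m < D"
  shows "(\<Sum>x | x ^ D = W. x ^ m) = 0"
proof -
  define z where "z = cis (2 * pi / real D)"
  have zD: "z ^ D = 1" using assms by (simp add: z_def Complex.DeMoivre)
  have zm: "z ^ m \<noteq> 1"
  proof
    assume "z ^ m = 1"
    then have "cis (2 * pi * real m / real D) = 1" by (simp add: z_def Complex.DeMoivre mult.commute)
    then have "cos (2 * pi * real m / real D) = 1" by (metis cis.simps(1) one_complex.simps(1))
    then obtain n :: int where "2 * pi * real m / real D = real_of_int n * 2 * pi"
      by (auto simp: cos_one_2pi_int)
    then have "real m = real_of_int n * real D" using assms by (simp add: field_simps)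
    then have eq: "int m = n * int D" by (metis of_int_eq_iff of_int_mult of_int_of_nat_eq)
    then have "int D dvd int m" by simp
    then have "D dvd m" by presburger
    then show False using assms nat_dvd_not_less by blast
  qed
  have z0: "z \<noteq> 0" by (simp add: z_def)
  have "bij_betw (\<lambda>x. z * x) {x. x ^ D = W} {x. x ^ D = W}"
    by (rule bij_betw_byWitness[where f' = "\<lambda>x. x / z"]) (use z0 zD in \<open>auto simp: power_mult_distrib power_divide\<close>)
  then have "(\<Sum>x | x ^ D = W. (z * x) ^ m) = (\<Sum>x | x ^ D = W. x ^ m)"
    by (rule sum.reindex_bij_betw)
  then have "z ^ m * (\<Sum>x | x ^ D = W. x ^ m) = (\<Sum>x | x ^ D = W. x ^ m)"
    by (simp add: power_mult_distrib sum_distrib_left)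
  then show ?thesis using zm by (metis mult_cancel_right1)
qed

text \<open>
  This is the value at \<open>c + W\<close> of the pushforward of \<open>(dz)^2 / (z - a)\<close> under \<open>z^D + c\<close>. The factor
  \<open>1 / (x - a)\<close> is a polynomial in \<open>x\<close> divided by \<open>W - a^D\<close>, because \<open>x - a\<close> divides \<open>x^D - a^D\<close>; of
  the power sums over the fibre that then occur only the one of exponent \<open>D\<close> is not zero. The result
  has simple poles at the critical value and at the image of \<open>a\<close>.
\<close>

lemma pushforward_simple_pole:
  fixes W a :: complex
  assumes D: "2 \<le> D" and W: "W \<noteq> 0" "W \<noteq> a ^ D"
  shows "(\<Sum>x | x ^ D = W. 1 / ((x - a) * (of_nat D * x ^ (D - 1))\<^sup>2)) = a / (of_nat D * W * (W - a ^ D))"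
proof -
  have moment: "(\<Sum>x | x ^ D = W. x ^ (i + 2)) = (if i = D - 2 then of_nat D * W else 0)" if "i < D" for i
  proof (cases "i = D - 2")
    case True
    then have "i + 2 = D" using D by simp
    then have "(\<Sum>x | x ^ D = W. x ^ (i + 2)) = (\<Sum>x | x ^ D = W. W)"
      by (intro sum.cong) auto
    also have "\<dots> = of_nat D * W"
      using card_nth_roots[OF W(1)] D by simp
    finally show ?thesis using True by simp
  next
    case False
    show ?thesis
    proof (cases "i + 2 < D")
      case True then show ?thesis using sum_nth_roots_power[of "i + 2" D W] False by simp
    next
      case F2: False
      then have i: "i + 2 = D + 1" using False that D by linarith
      have "(\<Sum>x | x ^ D = W. x ^ (i + 2)) = (\<Sum>x | x ^ D = W. W * x ^ 1)"
        unfolding i by (intro sum.cong) (auto simp: mult.commute)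
      also have "\<dots> = W * (\<Sum>x | x ^ D = W. x ^ 1)" by (simp add: sum_distrib_left)
      also have "\<dots> = 0" using sum_nth_roots_power[of 1 D W] D by simp
      finally show ?thesis using False by simp
    qed
  qed
  have summand: "1 / ((x - a) * (of_nat D * x ^ (D - 1))\<^sup>2)
      = (\<Sum>i<D. a ^ (D - Suc i) * x ^ (i + 2)) / ((of_nat D)\<^sup>2 * W\<^sup>2 * (W - a ^ D))" if x: "x ^ D = W" for x
  proof -
    have x0: "x \<noteq> 0" using W x D by (metis not_numeral_le_zero power_0_left)
    have xa: "x \<noteq> a" using W x by auto
    define S where "S = (\<Sum>i<D. a ^ (D - Suc i) * x ^ i)"
    have fac: "W - a ^ D = (x - a) * S"
      unfolding S_def using x by (metis power_diff_sumr2)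
    then have S0: "S \<noteq> 0" using W by auto
    have num: "(\<Sum>i<D. a ^ (D - Suc i) * x ^ (i + 2)) = S * x\<^sup>2"
      unfolding S_def sum_distrib_right by (intro sum.cong) (simp_all add: power_add power2_eq_square algebra_simps)
    have X0: "x ^ (D - 1) \<noteq> 0" using x0 by simp
    have "x ^ (D - 1) * x = W"
      using x D by (metis Suc_1 Suc_le_D diff_Suc_1 power_Suc2)
    then have "W\<^sup>2 = (x ^ (D - 1))\<^sup>2 * x\<^sup>2" by (metis power_mult_distrib)
    then show ?thesis unfolding num fac using x0 xa S0 X0 D
      by (simp add: divide_simps power_mult_distrib)
  qed
  have "(\<Sum>x | x ^ D = W. 1 / ((x - a) * (of_nat D * x ^ (D - 1))\<^sup>2))
      = (\<Sum>x | x ^ D = W. \<Sum>i<D. a ^ (D - Suc i) * x ^ (i + 2)) / ((of_nat D)\<^sup>2 * W\<^sup>2 * (W - a ^ D))"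
    unfolding sum_divide_distrib[of _ "{x. x ^ D = W}"] by (intro sum.cong refl, rule summand) simp
  also have "(\<Sum>x | x ^ D = W. \<Sum>i<D. a ^ (D - Suc i) * x ^ (i + 2))
      = (\<Sum>i<D. a ^ (D - Suc i) * (\<Sum>x | x ^ D = W. x ^ (i + 2)))"
    by (subst sum.swap) (simp add: sum_distrib_left)
  also have "\<dots> = (\<Sum>i<D. if i = D - 2 then a ^ (D - Suc i) * (of_nat D * W) else 0)"
    by (intro sum.cong refl) (use moment in auto)
  also have "\<dots> = a * (of_nat D * W)"
    using D by (subst sum.delta) (auto simp: Suc_diff_Suc numeral_2_eq_2)
  finally have "(\<Sum>x | x ^ D = W. 1 / ((x - a) * (of_nat D * x ^ (D - 1))\<^sup>2))
      = a * (of_nat D * W) / ((of_nat D)\<^sup>2 * W\<^sup>2 * (W - a ^ D))" .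
  also have "\<dots> = a / (of_nat D * W * (W - a ^ D))"
    using W D by (simp add: divide_simps power2_eq_square)
  finally show ?thesis .
qed

text \<open>
  The fraction need not be reduced: a common factor that does not vanish at \<open>z\<close> cancels in the
  value.
\<close>

lemma rat_eval_Fract:
  assumes "M \<noteq> 0" "poly M z \<noteq> 0"
  shows "rat_eval (Fract N M) z = poly N z / poly M z"
proof -
  define n d where "n = fst (quot_of_fract (Fract N M))" and "d = snd (quot_of_fract (Fract N M))"
  have nd: "Fract n d = Fract N M"
    unfolding n_def d_def by (metis Fract_quot_of_fract)
  have d0: "d \<noteq> 0" unfolding d_def by (rule snd_quot_of_fract_nonzero)
  have eq: "n * M = N * d" using nd d0 assms(1) by (simp add: eq_fract)
  have "coprime n d" unfolding n_def d_def by (rule coprime_quot_of_fract)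
  moreover have "d dvd n * M" by (simp add: eq)
  ultimately have "d dvd M" by (metis coprime_commute coprime_dvd_mult_right_iff)
  then have "poly d z \<noteq> 0" using assms(2) by (metis dvdE mult_zero_left poly_mult)
  moreover have "poly n z * poly M z = poly N z * poly d z" using eq by (metis poly_mult)
  ultimately show ?thesis unfolding rat_eval_def n_def[symmetric] d_def[symmetric]
    using assms(2) by (simp add: divide_simps)
qed

lemma rat_eval_eqI:
  assumes "\<forall>\<^sub>F y in cofinite. rat_eval r y = rat_eval r' y"
  shows "r = r'"
proof -
  obtain n d where r: "r = Fract n d" "d \<noteq> 0" by (cases r)
  obtain n' d' where r': "r' = Fract n' d'" "d' \<noteq> 0" by (cases r')
  have "finite {y. rat_eval r y \<noteq> rat_eval r' y}" using assms by (simp add: eventually_cofinite)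
  moreover have "finite {y. poly (d * d') y = 0}" using r r' by (intro poly_roots_finite) simp
  ultimately have fin: "finite ({y. rat_eval r y \<noteq> rat_eval r' y} \<union> {y. poly (d * d') y = 0})" by simp
  have "n * d' - n' * d = 0"
  proof (rule ccontr)
    assume "n * d' - n' * d \<noteq> 0"
    then have "finite {y. poly (n * d' - n' * d) y = 0}" by (rule poly_roots_finite)
    with fin have "finite (({y. rat_eval r y \<noteq> rat_eval r' y} \<union> {y. poly (d * d') y = 0}) \<union> {y. poly (n * d' - n' * d) y = 0})"
      by simp
    moreover have "\<dots> = UNIV" using r r' by (auto simp: rat_eval_Fract divide_simps)
    ultimately show False using infinite_UNIV_char_0 by metis
  qed
  then show ?thesis using r r' by (simp add: eq_fract)
qed

text \<open>
  A rational function is determined by almost all of its values, so the definite description is met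
  by any function with the right values.
\<close>

lemma pushforward_eqI:
  assumes "\<forall>\<^sub>F y in cofinite.
     rat_eval r y = (\<Sum>x | poly f x = y. rat_eval q x / (poly (pderiv f) x)\<^sup>2)"
  shows "pushforward f q = r"
  unfolding pushforward_def
proof (rule the_equality)
  fix r' assume "\<forall>\<^sub>F y in cofinite. rat_eval r' y = (\<Sum>x | poly f x = y. rat_eval q x / (poly (pderiv f) x)\<^sup>2)"
  with assms have "\<forall>\<^sub>F y in cofinite. rat_eval r' y = rat_eval r y"
    by eventually_elim simp
  then show "r' = r" by (rule rat_eval_eqI)
qed (rule assms)

text \<open>
  When \<open>g\<close> vanishes at 0 the singularity of \<open>g w / w\<close> is removable; assuming a pole excludes this
  case.
\<close>

lemma at_worst_simple_pole:
  assumes "open S" "0 \<in> S" "g holomorphic_on S" "\<And>w. w \<in> S \<Longrightarrow> w \<noteq> 0 \<Longrightarrow> f w = g w / w"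
    and "is_pole f 0"
  shows "zorder f 0 = -1"
proof (cases "g 0 = 0")
  case False
  show ?thesis
    by (rule zorder_eqI[OF assms(1-3) False]) (use assms(4) in \<open>auto simp: power_int_minus field_simps\<close>)
next
  case True
  have "(g has_field_derivative deriv g 0) (at 0)"
    using assms by (metis holomorphic_derivI)
  then have "((\<lambda>w. (g w - g 0) / (w - 0)) \<longlongrightarrow> deriv g 0) (at 0)"
    by (simp add: has_field_derivative_iff)
  moreover have "\<forall>\<^sub>F w in at 0. (g w - g 0) / (w - 0) = f w"
    using assms(1,2,4) True by (auto simp: eventually_at_topological)
  ultimately have "(f \<longlongrightarrow> deriv g 0) (at 0)" by (rule Lim_transform_eventually)
  then have "\<not> is_pole f 0" unfolding is_pole_def by (metis at_neq_bot not_tendsto_and_filterlim_at_infinity)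
  with assms show ?thesis by blast
qed

lemma crit_orbit_0 [simp]: "crit_orbit D c 0 = 0"
  by (simp add: crit_orbit_def)

lemma crit_orbit_Suc: "crit_orbit D c (Suc n) = crit_orbit D c n ^ D + c"
  by (simp add: crit_orbit_def umap_def)

lemma crit_orbit_add: "crit_orbit D c (n + k) = (umap D c ^^ k) (crit_orbit D c n)"
  by (simp add: crit_orbit_def add.commute[of n] funpow_add)

lemma orbit_deriv_Suc:
  "orbit_deriv D c (Suc k) = orbit_deriv D c k * (of_nat D * crit_orbit D c (Suc k) ^ (D - 1))"
  by (simp add: orbit_deriv_def)

lemma poly_unicritical_poly: "poly (unicritical_poly D c) = umap D c"
  by (rule ext) (simp add: unicritical_poly_def umap_def poly_monom)

lemma poly_pderiv_unicritical_poly: "poly (pderiv (unicritical_poly D c)) z = of_nat D * z ^ (D - 1)"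
  by (simp add: unicritical_poly_def pderiv_add pderiv_monom poly_monom)

lemma sphere_map_unicritical_poly_funpow:
  "(sphere_map (unicritical_poly D c) ^^ n) (Some z) = Some ((umap D c ^^ n) z)"
  by (induction n) (simp_all add: sphere_map_def poly_unicritical_poly)

text \<open>
  The left side is \<open>b (dz)^2 / (z - x)\<close> in the coordinate \<open>w = 1 / z\<close>. In a sum of such terms the
  poles of order 3 and 2 cancel once the sums of the \<open>b\<close> and of the \<open>b * x\<close> vanish.
\<close>

lemma pole_expansion_at_infinity:
  fixes w x b :: complex
  assumes "w \<noteq> 0" "1 - x * w \<noteq> 0"
  shows "b / ((1 - x * w) / w) / w ^ 4 = b / w ^ 3 + b * x / w\<^sup>2 + b * x\<^sup>2 / (1 - x * w) / w"
proof -
  define u where "u = 1 - x * w"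
  have u: "u \<noteq> 0" using assms by (simp add: u_def)
  have "b / w ^ 3 + b * x / w\<^sup>2 + b * x\<^sup>2 / u / w = b * (u + x * w * u + x\<^sup>2 * w\<^sup>2) / (u * w ^ 3)"
  proof -
    have "b / w ^ 3 = b * u / (u * w ^ 3)" using u by simp
    moreover have "b * x / w\<^sup>2 = b * (x * w * u) / (u * w ^ 3)"
      using u assms by (simp add: power2_eq_square power3_eq_cube)
    moreover have "b * x\<^sup>2 / u / w = b * (x\<^sup>2 * w\<^sup>2) / (u * w ^ 3)"
      using u assms by (simp add: power2_eq_square power3_eq_cube)
    ultimately show ?thesis by (simp add: add_divide_distrib distrib_left)
  qed
  also have "u + x * w * u + x\<^sup>2 * w\<^sup>2 = 1" by (simp add: u_def algebra_simps power2_eq_square)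
  also have "b * 1 / (u * w ^ 3) = b / (u / w) / w ^ 4"
    using assms u by (simp add: divide_simps power3_eq_cube power4_eq_xxxx)
  finally show ?thesis by (simp add: u_def)
qed

text \<open>
  On a combination of the differentials \<open>(dz)^2 / (z - x)\<close>, with \<open>x\<close> running through the periodic
  critical orbit, the pushforward moves each pole one step along the orbit, divides its residue by
  \<open>f'(x)\<close>, and puts the opposite residue at the critical value; a pole at 0 disappears. Being an
  eigenvector for \<open>1 / s\<close> forces the residue at the \<open>k\<close>-th point after the critical value to be
  \<open>s^k\<close> over the derivative of the \<open>k\<close>-th iterate, up to a common factor, and the residues must add
  up to 0. This condition also makes the double pole at infinity disappear, unless \<open>s = D\<close>: the
  pushforward acts on the coefficient of that pole as multiplication by \<open>1 / D\<close>.
\<close>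

lemma eigenvalue_criterion:
  assumes D: "2 \<le> D" and period: "crit_orbit D c (Suc m) = 0"
    and nz: "\<And>k. 1 \<le> k \<Longrightarrow> k \<le> m \<Longrightarrow> crit_orbit D c k \<noteq> 0"
    and root: "(\<Sum>k\<le>m. s ^ k / orbit_deriv D c k) = 0"
    and s: "s \<noteq> 0" "s \<noteq> of_nat D"
  shows "1 / s \<in> Sigma_set D"
proof -
  define X where "X i = crit_orbit D c (Suc i)" for i
  define B where "B i = s ^ i / orbit_deriv D c i" for i
  define I where "I = {..<Suc m}"
  have finI [simp]: "finite I" by (simp add: I_def)
  have X0: "X 0 = c" using D by (simp add: X_def crit_orbit_Suc)
  have XSuc: "X (Suc i) = X i ^ D + c" for i by (simp add: X_def crit_orbit_Suc)
  have Xm: "X m = 0" using period by (simp add: X_def)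
  have Xnz: "X i \<noteq> 0" if "i < m" for i using nz[of "Suc i"] that by (simp add: X_def)
  have B0: "B 0 = 1" by (simp add: B_def orbit_deriv_def)
  have BSuc: "B (Suc i) = s * (B i / (of_nat D * X i ^ (D - 1)))" for i
    by (simp add: B_def orbit_deriv_Suc X_def)
  have sumB: "(\<Sum>i\<in>I. B i) = 0" using root by (simp add: B_def I_def lessThan_Suc_atMost)
  have powD: "a ^ D = a ^ (D - 1) * a" for a :: complex
    using D by (metis Suc_1 Suc_le_D diff_Suc_1 power_Suc2)
  have injX: "inj_on X I"
  proof (rule linorder_inj_onI')
    fix i j assume ij: "i \<in> I" "j \<in> I" "i < j"
    show "X i \<noteq> X j"
    proof
      assume "X i = X j"
      then have "(umap D c ^^ (m - j)) (X i) = (umap D c ^^ (m - j)) (X j)" by simp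
      then have "crit_orbit D c (Suc i + (m - j)) = crit_orbit D c (Suc j + (m - j))"
        unfolding X_def crit_orbit_add by simp
      moreover have "Suc j + (m - j) = Suc m" using ij by (simp add: I_def)
      ultimately have "crit_orbit D c (Suc i + (m - j)) = 0" using period by metis
      moreover have "Suc i + (m - j) \<le> m" using ij unfolding I_def by auto
      ultimately show False using nz[of "Suc i + (m - j)"] by simp
    qed
  qed
  \<comment> \<open>Index \<open>i\<close> stands for the point \<open>f^i(c)\<close>. The recursions for \<open>B\<close> and \<open>X\<close> show that the sum \<open>\<mu>\<close> satisfies
    \<open>\<mu> / s = \<mu> / D\<close>, and \<open>s\<close> differs from \<open>D\<close>.\<close>
  have sumBX: "(\<Sum>i\<in>I. B i * X i) = 0"
  proof -
    have step: "B (Suc i) * X (Suc i) / s = B i * X i / of_nat D + c / s * B (Suc i)" if "i < m" for i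
      using Xnz[OF that] s D unfolding BSuc XSuc powD[of "X i"]
      by (simp add: field_simps)
    have "(\<Sum>i\<in>I. B i * X i) / s = B 0 * X 0 / s + (\<Sum>i<m. B (Suc i) * X (Suc i) / s)"
      by (simp add: I_def sum.lessThan_Suc_shift sum_divide_distrib add_divide_distrib del: sum.lessThan_Suc)
    also have "(\<Sum>i<m. B (Suc i) * X (Suc i) / s) = (\<Sum>i<m. B i * X i / of_nat D + c / s * B (Suc i))"
      by (intro sum.cong refl step) simp
    also have "\<dots> = (\<Sum>i<m. B i * X i) / of_nat D + c / s * (\<Sum>i<m. B (Suc i))"
      by (simp add: sum.distrib sum_distrib_left sum_divide_distrib)
    also have "(\<Sum>i<m. B i * X i) = (\<Sum>i\<in>I. B i * X i)" by (simp add: I_def Xm)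
    also have "B 0 * X 0 / s + ((\<Sum>i\<in>I. B i * X i) / of_nat D + c / s * (\<Sum>i<m. B (Suc i)))
       = (\<Sum>i\<in>I. B i * X i) / of_nat D + c / s * (\<Sum>i\<in>I. B i)"
      by (simp add: I_def sum.lessThan_Suc_shift X0 algebra_simps del: sum.lessThan_Suc)
    finally have "(\<Sum>i\<in>I. B i * X i) / s = (\<Sum>i\<in>I. B i * X i) / of_nat D" using sumB by simp
    then show ?thesis using s D by (simp add: field_simps)
  qed

  define M where "M = (\<Prod>j\<in>I. [:- X j, 1:])"
  define N where "N = (\<Sum>i\<in>I. smult (B i) (\<Prod>j\<in>I - {i}. [:- X j, 1:]))"
  define q where "q = Fract N M"
  have M0: "M \<noteq> 0" by (simp add: M_def)
  have polyM: "poly M z \<noteq> 0" if "z \<notin> X ` I" for z using that by (auto simp: M_def poly_prod)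
  have rat_q: "rat_eval q z = (\<Sum>i\<in>I. B i / (z - X i))" if z: "z \<notin> X ` I" for z
  proof -
    have "poly N z / poly M z = (\<Sum>i\<in>I. B i * (\<Prod>j\<in>I - {i}. z - X j) / poly M z)"
      by (simp add: N_def poly_sum poly_prod sum_divide_distrib)
    also have "\<dots> = (\<Sum>i\<in>I. B i / (z - X i))"
    proof (intro sum.cong refl)
      fix i assume i: "i \<in> I"
      have "poly M z = (z - X i) * (\<Prod>j\<in>I - {i}. z - X j)"
        using i by (simp add: M_def poly_prod prod.remove left_diff_distrib)
      moreover have "(\<Prod>j\<in>I - {i}. z - X j) \<noteq> 0" using z by auto
      ultimately show "B i * (\<Prod>j\<in>I - {i}. z - X j) / poly M z = B i / (z - X i)" by simp
    qed
    finally show ?thesis unfolding q_def by (simp add: rat_eval_Fract[OF M0 polyM[OF z]])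
  qed
  have q0: "q \<noteq> 0"
  proof -
    have z: "0 \<in> I" by (simp add: I_def)
    have "poly N (X 0) = (\<Sum>i\<in>I. if i = 0 then (\<Prod>j\<in>I - {0}. X 0 - X j) else 0)"
      unfolding N_def poly_sum
    proof (intro sum.cong refl)
      fix i assume i: "i \<in> I"
      show "poly (smult (B i) (\<Prod>j\<in>I - {i}. [:- X j, 1:])) (X 0)
          = (if i = 0 then (\<Prod>j\<in>I - {0}. X 0 - X j) else 0)"
        using z by (auto simp: poly_prod B0)
    qed
    also have "\<dots> = (\<Prod>j\<in>I - {0}. X 0 - X j)" using z by (simp add: sum.delta)
    also have "\<dots> \<noteq> 0" using injX z by (auto simp: inj_on_def)
    finally have "N \<noteq> 0" by auto
    then show ?thesis using M0 by (simp add: q_def Zero_fract_def eq_fract)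
  qed

  define f where "f = unicritical_poly D c"
  have crit: "poly (pderiv f) z = 0 \<longleftrightarrow> z = 0" for z
    using D by (simp add: f_def poly_pderiv_unicritical_poly)
  have post: "Some (X i) \<in> postcritical_set f" for i
  proof -
    have "(sphere_map f ^^ Suc i) (Some 0) = Some (X i)"
      unfolding f_def sphere_map_unicritical_poly_funpow X_def crit_orbit_def ..
    moreover have "Some 0 \<in> sphere_critical_points f" by (simp add: sphere_critical_points_def crit)
    ultimately show ?thesis unfolding postcritical_set_def
      by (metis (no_types, lifting) UN_iff atLeast_iff image_eqI le_add1 plus_1_eq_Suc)
  qed
  have post_inf: "None \<in> postcritical_set f"
  proof -
    have "(sphere_map f ^^ 1) None = None" by (simp add: sphere_map_def)
    moreover have "None \<in> sphere_critical_points f" by (simp add: sphere_critical_points_def)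
    ultimately show ?thesis unfolding postcritical_set_def
      by (metis (no_types, lifting) UN_iff atLeast_iff image_eqI order_refl)
  qed

  have Qf: "q \<in> quad_diffs f"
    unfolding quad_diffs_def
  proof (intro CollectI allI impI)
    fix x assume pole: "is_pole (qd_local q x) 0"
    show "zorder (qd_local q x) 0 = -1 \<and> x \<in> postcritical_set f"
    proof (cases x)
      case None
      define S where "S = {w. \<forall>j\<in>I. 1 - X j * w \<noteq> 0}"
      define g where "g w = (\<Sum>i\<in>I. B i * (X i)\<^sup>2 / (1 - X i * w))" for w
      have "open S"
      proof -
        have "S = (\<Inter>j\<in>I. {w. 1 - X j * w \<noteq> 0})" by (auto simp: S_def)
        then show ?thesis by (auto intro!: open_INT open_Collect_neq continuous_intros)
      qed
      moreover have "0 \<in> S" by (simp add: S_def)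
      moreover have "g holomorphic_on S"
        unfolding g_def S_def by (intro holomorphic_intros) auto
      moreover have "qd_local q x w = g w / w" if w: "w \<in> S" "w \<noteq> 0" for w
      proof -
        have "1 / w \<notin> X ` I" using w by (auto simp: S_def field_simps)
        then have "qd_local q x w = (\<Sum>i\<in>I. B i / (1 / w - X i)) / w ^ 4"
          using None rat_q by simp
        also have "\<dots> = (\<Sum>i\<in>I. B i / w ^ 3 + B i * X i / w\<^sup>2 + B i * (X i)\<^sup>2 / (1 - X i * w) / w)"
          unfolding sum_divide_distrib
        proof (intro sum.cong refl)
          fix i assume "i \<in> I"
          then have "1 - X i * w \<noteq> 0" using w by (auto simp: S_def)
          then have "B i / ((1 - X i * w) / w) / w ^ 4
              = B i / w ^ 3 + B i * X i / w\<^sup>2 + B i * (X i)\<^sup>2 / (1 - X i * w) / w"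
            by (rule pole_expansion_at_infinity[OF w(2)])
          moreover have "1 / w - X i = (1 - X i * w) / w" using w by (simp add: diff_divide_distrib)
          ultimately show "B i / (1 / w - X i) / w ^ 4
              = B i / w ^ 3 + B i * X i / w\<^sup>2 + B i * (X i)\<^sup>2 / (1 - X i * w) / w" by simp
        qed
        also have "\<dots> = (\<Sum>i\<in>I. B i) / w ^ 3 + (\<Sum>i\<in>I. B i * X i) / w\<^sup>2 + g w / w"
          by (simp add: sum.distrib sum_divide_distrib g_def)
        finally show ?thesis by (simp add: sumB sumBX)
      qed
      ultimately have "zorder (qd_local q x) 0 = -1" using pole by (rule at_worst_simple_pole)
      then show ?thesis using post_inf None by simp
    next
      case (Some a)
      define S where "S = {w. \<forall>j\<in>I. X j \<noteq> a \<longrightarrow> a + w \<noteq> X j}"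
      have opS: "open S"
      proof -
        have "S = (\<Inter>j\<in>{j\<in>I. X j \<noteq> a}. {w. a + w \<noteq> X j})" by (auto simp: S_def)
        then show ?thesis by (auto intro!: open_INT open_Collect_neq continuous_intros)
      qed
      have zS: "0 \<in> S" by (simp add: S_def)
      have "a \<in> X ` I"
      proof (rule ccontr)
        assume a: "a \<notin> X ` I"
        define g where "g w = (\<Sum>i\<in>I. B i / (a + w - X i))" for w
        have "g holomorphic_on S"
          unfolding g_def S_def by (intro holomorphic_intros) (use a in auto)
        then have "(g \<longlongrightarrow> g 0) (at 0)"
          using opS zS by (metis continuous_on_eq_continuous_at holomorphic_on_imp_continuous_on isContD)
        moreover have "\<forall>\<^sub>F w in at 0. g w = qd_local q x w"
        proof -
          have "\<forall>\<^sub>F w in at 0. w \<in> S" using opS zS by (metis eventually_at_topological)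
          then show ?thesis
          proof eventually_elim
            case (elim w)
            then have "a + w \<notin> X ` I" using a by (auto simp: S_def)
            then show ?case using Some rat_q by (simp add: g_def)
          qed
        qed
        ultimately have "(qd_local q x \<longlongrightarrow> g 0) (at 0)" by (rule Lim_transform_eventually)
        then show False using pole unfolding is_pole_def
          by (metis at_neq_bot not_tendsto_and_filterlim_at_infinity)
      qed
      then obtain k where k: "k \<in> I" "a = X k" by auto
      define g where "g w = B k + w * (\<Sum>i\<in>I - {k}. B i / (a + w - X i))" for w
      have "g holomorphic_on S"
        unfolding g_def S_def by (intro holomorphic_intros) (use k injX in \<open>auto simp: inj_on_def\<close>)
      moreover have "qd_local q x w = g w / w" if w: "w \<in> S" "w \<noteq> 0" for w
      proof -
        have "a + w \<notin> X ` I" using w k by (auto simp: S_def)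
        then have "qd_local q x w = (\<Sum>i\<in>I. B i / (a + w - X i))" using Some rat_q by simp
        also have "\<dots> = B k / w + (\<Sum>i\<in>I - {k}. B i / (a + w - X i))"
          using k by (simp add: sum.remove)
        also have "\<dots> = g w / w" using w by (simp add: g_def add_divide_distrib)
        finally show ?thesis .
      qed
      ultimately have "zorder (qd_local q x) 0 = -1" using opS zS pole by (metis at_worst_simple_pole)
      then show ?thesis using post k Some by simp
    qed
  qed

  have push: "pushforward f q = to_fract [:1 / s:] * q"
  proof (rule pushforward_eqI)
    define E where "E = X ` {..Suc m}"
    have "finite E" by (simp add: E_def)
    then have "\<forall>\<^sub>F y in cofinite. y \<notin> E" by (simp add: eventually_cofinite)
    then show "\<forall>\<^sub>F y in cofinite. rat_eval (to_fract [:1 / s:] * q) y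
        = (\<Sum>x | poly f x = y. rat_eval q x / (poly (pderiv f) x)\<^sup>2)"
    proof eventually_elim
      case (elim y)
      have yX: "y \<noteq> X i" if "i \<le> Suc m" for i using elim that by (auto simp: E_def)
      have yI: "y \<notin> X ` I" by (metis I_def imageE lessThan_iff less_imp_le yX)
      have yc: "y - c \<noteq> 0" using yX[of 0] X0 by auto
      have yXD: "y - c \<noteq> X i ^ D" if "i \<in> I" for i
        using yX[of "Suc i"] that XSuc[of i] by (auto simp: I_def algebra_simps)
      have fib: "{x. poly f x = y} = {x. x ^ D = y - c}"
        by (auto simp: f_def poly_unicritical_poly umap_def algebra_simps)
      have "(\<Sum>x | poly f x = y. rat_eval q x / (poly (pderiv f) x)\<^sup>2)
          = (\<Sum>x | x ^ D = y - c. \<Sum>i\<in>I. B i * (1 / ((x - X i) * (of_nat D * x ^ (D - 1))\<^sup>2)))"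
        unfolding fib
      proof (intro sum.cong refl)
        fix x assume x: "x \<in> {x. x ^ D = y - c}"
        have "x \<notin> X ` I"
        proof
          assume "x \<in> X ` I"
          then obtain i where "i \<in> I" "x = X i" by blast
          then show False using yXD[of i] x by simp
        qed
        then show "rat_eval q x / (poly (pderiv f) x)\<^sup>2
            = (\<Sum>i\<in>I. B i * (1 / ((x - X i) * (of_nat D * x ^ (D - 1))\<^sup>2)))"
          by (simp add: rat_q f_def poly_pderiv_unicritical_poly sum_divide_distrib)
      qed
      also have "\<dots> = (\<Sum>i\<in>I. B i * (\<Sum>x | x ^ D = y - c. 1 / ((x - X i) * (of_nat D * x ^ (D - 1))\<^sup>2)))"
        by (subst sum.swap) (simp add: sum_distrib_left)
      also have "\<dots> = (\<Sum>i\<in>I. B i * (X i / (of_nat D * (y - c) * (y - c - X i ^ D))))"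
        by (intro sum.cong refl) (simp only: pushforward_simple_pole[OF D yc yXD])
      also have "\<dots> = (\<Sum>i<m. B i * (X i / (of_nat D * (y - c) * (y - c - X i ^ D))))"
        by (simp add: I_def Xm)
      also have "\<dots> = (\<Sum>i<m. B (Suc i) * (1 / (y - X (Suc i)) - 1 / (y - X 0)) / s)"
      proof (intro sum.cong refl)
        fix i assume i: "i \<in> {..<m}"
        then have 1: "X i \<noteq> 0" "y - c - X i ^ D \<noteq> 0" using Xnz yXD[of i] by (auto simp: I_def)
        have 2: "y - X (Suc i) = y - c - X i ^ D" by (simp add: XSuc)
        have "1 / (y - X (Suc i)) - 1 / (y - X 0) = X i ^ D / ((y - c) * (y - c - X i ^ D))"
          unfolding 2 X0 using 1 yc by (simp add: divide_simps)
        then have "B (Suc i) * (1 / (y - X (Suc i)) - 1 / (y - X 0)) / s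
            = B i / (of_nat D * X i ^ (D - 1)) * (X i ^ D / ((y - c) * (y - c - X i ^ D)))"
          using s by (simp add: BSuc)
        also have "\<dots> = B i * (X i / (of_nat D * (y - c) * (y - c - X i ^ D)))"
          unfolding powD[of "X i"] using 1 yc D by simp
        finally show "B i * (X i / (of_nat D * (y - c) * (y - c - X i ^ D)))
            = B (Suc i) * (1 / (y - X (Suc i)) - 1 / (y - X 0)) / s" ..
      qed
      also have "\<dots> = (\<Sum>i\<in>I. B i * (1 / (y - X i) - 1 / (y - X 0)) / s)"
        by (simp add: I_def sum.lessThan_Suc_shift del: sum.lessThan_Suc)
      also have "\<dots> = (\<Sum>i\<in>I. B i / (y - X i)) / s - (\<Sum>i\<in>I. B i) / (y - X 0) / s"
        by (simp add: sum_divide_distrib sum_subtractf[symmetric] algebra_simps diff_divide_distrib)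
      also have "\<dots> = rat_eval q y / s" by (simp add: sumB rat_q[OF yI])
      also have "\<dots> = rat_eval (to_fract [:1 / s:] * q) y"
      proof -
        have "to_fract [:1 / s:] * q = Fract ([:1 / s:] * N) M" by (simp add: q_def to_fract_def)
        then show ?thesis
          using polyM[OF yI] by (simp add: rat_eval_Fract[OF M0] q_def)
      qed
      finally show ?case ..
    qed
  qed

  have "degree f = D" using D by (simp add: f_def unicritical_poly_def degree_add_eq_left degree_monom_eq)
  moreover have "unicritical f" by (simp add: unicritical_def crit)
  moreover have "periodic_critical_point f"
    unfolding periodic_critical_point_def periodic_point_def
    by (rule exI[of _ 0], intro conjI exI[of _ "Suc m"])
       (use period crit in \<open>simp_all add: f_def poly_unicritical_poly crit_orbit_def del: funpow.simps\<close>)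
  moreover have "pushforward_eigenvalue f (1 / s)"
    unfolding pushforward_eigenvalue_def using Qf q0 push by blast
  ultimately show ?thesis unfolding Sigma_set_def by blast
qed

section \<open>Accumulation of zeros on a circle\<close>

text \<open>
  Finitely many members of the sequence cannot spoil the uniform bounds, by compactness.
\<close>

lemma Montel_eventually:
  fixes F :: "nat \<Rightarrow> complex \<Rightarrow> complex"
  assumes "open S" and hol: "\<And>j. F j holomorphic_on S"
    and bnd: "\<And>K. compact K \<Longrightarrow> K \<subseteq> S \<Longrightarrow> \<exists>B. \<forall>\<^sub>F j in sequentially. \<forall>z\<in>K. cmod (F j z) \<le> B"
  obtains g r where "g holomorphic_on S" "strict_mono (r :: nat \<Rightarrow> nat)"
    "\<And>z. z \<in> S \<Longrightarrow> (\<lambda>n. F (r n) z) \<longlonglongrightarrow> g z"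
    "\<And>K. compact K \<Longrightarrow> K \<subseteq> S \<Longrightarrow> uniform_limit K (F \<circ> r) g sequentially"
proof (rule Montel[OF \<open>open S\<close>, of "range F" F])
  fix K assume K: "compact K" "K \<subseteq> S"
  obtain B N where B: "\<And>j z. j \<ge> N \<Longrightarrow> z \<in> K \<Longrightarrow> cmod (F j z) \<le> B"
    using bnd[OF K] unfolding eventually_sequentially by metis
  have "\<exists>b. \<forall>z\<in>K. cmod (F j z) \<le> b" for j
  proof -
    have "compact (F j ` K)"
      using K hol by (meson compact_continuous_image continuous_on_subset holomorphic_on_imp_continuous_on)
    then show ?thesis by (meson bounded_iff compact_imp_bounded imageI)
  qed
  then obtain b where b: "\<And>j z. z \<in> K \<Longrightarrow> cmod (F j z) \<le> b j" by metis
  have "cmod (F j z) \<le> max B (Max (b ` {..N}))" if "z \<in> K" for j z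
  proof (cases "j \<ge> N")
    case False
    then have "b j \<le> Max (b ` {..N})" by (intro Max_ge) auto
    then show ?thesis using b[OF that, of j] by linarith
  qed (use B that in \<open>simp add: le_max_iff_disj\<close>)
  then show "\<exists>B. \<forall>h\<in>range F. \<forall>z\<in>K. cmod (h z) \<le> B" by auto
qed (use hol in auto)

lemma compact_subset_ball_norm_bound:
  fixes K :: "complex set"
  assumes "compact K" "K \<subseteq> ball 0 R" "0 < R"
  obtains r where "0 < r" "r < R" "\<And>z. z \<in> K \<Longrightarrow> cmod z \<le> r"
proof (cases "K = {}")
  case True
  then show ?thesis using that[of "R / 2"] assms by auto
next
  case False
  then obtain z where z: "z \<in> K" "\<And>y. y \<in> K \<Longrightarrow> cmod y \<le> cmod z"
    using continuous_attains_sup[OF assms(1) False, of cmod] by (auto intro: continuous_intros)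
  then have "cmod z < R" using assms by auto
  then show ?thesis
    using that[of "max (cmod z) (R / 2)"] z assms by (auto simp: le_max_iff_disj)
qed

text \<open>
  The geometric series bounds all the polynomials at once on a disc slightly smaller than the one in
  the hypothesis.
\<close>

lemma normal_of_coefficient_bounds:
  fixes a :: "nat \<Rightarrow> nat \<Rightarrow> complex" and m :: "nat \<Rightarrow> nat"
  assumes R: "0 < R"
    and bd: "\<And>t. 0 < t \<Longrightarrow> t < R \<Longrightarrow> \<exists>C. \<forall>\<^sub>F j in sequentially. \<forall>k\<le>m j. cmod (a j k) \<le> C / t ^ k"
    and K: "compact K" "K \<subseteq> ball 0 R"
  shows "\<exists>B. \<forall>\<^sub>F j in sequentially. \<forall>z\<in>K. cmod (\<Sum>k\<le>m j. a j k * z ^ k) \<le> B"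
proof -
  obtain r where r: "0 < r" "r < R" "\<And>z. z \<in> K \<Longrightarrow> cmod z \<le> r"
    using compact_subset_ball_norm_bound[OF K R] by blast
  define t where "t = (r + R) / 2"
  have t: "0 < t" "t < R" "r < t" using r by (auto simp: t_def)
  obtain C where C: "\<forall>\<^sub>F j in sequentially. \<forall>k\<le>m j. cmod (a j k) \<le> C / t ^ k" using bd t by blast
  have q: "0 \<le> r / t" "r / t < 1" using r t by auto
  show ?thesis
  proof (rule exI, rule eventually_mono[OF C], intro ballI)
    fix j z assume j: "\<forall>k\<le>m j. cmod (a j k) \<le> C / t ^ k" and z: "z \<in> K"
    have C0: "0 \<le> C" using order_trans[OF norm_ge_zero j[rule_format, of 0]] by simp
    have "cmod (\<Sum>k\<le>m j. a j k * z ^ k) \<le> (\<Sum>k\<le>m j. C * (r / t) ^ k)"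
    proof (rule sum_norm_le)
      fix k assume "k \<in> {..m j}"
      then have "cmod (a j k) \<le> C / t ^ k" using j by simp
      moreover have "cmod z ^ k \<le> r ^ k" using r z by (intro power_mono) auto
      ultimately have "cmod (a j k) * cmod z ^ k \<le> C / t ^ k * r ^ k"
        using C0 t by (intro mult_mono) auto
      then show "cmod (a j k * z ^ k) \<le> C * (r / t) ^ k"
        by (simp add: norm_mult norm_power power_divide)
    qed
    also have "\<dots> = C * (\<Sum>k\<le>m j. (r / t) ^ k)" by (simp add: sum_distrib_left)
    also have "\<dots> \<le> C * (\<Sum>k. (r / t) ^ k)"
      using q C0 by (intro mult_left_mono sum_le_suminf summable_geometric) auto
    finally show "cmod (\<Sum>k\<le>m j. a j k * z ^ k) \<le> C * (\<Sum>k. (r / t) ^ k)" .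
  qed
qed

lemma nonvanishing_point:
  assumes "g holomorphic_on ball (0::complex) R" "0 < R" "g 0 \<noteq> 0" "open U" "U \<noteq> {}" "U \<subseteq> ball 0 R"
  obtains u where "u \<in> U" "g u \<noteq> 0"
proof -
  have "\<exists>u\<in>U. g u \<noteq> 0"
  proof (rule ccontr)
    assume "\<not> ?thesis"
    then have "g 0 = 0"
      using analytic_continuation_open[of U "ball 0 R" g "\<lambda>_. 0" 0] assms by auto
    with assms show False by simp
  qed
  with that show ?thesis by blast
qed

text \<open>
  A theorem of Jentzsch type. The two families of bounds say that the polynomials are normal inside
  the circle and that the reversed polynomials, normalized by the top coefficient, are normal in
  \<open>1 / z\<close> outside; neither limit is identically zero, because both take the value 1 at the origin.
  Suppose that the polynomials had no zeros in a disc \<open>W\<close> about a point of the circle. Then their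
  roots of order \<open>m j\<close> exist on \<open>W\<close> and form a normal family. A limit has modulus 1 inside the
  circle, where the polynomials themselves converge, so it is constant; but outside the circle its
  modulus exceeds 1, because there the polynomials grow exponentially.
\<close>

lemma zeros_accumulate_on_circle:
  fixes a :: "nat \<Rightarrow> nat \<Rightarrow> complex" and m :: "nat \<Rightarrow> nat"
  assumes lim_m: "filterlim m at_top sequentially" and \<sigma>: "0 < \<sigma>"
    and a0: "\<And>j. a j 0 = 1" and am: "\<And>j. a j (m j) \<noteq> 0"
    and fwd: "\<And>t. 0 < t \<Longrightarrow> t < \<sigma> \<Longrightarrow>
       \<exists>C. \<forall>\<^sub>F j in sequentially. \<forall>k\<le>m j. cmod (a j k) \<le> C / t ^ k"
    and bwd: "\<And>t. \<sigma> < t \<Longrightarrow>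
       \<exists>C. \<forall>\<^sub>F j in sequentially. \<forall>k\<le>m j. cmod (a j (m j - k)) \<le> C * t ^ k * cmod (a j (m j))"
    and s0: "cmod s0 = \<sigma>" and \<eta>: "0 < \<eta>"
  shows "\<exists>j s. cmod (s - s0) < \<eta> \<and> (\<Sum>k\<le>m j. a j k * s ^ k) = 0"
proof (rule ccontr)
  assume contra: "\<not> ?thesis"
  define P where "P j z = (\<Sum>k\<le>m j. a j k * z ^ k)" for j z
  define Q where "Q j z = (\<Sum>k\<le>m j. a j (m j - k) / a j (m j) * z ^ k)" for j z
  define W where "W = ball s0 \<eta>"
  have opW: "open W" "connected W" "convex W" by (auto simp: W_def)
  have Pnz: "P j z \<noteq> 0" if "z \<in> W" for j z
    using contra that by (auto simp: W_def P_def dist_norm norm_minus_commute)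
  have P_Q: "P j z = a j (m j) * z ^ m j * Q j (1 / z)" if "z \<noteq> 0" for j z
  proof -
    have "P j z = (\<Sum>k\<le>m j. a j (m j - k) * z ^ (m j - k))"
      unfolding P_def by (rule sum.reindex_bij_witness[where i = "\<lambda>k. m j - k" and j = "\<lambda>k. m j - k"]) auto
    also have "\<dots> = (\<Sum>k\<le>m j. a j (m j) * z ^ m j * (a j (m j - k) / a j (m j) * (1 / z) ^ k))"
      using that am by (intro sum.cong refl) (simp add: power_diff divide_simps)
    finally show ?thesis by (simp add: Q_def sum_distrib_left)
  qed
  have holP: "P j holomorphic_on A" for j A unfolding P_def by (intro holomorphic_intros)
  have holQ: "Q j holomorphic_on A" for j A unfolding Q_def by (intro holomorphic_intros) (use am in auto)

  obtain g r1 where g: "g holomorphic_on ball 0 \<sigma>" "strict_mono (r1 :: nat \<Rightarrow> nat)"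
      "\<And>z. z \<in> ball 0 \<sigma> \<Longrightarrow> (\<lambda>n. P (r1 n) z) \<longlonglongrightarrow> g z"
  proof (rule Montel_eventually[of "ball 0 \<sigma>" P])
    show "\<exists>B. \<forall>\<^sub>F j in sequentially. \<forall>z\<in>K. cmod (P j z) \<le> B" if "compact K" "K \<subseteq> ball 0 \<sigma>" for K
      unfolding P_def by (rule normal_of_coefficient_bounds[OF \<sigma> fwd that])
  qed (use holP in auto)
  have bwd': "\<exists>C. \<forall>\<^sub>F j in sequentially. \<forall>k\<le>m j. cmod (a j (m j - k) / a j (m j)) \<le> C / t ^ k"
    if t: "0 < t" "t < 1 / \<sigma>" for t
  proof -
    have "\<sigma> < 1 / t" using t \<sigma> by (simp add: field_simps)
    then obtain C where "\<forall>\<^sub>F j in sequentially. \<forall>k\<le>m j. cmod (a j (m j - k)) \<le> C * (1 / t) ^ k * cmod (a j (m j))"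
      using bwd by blast
    then have "\<forall>\<^sub>F j in sequentially. \<forall>k\<le>m j. cmod (a j (m j - k) / a j (m j)) \<le> C / t ^ k"
      by eventually_elim (use am in \<open>simp add: norm_divide field_simps\<close>)
    then show ?thesis by blast
  qed
  have normalQ: "\<exists>B. \<forall>\<^sub>F j in sequentially. \<forall>z\<in>K. cmod (Q j z) \<le> B" if "compact K" "K \<subseteq> ball 0 (1 / \<sigma>)" for K
    unfolding Q_def by (rule normal_of_coefficient_bounds[OF _ bwd' that]) (use \<sigma> in auto)
  obtain G r2 where G: "G holomorphic_on ball 0 (1 / \<sigma>)" "strict_mono (r2 :: nat \<Rightarrow> nat)"
      "\<And>z. z \<in> ball 0 (1 / \<sigma>) \<Longrightarrow> (\<lambda>n. Q (r1 (r2 n)) z) \<longlonglongrightarrow> G z"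
  proof (rule Montel_eventually[of "ball 0 (1 / \<sigma>)" "\<lambda>n. Q (r1 n)"])
    fix K assume "compact K" "K \<subseteq> ball (0::complex) (1 / \<sigma>)"
    then obtain B where "\<forall>\<^sub>F j in sequentially. \<forall>z\<in>K. cmod (Q j z) \<le> B" using normalQ by blast
    then have "\<forall>\<^sub>F j in sequentially. \<forall>z\<in>K. cmod (Q (r1 j) z) \<le> B"
      by (rule eventually_compose_filterlim[OF _ filterlim_subseq[OF g(2)]])
    then show "\<exists>B. \<forall>\<^sub>F j in sequentially. \<forall>z\<in>K. cmod (Q (r1 j) z) \<le> B" by blast
  qed (use holQ in auto)

  have "\<exists>l. l holomorphic_on W \<and> (\<forall>z\<in>W. P j z = exp (l z))" for j
  proof -
    have "simply_connected W" using opW by (simp add: convex_imp_simply_connected)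
    then show ?thesis
      using simply_connected_eq_holomorphic_log[OF opW(1)] opW(2) holP Pnz by (metis (no_types, lifting))
  qed
  then obtain l where l: "\<And>j. l j holomorphic_on W" "\<And>j z. z \<in> W \<Longrightarrow> P j z = exp (l j z)"
    by metis
  define H where "H j z = exp (l j z / of_nat (m j))" for j z
  have holH: "H j holomorphic_on W" for j
    unfolding H_def by (cases "m j = 0") (use l in \<open>auto intro!: holomorphic_intros\<close>)
  have H_pow: "cmod (H j z) ^ m j = cmod (P j z)" if "z \<in> W" "0 < m j" for j z
  proof -
    have "H j z ^ m j = exp (of_nat (m j) * (l j z / of_nat (m j)))"
      unfolding H_def by (rule exp_of_nat_mult[symmetric])
    then show ?thesis using that l by (metis (no_types, lifting) divide_self_if mult.commute mult.right_neutral neq0_conv norm_power of_nat_eq_0_iff times_divide_eq_right)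
  qed
  have ln_H: "ln (cmod (H j z)) = ln (cmod (P j z)) / real (m j)" if "z \<in> W" "0 < m j" for j z
  proof -
    have "cmod (H j z) > 0" by (simp add: H_def)
    then show ?thesis using H_pow[OF that, symmetric] that by (simp add: ln_realpow)
  qed
  \<comment> \<open>For \<open>m j > 0\<close>, \<open>H j\<close> is a root of order \<open>m j\<close> of \<open>P j\<close> on \<open>W\<close>.\<close>
  have m_pos: "\<forall>\<^sub>F j in sequentially. 0 < m j"
    using lim_m[unfolded filterlim_at_top, rule_format, of 1] by eventually_elim simp
  obtain C1 where C1: "\<forall>\<^sub>F j in sequentially. \<forall>k\<le>m j. cmod (a j k) \<le> C1 / (\<sigma> / 2) ^ k"
    using fwd[of "\<sigma> / 2"] \<sigma> by auto
  define R where "R = (cmod s0 + \<eta>) / (\<sigma> / 2) + 1"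
  have R1: "1 \<le> R" using \<sigma> \<eta> by (simp add: R_def)
  define C2 where "C2 = max C1 1"
  have bndH: "\<forall>\<^sub>F j in sequentially. \<forall>z\<in>W. cmod (H j z) \<le> C2 * (2 * R)"
    using C1 m_pos
  proof eventually_elim
    case (elim j)
    show ?case
    proof
      fix z assume z: "z \<in> W"
      have zb: "cmod z \<le> cmod s0 + \<eta>"
        using z norm_triangle_sub[of z s0] by (simp add: W_def dist_norm norm_minus_commute)
      have "cmod (P j z) \<le> (\<Sum>k\<le>m j. C2 * R ^ m j)"
        unfolding P_def
      proof (rule sum_norm_le)
        fix k assume k: "k \<in> {..m j}"
        have "cmod (a j k * z ^ k) \<le> C1 / (\<sigma> / 2) ^ k * (cmod s0 + \<eta>) ^ k"
          unfolding norm_mult norm_power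
          using elim k zb by (intro mult_mono power_mono) (auto intro: order_trans[OF norm_ge_zero])
        also have "\<dots> = C1 * ((cmod s0 + \<eta>) / (\<sigma> / 2)) ^ k"
          unfolding power_divide[of "cmod s0 + \<eta>"] by simp
        also have "\<dots> \<le> C2 * R ^ k"
          using \<sigma> \<eta> by (intro mult_mono power_mono) (auto simp: C2_def R_def)
        also have "\<dots> \<le> C2 * R ^ m j"
          using k R1 by (intro mult_left_mono power_increasing) (auto simp: C2_def)
        finally show "cmod (a j k * z ^ k) \<le> C2 * R ^ m j" .
      qed
      also have "\<dots> = real (Suc (m j)) * C2 * R ^ m j" by simp
      also have "\<dots> \<le> 2 ^ m j * C2 ^ m j * R ^ m j"
      proof (intro mult_mono)
        have "Suc (m j) \<le> 2 ^ m j" using less_exp[of "m j"] by (rule Suc_leI)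
        then show "real (Suc (m j)) \<le> 2 ^ m j"
          by (metis of_nat_le_iff of_nat_numeral of_nat_power)
        show "C2 \<le> C2 ^ m j" using elim by (intro self_le_power) (auto simp: C2_def)
      qed (use R1 in \<open>auto simp: C2_def\<close>)
      also have "\<dots> = (C2 * (2 * R)) ^ m j" by (simp add: power_mult_distrib)
      finally have "cmod (H j z) ^ m j \<le> (C2 * (2 * R)) ^ m j" using H_pow z elim by simp
      then show "cmod (H j z) \<le> C2 * (2 * R)"
        using elim R1 by (subst (asm) power_mono_iff) (auto simp: C2_def)
    qed
  qed
  obtain h r3 where h: "h holomorphic_on W" "strict_mono (r3 :: nat \<Rightarrow> nat)"
      "\<And>z. z \<in> W \<Longrightarrow> (\<lambda>n. H (r1 (r2 (r3 n))) z) \<longlonglongrightarrow> h z"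
  proof (rule Montel_eventually[of W "\<lambda>n. H (r1 (r2 n))"])
    fix K assume K: "compact K" "K \<subseteq> W"
    have "\<forall>\<^sub>F j in sequentially. \<forall>z\<in>W. cmod (H (r1 (r2 j)) z) \<le> C2 * (2 * R)"
      using bndH filterlim_compose[OF filterlim_subseq[OF g(2)] filterlim_subseq[OF G(2)]]
      by (rule eventually_compose_filterlim)
    then show "\<exists>B. \<forall>\<^sub>F j in sequentially. \<forall>z\<in>K. cmod (H (r1 (r2 j)) z) \<le> B"
      by (intro exI, eventually_elim) (use K in auto)
  qed (use holH opW in auto)
  define r where "r n = r1 (r2 (r3 n))" for n
  have r: "filterlim r at_top sequentially"
    unfolding r_def by (intro filterlim_compose[OF filterlim_subseq[OF g(2)]] filterlim_compose[OF filterlim_subseq[OF G(2)]] filterlim_subseq[OF h(2)])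
  have limP: "(\<lambda>n. P (r n) z) \<longlonglongrightarrow> g z" if "z \<in> ball 0 \<sigma>" for z
    unfolding r_def using filterlim_compose[OF g(3)[OF that] filterlim_compose[OF filterlim_subseq[OF G(2)] filterlim_subseq[OF h(2)]]] by simp
  have limQ: "(\<lambda>n. Q (r n) z) \<longlonglongrightarrow> G z" if "z \<in> ball 0 (1 / \<sigma>)" for z
    unfolding r_def using filterlim_compose[OF G(3)[OF that] filterlim_subseq[OF h(2)]] by simp
  have limH: "(\<lambda>n. H (r n) z) \<longlonglongrightarrow> h z" if "z \<in> W" for z
    unfolding r_def using h(3)[OF that] .
  have mr: "filterlim (\<lambda>n. real (m (r n))) at_top sequentially"
    by (intro filterlim_compose[OF filterlim_real_sequentially] filterlim_compose[OF lim_m r])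
  have mr_pos: "\<forall>\<^sub>F n in sequentially. 0 < m (r n)"
    using m_pos r by (rule eventually_compose_filterlim)
  have g0: "g 0 = 1"
  proof -
    have "P j 0 = 1" for j using a0 unfolding P_def by (simp add: power_0_left if_distrib sum.delta cong: if_cong)
    then have "(\<lambda>n. P (r n) 0) \<longlonglongrightarrow> 1" by simp
    then show ?thesis using limP[of 0] \<sigma> LIMSEQ_unique by auto
  qed
  have G0: "G 0 = 1"
  proof -
    have "Q j 0 = 1" for j using am unfolding Q_def by (simp add: power_0_left if_distrib sum.delta cong: if_cong)
    then have "(\<lambda>n. Q (r n) 0) \<longlonglongrightarrow> 1" by simp
    then show ?thesis using limQ[of 0] \<sigma> LIMSEQ_unique by auto
  qed
  have ln_over: "(\<lambda>n. ln (cmod (f n)) / real (m (r n))) \<longlonglongrightarrow> 0" if "f \<longlonglongrightarrow> y" "y \<noteq> 0" for f :: "nat \<Rightarrow> complex" and y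
  proof -
    have "(\<lambda>n. ln (cmod (f n))) \<longlonglongrightarrow> ln (cmod y)" using that by (intro tendsto_intros) auto
    then show ?thesis by (rule real_tendsto_divide_at_top[OF _ mr])
  qed
  have inner: "cmod (h z) = 1" if z: "z \<in> W" "cmod z < \<sigma>" "g z \<noteq> 0" for z
  proof -
    have "(\<lambda>n. ln (cmod (P (r n) z)) / real (m (r n))) \<longlonglongrightarrow> 0"
      using z limP by (intro ln_over) auto
    moreover have "\<forall>\<^sub>F n in sequentially. ln (cmod (P (r n) z)) / real (m (r n)) = ln (cmod (H (r n) z))"
      using mr_pos by eventually_elim (use ln_H z in simp)
    ultimately have "(\<lambda>n. ln (cmod (H (r n) z))) \<longlonglongrightarrow> 0" by (rule Lim_transform_eventually)
    then have "(\<lambda>n. exp (ln (cmod (H (r n) z)))) \<longlonglongrightarrow> exp 0" by (intro tendsto_intros)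
    moreover have "exp (ln (cmod (H (r n) z))) = cmod (H (r n) z)" for n by (simp add: H_def)
    ultimately have "(\<lambda>n. cmod (H (r n) z)) \<longlonglongrightarrow> 1" by simp
    then show ?thesis using limH[OF z(1)] LIMSEQ_unique tendsto_norm by blast
  qed
  have outer: "1 < cmod (h z)" if z: "z \<in> W" "\<sigma> < cmod z" "G (1 / z) \<noteq> 0" for z
  proof -
    define t where "t = (\<sigma> + cmod z) / 2"
    have t: "\<sigma> < t" "t < cmod z" using z by (auto simp: t_def)
    have z0: "z \<noteq> 0" using z \<sigma> by auto
    obtain C where C: "\<forall>\<^sub>F j in sequentially. \<forall>k\<le>m j. cmod (a j (m j - k)) \<le> C * t ^ k * cmod (a j (m j))"
      using bwd[OF t(1)] by blast
    have C': "\<forall>\<^sub>F n in sequentially. \<forall>k\<le>m (r n). cmod (a (r n) (m (r n) - k)) \<le> C * t ^ k * cmod (a (r n) (m (r n)))"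
      using C r by (rule eventually_compose_filterlim)
    have "cmod (1 / z) < 1 / \<sigma>" using frac_less2[of 1 1 \<sigma> "cmod z"] z \<sigma> by (simp add: norm_divide)
    then have "(\<lambda>n. ln (cmod (Q (r n) (1 / z))) / real (m (r n))) \<longlonglongrightarrow> 0"
      using z limQ by (intro ln_over) auto
    moreover have "(\<lambda>n. ln (cmod (of_real \<bar>C\<bar> + 1)) / real (m (r n))) \<longlonglongrightarrow> 0"
      by (rule ln_over[OF tendsto_const]) (metis abs_ge_zero add_nonneg_eq_0_iff of_real_1 of_real_add of_real_eq_0_iff zero_le_one zero_neq_one)
    ultimately have "(\<lambda>n. ln (cmod z / t) + ln (cmod (Q (r n) (1 / z))) / real (m (r n)) - ln (cmod (of_real \<bar>C\<bar> + 1)) / real (m (r n)))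
        \<longlonglongrightarrow> ln (cmod z / t) + 0 - 0"
      by (intro tendsto_intros)
    moreover have "\<forall>\<^sub>F n in sequentially. ln (cmod z / t) + ln (cmod (Q (r n) (1 / z))) / real (m (r n))
        - ln (cmod (of_real \<bar>C\<bar> + 1)) / real (m (r n)) \<le> cmod (H (r n) z) - 1"
      using mr_pos C'
    proof eventually_elim
      case (elim n)
      define A where "A = cmod (a (r n) (m (r n)))"
      have A: "A > 0" using am by (simp add: A_def)
      \<comment> \<open>The case \<open>k = m\<close> of the bounds on the reversed coefficients bounds the top coefficient from below.\<close>
      have "1 \<le> C * t ^ m (r n) * A"
        using elim(2)[rule_format, of "m (r n)"] a0 by (simp add: A_def)
      also have "\<dots> \<le> (\<bar>C\<bar> + 1) * t ^ m (r n) * A" using t \<sigma> A by (intro mult_right_mono) auto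
      finally have "ln 1 \<le> ln ((\<bar>C\<bar> + 1) * t ^ m (r n) * A)" by (subst ln_le_cancel_iff) auto
      also have "\<dots> = ln (\<bar>C\<bar> + 1) + real (m (r n)) * ln t + ln A"
        using t \<sigma> A by (simp add: ln_mult ln_realpow add_pos_nonneg)
      finally have lnA: "ln A \<ge> - ln (\<bar>C\<bar> + 1) - real (m (r n)) * ln t" by simp
      have Qnz: "cmod (Q (r n) (1 / z)) > 0" using P_Q[OF z0, of "r n"] Pnz[OF z(1), of "r n"] by auto
      have "ln (cmod (P (r n) z)) = ln (A * cmod z ^ m (r n) * cmod (Q (r n) (1 / z)))"
        unfolding P_Q[OF z0, of "r n"] by (simp add: norm_mult norm_power A_def)
      also have "\<dots> = ln A + real (m (r n)) * ln (cmod z) + ln (cmod (Q (r n) (1 / z)))"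
        using A Qnz z0 by (simp add: ln_mult ln_realpow)
      finally have lnP: "ln (cmod (P (r n) z)) = ln A + real (m (r n)) * ln (cmod z) + ln (cmod (Q (r n) (1 / z)))" .
      have cC: "cmod (of_real \<bar>C\<bar> + 1) = \<bar>C\<bar> + 1"
        by (metis abs_ge_zero abs_of_nonneg add_nonneg_nonneg norm_of_real of_real_1 of_real_add zero_le_one)
      have "ln (cmod z / t) + ln (cmod (Q (r n) (1 / z))) / real (m (r n)) - ln (\<bar>C\<bar> + 1) / real (m (r n))
          = (- ln (\<bar>C\<bar> + 1) - real (m (r n)) * ln t + real (m (r n)) * ln (cmod z) + ln (cmod (Q (r n) (1 / z)))) / real (m (r n))"
      proof -
        have "(x - y) + q / M - d / M = (- d - M * y + M * x + q) / M" if "M \<noteq> 0" for x y q M d :: real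
          using that by (simp add: diff_divide_distrib add_divide_distrib)
        moreover have "ln (cmod z / t) = ln (cmod z) - ln t" using z0 t \<sigma> by (simp add: ln_div)
        moreover have "real (m (r n)) \<noteq> 0" using elim by simp
        ultimately show ?thesis by metis
      qed
      also have "\<dots> \<le> ln (cmod (P (r n) z)) / real (m (r n))"
        unfolding lnP using lnA by (intro divide_right_mono) auto
      also have "\<dots> = ln (cmod (H (r n) z))" using ln_H z elim by simp
      also have "\<dots> \<le> cmod (H (r n) z) - 1" by (rule ln_le_minus_one) (simp add: H_def)
      finally show ?case unfolding cC .
    qed
    moreover have "(\<lambda>n. cmod (H (r n) z) - 1) \<longlonglongrightarrow> cmod (h z) - 1"
      using limH[OF z(1)] by (intro tendsto_intros)
    ultimately have "ln (cmod z / t) + 0 - 0 \<le> cmod (h z) - 1"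
      by (intro tendsto_le[OF sequentially_bot, of "\<lambda>n. cmod (H (r n) z) - 1" "cmod (h z) - 1"
          "\<lambda>n. ln (cmod z / t) + ln (cmod (Q (r n) (1 / z))) / real (m (r n)) - ln (cmod (of_real \<bar>C\<bar> + 1)) / real (m (r n))"]) auto
    moreover have "ln (cmod z / t) > 0" using t \<sigma> by (intro ln_gt_zero) auto
    ultimately show ?thesis by linarith
  qed

  \<comment> \<open>The points \<open>s0 * (1 - e)\<close> and \<open>s0 * (1 + e)\<close> show that \<open>W\<close> meets both sides of the circle.\<close>
  define e where "e = min (\<eta> / (2 * \<sigma>)) (1 / 2)"
  have e: "0 < e" "e < 1" "e * \<sigma> < \<eta>"
  proof -
    have "e * \<sigma> \<le> \<eta> / (2 * \<sigma>) * \<sigma>" using \<sigma> by (intro mult_right_mono) (auto simp: e_def)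
    also have "\<dots> < \<eta>" using \<sigma> \<eta> by simp
    finally show "e * \<sigma> < \<eta>" .
  qed (use \<eta> \<sigma> in \<open>auto simp: e_def\<close>)
  define U where "U = W \<inter> ball 0 \<sigma>"
  have "s0 * of_real (1 - e) \<in> U"
  proof -
    have "s0 - s0 * of_real (1 - e) = s0 * of_real e" by (simp add: algebra_simps)
    then have "cmod (s0 - s0 * of_real (1 - e)) = \<sigma> * e" using s0 e by (metis abs_of_pos norm_mult norm_of_real)
    moreover have "cmod (s0 * of_real (1 - e)) = \<sigma> * (1 - e)" using s0 e by (simp only: norm_mult norm_of_real)
    ultimately show ?thesis using e \<sigma> by (simp add: U_def W_def dist_norm mult.commute)
  qed
  then have U: "open U" "U \<noteq> {}" "U \<subseteq> ball 0 \<sigma>" using opW by (auto simp: U_def)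
  obtain u where u: "u \<in> U" "g u \<noteq> 0" using nonvanishing_point[OF g(1) \<sigma> _ U] g0 by auto
  have contg: "continuous_on U g"
    using g(1) U by (meson continuous_on_subset holomorphic_on_imp_continuous_on)
  define U' where "U' = U \<inter> g -` (- {0})"
  have U': "open U'" "u \<in> U'" "U' \<subseteq> W"
    using u continuous_open_preimage[OF contg U(1), of "- {0}"] by (auto simp: U'_def U_def)
  define V where "V = ball 0 (1 / \<sigma>) \<inter> ((\<lambda>w. 1 / w) -` W \<inter> - {0})"
  have opV: "open V"
  proof -
    have "open (- {0 :: complex} \<inter> (\<lambda>w. 1 / w) -` W)"
      by (intro continuous_open_preimage opW continuous_intros) auto
    then show ?thesis unfolding V_def by (metis Int_commute open_Int open_ball)
  qed
  have "1 / (s0 * of_real (1 + e)) \<in> V"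
  proof -
    have "s0 - s0 * of_real (1 + e) = - (s0 * of_real e)" by (simp add: algebra_simps)
    then have "cmod (s0 - s0 * of_real (1 + e)) = \<sigma> * e" using s0 e by (metis abs_of_pos norm_minus_cancel norm_mult norm_of_real)
    moreover have c: "cmod (s0 * of_real (1 + e)) = \<sigma> * (1 + e)" using s0 e by (simp only: norm_mult norm_of_real)
    moreover have "1 / (\<sigma> * (1 + e)) < 1 / \<sigma>" using frac_less2[of 1 1 \<sigma> "\<sigma> * (1 + e)"] \<sigma> e by simp
    moreover have "s0 * of_real (1 + e) \<noteq> 0" using c \<sigma> e by (metis add_pos_pos less_numeral_extra(3) mult_pos_pos norm_zero zero_less_one)
    ultimately show ?thesis using e \<sigma> by (simp add: V_def W_def dist_norm norm_divide mult.commute del: of_real_add)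
  qed
  then have V: "V \<noteq> {}" "V \<subseteq> ball 0 (1 / \<sigma>)" by (auto simp: V_def)
  obtain v where v: "v \<in> V" "G v \<noteq> 0" using nonvanishing_point[OF G(1) _ _ opV V] G0 \<sigma> by auto
  have v0: "v \<noteq> 0" "1 / v \<in> W" using v by (auto simp: V_def)
  have "\<sigma> < cmod (1 / v)" using v v0 \<sigma> by (auto simp: V_def norm_divide field_simps)
  then have hv: "1 < cmod (h (1 / v))" using outer[of "1 / v"] v v0 by simp
  have hU: "h ` U' \<subseteq> sphere 0 1"
  proof clarify
    fix z assume "z \<in> U'"
    then have "z \<in> W" "cmod z < \<sigma>" "g z \<noteq> 0" by (auto simp: U'_def U_def)
    then show "h z \<in> sphere 0 1" using inner by simp
  qed
  have "\<not> h constant_on W"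
  proof
    assume "h constant_on W"
    then have "h (1 / v) = h u" using v0 U' unfolding constant_on_def by (metis subsetD)
    then show False using hv hU U' by auto
  qed
  then have "open (h ` U')" using open_mapping_thm[OF h(1) opW(1,2) U'(1,3)] by simp
  moreover have "negligible (h ` U')"
    using hU negligible_sphere negligible_subset by blast
  ultimately show False using U' open_not_negligible by blast
qed

section \<open>Backward orbits and local inverse branches\<close>

lemma umap_funpow_holomorphic: "(umap D c ^^ n) holomorphic_on A"
proof (induction n)
  case (Suc n)
  have "(umap D c ^^ Suc n) = (\<lambda>z. (umap D c ^^ n) z ^ D + c)" by (simp add: fun_eq_iff umap_def)
  with Suc show ?case by (auto intro!: holomorphic_intros)
qed (simp add: id_def)

lemma umap_funpow_fixed: "umap D c p = p \<Longrightarrow> (umap D c ^^ n) p = p"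
  by (induction n) simp_all

lemma deriv_umap_funpow_fixed:
  assumes "umap D c p = p"
  shows "((umap D c ^^ n) has_field_derivative (of_nat D * p ^ (D - 1)) ^ n) (at p)"
proof (induction n)
  case (Suc n)
  have "(umap D c has_field_derivative of_nat D * p ^ (D - 1)) (at p)"
    unfolding umap_def[abs_def] by (auto intro!: derivative_eq_intros)
  then have "(umap D c has_field_derivative of_nat D * p ^ (D - 1)) (at ((umap D c ^^ n) p))"
    by (simp only: umap_funpow_fixed[OF assms])
  from DERIV_chain[OF this Suc] show ?case by (simp add: o_def mult.commute)
qed (simp add: id_def)

text \<open>
  If backward orbits of \<open>y1\<close> stayed away from \<open>p\<close>, all iterates would omit \<open>y1\<close> near \<open>p\<close>, hence also
  its preimage \<open>y2\<close>. Omitting two values and being bounded at \<open>p\<close>, they would be uniformly bounded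
  near \<open>p\<close> by Schottky's theorem, which contradicts the growth of their derivatives at the repelling
  point.
\<close>

lemma preimages_accumulate_at_repelling:
  assumes fix_p: "umap D c p = p" and rep: "1 < cmod (of_nat D * p ^ (D - 1))"
    and y: "y1 \<noteq> y2" "umap D c y2 = y1" and e: "0 < e"
  shows "\<exists>n z. cmod (z - p) < e \<and> (umap D c ^^ n) z = y1"
proof (rule ccontr)
  assume contra: "\<not> ?thesis"
  have omit1: "(umap D c ^^ n) z \<noteq> y1" if "z \<in> ball p e" for n z
    using contra that by (auto simp: dist_norm norm_minus_commute)
  have omit2: "(umap D c ^^ n) z \<noteq> y2" if "z \<in> ball p e" for n z
    using omit1[OF that, of "Suc n"] y by auto
  define h where "h n z = ((umap D c ^^ n) z - y1) / (y2 - y1)" for n z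
  define r where "r = cmod (p - y1) / cmod (y2 - y1) + 1"
  have "0 < r" by (auto simp: r_def intro: add_nonneg_pos)
  obtain B Z where B: "0 < B" and Z: "open Z" "p \<in> Z" and ZB: "\<And>f z. f \<in> range h \<Longrightarrow> z \<in> Z \<Longrightarrow> cmod (f z) \<le> B"
  proof (rule GPicard1[of "ball p e" p r "range h" "range h"])
    show "f holomorphic_on ball p e" if "f \<in> range h" for f
      using that y unfolding h_def by (auto intro!: holomorphic_intros umap_funpow_holomorphic)
    show "f z \<noteq> 0 \<and> f z \<noteq> 1" if "f \<in> range h" "z \<in> ball p e" for f z
      using that y omit1[OF that(2)] omit2[OF that(2)] by (auto simp: h_def)
    show "cmod (f p) \<le> r" if "f \<in> range h" for f
      using that by (auto simp: h_def r_def umap_funpow_fixed[OF fix_p] norm_divide)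
  qed (use e \<open>0 < r\<close> in auto)
  obtain d where d: "0 < d" "cball p d \<subseteq> Z" using Z by (metis open_contains_cball)
  define B' where "B' = B * cmod (y2 - y1) + cmod y1"
  have "cmod (of_nat D * p ^ (D - 1)) ^ n \<le> B' / d" for n
  proof -
    have "cmod ((deriv ^^ 1) (umap D c ^^ n) p) \<le> fact 1 * B' / d ^ 1"
    proof (rule Cauchy_inequality)
      show "(umap D c ^^ n) holomorphic_on ball p d" by (rule umap_funpow_holomorphic)
      show "continuous_on (cball p d) (umap D c ^^ n)"
        by (rule holomorphic_on_imp_continuous_on) (rule umap_funpow_holomorphic)
      fix z assume "cmod (p - z) = d"
      then have "z \<in> Z" using d by (auto simp: dist_norm)
      then have "cmod (h n z) \<le> B" using ZB by blast
      then have "cmod ((umap D c ^^ n) z - y1) \<le> B * cmod (y2 - y1)"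
        using y by (simp add: h_def norm_divide field_simps)
      then show "cmod ((umap D c ^^ n) z) \<le> B'"
        using norm_triangle_sub[of "(umap D c ^^ n) z" y1] by (simp add: B'_def)
    qed (rule d)
    moreover have "deriv (umap D c ^^ n) p = (of_nat D * p ^ (D - 1)) ^ n"
      by (rule DERIV_imp_deriv) (rule deriv_umap_funpow_fixed[OF fix_p])
    ultimately show ?thesis by (simp add: norm_power)
  qed
  moreover obtain n where "B' / d < cmod (of_nat D * p ^ (D - 1)) ^ n"
    using real_arch_pow[OF rep] by blast
  ultimately show False by (meson not_le)
qed

lemma first_visit_to_0:
  assumes "(f ^^ n) z = (0::complex)"
  shows "\<exists>l. (f ^^ l) z = 0 \<and> (\<forall>i<l. (f ^^ i) z \<noteq> 0)"
  using assms exists_least_iff[of "\<lambda>l. (f ^^ l) z = 0"] by blast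

text \<open>
  Parameters are written as \<open>c = t - t^D\<close>: this makes \<open>t\<close> a fixed point of \<open>z^D + c\<close>, so that a
  fixed point is followed explicitly and no implicit function theorem is called for.
\<close>

definition fixmap :: "nat \<Rightarrow> complex \<Rightarrow> complex \<Rightarrow> complex" where
  "fixmap D t = umap D (t - t ^ D)"

lemma fixmap_fixed: "fixmap D t t = t"
  by (simp add: fixmap_def umap_def)

text \<open>
  The branch is \<open>y * exp (Ln (w') / D)\<close>, where \<open>w'\<close> is \<open>(w - c) / y^D\<close> and is close to 1. It is
  stated for substituted functions, since this is how joint holomorphy in the parameter and the
  point is used.
\<close>

lemma local_inverse_step:
  assumes D: "1 \<le> D" and y: "y \<noteq> 0" "fixmap D t0 y = y'" and \<epsilon>: "0 < \<epsilon>"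
  obtains \<delta> h ib where "0 < \<delta>" "0 < h"
    "\<And>t w. t \<in> ball t0 h \<Longrightarrow> w \<in> ball y' \<delta> \<Longrightarrow> ib t w \<in> ball y \<epsilon> \<and> fixmap D t (ib t w) = w"
    "\<And>A g. A \<subseteq> ball t0 h \<Longrightarrow> g holomorphic_on A \<Longrightarrow> g ` A \<subseteq> ball y' \<delta> \<Longrightarrow> (\<lambda>t. ib t (g t)) holomorphic_on A"
proof -
  define E where "E \<xi> = y * exp (Ln \<xi> / of_nat D)" for \<xi>
  define X where "X t w = (w - (t - t ^ D)) / y ^ D" for t w :: complex
  have "isCont E 1" unfolding E_def by (intro continuous_intros) (use D in auto)
  then obtain r0 where r0: "0 < r0" "\<And>\<xi>. cmod (\<xi> - 1) < r0 \<Longrightarrow> cmod (E \<xi> - E 1) < \<epsilon>"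
    unfolding continuous_at_eps_delta using \<epsilon> by (metis dist_norm)
  define r where "r = min r0 1"
  have r: "0 < r" "r \<le> 1" "r \<le> r0" using r0 by (auto simp: r_def)
  define d where "d = r * cmod (y ^ D) / 2"
  have d: "0 < d" using r y by (simp add: d_def)
  have "isCont (\<lambda>t. t - t ^ D) t0" by (intro continuous_intros)
  then obtain h where h: "0 < h" "\<And>t. cmod (t - t0) < h \<Longrightarrow> cmod ((t - t ^ D) - (t0 - t0 ^ D)) < d"
    unfolding continuous_at_eps_delta using d by (metis dist_norm)
  have X1: "cmod (X t w - 1) < r" if "t \<in> ball t0 h" "w \<in> ball y' d" for t w
  proof -
    have "y ^ D = y' - (t0 - t0 ^ D)" using y(2) by (auto simp: fixmap_def umap_def algebra_simps)
    then have "X t w - 1 = ((w - y') - ((t - t ^ D) - (t0 - t0 ^ D))) / y ^ D"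
      using y(1) by (simp add: X_def field_simps)
    moreover have "cmod ((w - y') - ((t - t ^ D) - (t0 - t0 ^ D))) < d + d"
      using that h(2)[of t] norm_triangle_ineq4[of "w - y'" "(t - t ^ D) - (t0 - t0 ^ D)"]
      by (auto simp: dist_norm norm_minus_commute)
    ultimately have "cmod (X t w - 1) < (d + d) / cmod (y ^ D)"
      using y(1) by (simp only: norm_divide) (simp add: divide_strict_right_mono)
    then show ?thesis using y(1) by (simp add: d_def)
  qed
  have Xpos: "X t w \<notin> \<real>\<^sub>\<le>\<^sub>0" if "t \<in> ball t0 h" "w \<in> ball y' d" for t w
  proof -
    have "cmod (1 - X t w) < 1" using X1[OF that] r by (simp add: norm_minus_commute)
    then have "Re (1 - X t w) < 1" using complex_Re_le_cmod order_le_less_trans by blast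
    then have "0 < Re (X t w)" by simp
    then show ?thesis by (auto simp: complex_nonpos_Reals_iff)
  qed
  show thesis
  proof (rule that[of d h "\<lambda>t w. E (X t w)"])
    fix t w assume tw: "t \<in> ball t0 h" "w \<in> ball y' d"
    have "cmod (E (X t w) - E 1) < \<epsilon>" using r0(2) X1[OF tw] r by force
    moreover have "E 1 = y" by (simp add: E_def)
    moreover have "fixmap D t (E (X t w)) = w"
    proof -
      have "exp (Ln (X t w) / of_nat D) ^ D = exp (of_nat D * (Ln (X t w) / of_nat D))"
        by (rule exp_of_nat_mult[symmetric])
      also have "\<dots> = X t w" using D Xpos[OF tw] by (simp add: exp_Ln) (metis Xpos exp_Ln nonpos_Reals_zero_I tw)
      finally show ?thesis using y(1)
        by (simp add: fixmap_def umap_def E_def power_mult_distrib X_def)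
    qed
    ultimately show "E (X t w) \<in> ball y \<epsilon> \<and> fixmap D t (E (X t w)) = w"
      by (simp add: dist_norm norm_minus_commute)
  next
    fix A g assume A: "A \<subseteq> ball t0 h" "g holomorphic_on A" "g ` A \<subseteq> ball y' d"
    have "X t (g t) \<notin> \<real>\<^sub>\<le>\<^sub>0" if "t \<in> A" for t using A that by (intro Xpos) auto
    then show "(\<lambda>t. E (X t (g t))) holomorphic_on A"
      unfolding E_def X_def using A D y by (intro holomorphic_intros) auto
  qed (use d h in auto)
qed

text \<open>
  Composition of the local branches along an orbit that avoids the critical point. The bounds by \<open>r\<close>
  keep the logarithms of the derivatives under control on this part of the orbit.
\<close>

lemma pullback_path:
  assumes D: "1 \<le> D"
  shows "\<And>u \<epsilon>. \<forall>i<a. (fixmap D t0 ^^ i) u \<noteq> 0 \<Longrightarrow> (fixmap D t0 ^^ a) u = y \<Longrightarrow> 0 < \<epsilon> \<Longrightarrow>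
   \<exists>\<delta> h r ib. 0 < \<delta> \<and> 0 < h \<and> 0 < r \<and>
    (\<forall>t w. t \<in> ball t0 h \<longrightarrow> w \<in> ball y \<delta> \<longrightarrow> ib t w \<in> ball u \<epsilon> \<and> (fixmap D t ^^ a) (ib t w) = w \<and>
      (\<forall>i<a. r \<le> cmod ((fixmap D t ^^ i) (ib t w)) \<and> cmod ((fixmap D t ^^ i) (ib t w)) \<le> 1 / r)) \<and>
    (\<forall>A g. A \<subseteq> ball t0 h \<longrightarrow> g holomorphic_on A \<longrightarrow> g ` A \<subseteq> ball y \<delta> \<longrightarrow> (\<lambda>t. ib t (g t)) holomorphic_on A)"
proof (induction a)
  case 0
  then show ?case
    by (intro exI[of _ \<epsilon>] exI[of _ 1] exI[of _ "\<lambda>t w. w"]) auto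
next
  case (Suc a)
  define \<epsilon>1 where "\<epsilon>1 = min \<epsilon> (cmod u / 2)"
  have u: "u \<noteq> 0" using Suc.prems(1)[rule_format, of 0] by simp
  have \<epsilon>1: "0 < \<epsilon>1" using u Suc.prems by (simp add: \<epsilon>1_def)
  obtain \<delta>1 h1 ib1 where 1: "0 < \<delta>1" "0 < h1"
    "\<And>t w. t \<in> ball t0 h1 \<Longrightarrow> w \<in> ball (fixmap D t0 u) \<delta>1 \<Longrightarrow> ib1 t w \<in> ball u \<epsilon>1 \<and> fixmap D t (ib1 t w) = w"
    "\<And>A g. A \<subseteq> ball t0 h1 \<Longrightarrow> g holomorphic_on A \<Longrightarrow> g ` A \<subseteq> ball (fixmap D t0 u) \<delta>1 \<Longrightarrow> (\<lambda>t. ib1 t (g t)) holomorphic_on A"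
    by (rule local_inverse_step[OF D u refl \<epsilon>1]; rule that; assumption)
  have u1: "\<forall>i<a. (fixmap D t0 ^^ i) (fixmap D t0 u) \<noteq> 0"
    using Suc.prems(1)[rule_format, of "Suc i" for i] by (simp add: funpow_swap1)
  have u2: "(fixmap D t0 ^^ a) (fixmap D t0 u) = y" using Suc.prems(2) by (simp add: funpow_swap1)
  from Suc.IH[OF u1 u2 1(1)] obtain \<delta>2 h2 r2 ib2 where 2: "0 < \<delta>2" "0 < h2" "0 < r2"
    and pb2: "\<forall>t w. t \<in> ball t0 h2 \<longrightarrow> w \<in> ball y \<delta>2 \<longrightarrow> ib2 t w \<in> ball (fixmap D t0 u) \<delta>1 \<and> (fixmap D t ^^ a) (ib2 t w) = w \<and>
      (\<forall>i<a. r2 \<le> cmod ((fixmap D t ^^ i) (ib2 t w)) \<and> cmod ((fixmap D t ^^ i) (ib2 t w)) \<le> 1 / r2)"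
    and hol2: "\<forall>A g. A \<subseteq> ball t0 h2 \<longrightarrow> g holomorphic_on A \<longrightarrow> g ` A \<subseteq> ball y \<delta>2 \<longrightarrow> (\<lambda>t. ib2 t (g t)) holomorphic_on A"
    by (elim exE conjE) (rule that; assumption)
  define r where "r = min r2 (min (cmod u / 2) (1 / (2 * cmod u)))"
  have r: "0 < r" "r \<le> r2" "r \<le> cmod u / 2" "r \<le> 1 / (2 * cmod u)" using 2 u by (auto simp: r_def)
  define ib where "ib t w = ib1 t (ib2 t w)" for t w
  have step: "fixmap D t (ib t w) = ib2 t w" "ib t w \<in> ball u \<epsilon>1"
    if "t \<in> ball t0 (min h1 h2)" "w \<in> ball y \<delta>2" for t w
    using 1(3)[of t "ib2 t w"] pb2[rule_format, of t w] that by (auto simp: ib_def)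
  have iter: "(fixmap D t ^^ Suc i) (ib t w) = (fixmap D t ^^ i) (ib2 t w)"
    if "t \<in> ball t0 (min h1 h2)" "w \<in> ball y \<delta>2" for t w i
    using step(1)[OF that] by (simp add: funpow_swap1)
  show ?case
  proof (intro exI conjI allI impI)
    show "0 < \<delta>2" "0 < min h1 h2" "0 < r" using 1 2 r by auto
    fix t w assume tw: "t \<in> ball t0 (min h1 h2)" "w \<in> ball y \<delta>2"
    show "ib t w \<in> ball u \<epsilon>" using step(2)[OF tw] by (simp add: \<epsilon>1_def)
    show "(fixmap D t ^^ Suc a) (ib t w) = w" using iter[OF tw] pb2[rule_format, of t w] tw by simp
    fix i assume i: "i < Suc a"
    have "r \<le> cmod ((fixmap D t ^^ i) (ib t w)) \<and> cmod ((fixmap D t ^^ i) (ib t w)) \<le> 1 / r"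
    proof (cases i)
      case 0
      have n: "cmod (ib t w - u) < cmod u / 2"
        using step(2)[OF tw] by (simp add: \<epsilon>1_def dist_norm norm_minus_commute)
      then have n': "cmod (ib t w) \<ge> cmod u / 2" "cmod (ib t w) \<le> 2 * cmod u"
        using norm_triangle_sub[of u "ib t w"] norm_triangle_sub[of "ib t w" u] by (auto simp: norm_minus_commute)
      have "2 * cmod u \<le> 1 / r" using r u by (simp add: field_simps)
      then show ?thesis using 0 n' r by auto
    next
      case (Suc i')
      have "r2 \<le> cmod ((fixmap D t ^^ i') (ib2 t w))" "cmod ((fixmap D t ^^ i') (ib2 t w)) \<le> 1 / r2"
        using pb2[rule_format, of t w] tw i Suc by auto
      moreover have "1 / r2 \<le> 1 / r" using r by (intro divide_left_mono) auto
      ultimately show ?thesis unfolding Suc iter[OF tw] using r by auto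
    qed
    then show "r \<le> cmod ((fixmap D t ^^ i) (ib t w))" "cmod ((fixmap D t ^^ i) (ib t w)) \<le> 1 / r" by auto
  next
    fix A g assume A: "A \<subseteq> ball t0 (min h1 h2)" "g holomorphic_on A" "g ` A \<subseteq> ball y \<delta>2"
    have sub: "A \<subseteq> ball t0 h1" "A \<subseteq> ball t0 h2" using A(1) by auto
    have "(\<lambda>t. ib2 t (g t)) holomorphic_on A" using hol2 A sub by blast
    moreover have "(\<lambda>t. ib2 t (g t)) ` A \<subseteq> ball (fixmap D t0 u) \<delta>1"
      using pb2 A(3) sub by blast
    ultimately show "(\<lambda>t. ib t (g t)) holomorphic_on A" unfolding ib_def using 1(4)[OF sub(1)] by simp
  qed
qed

text \<open>
  The difference quotient of \<open>x^D\<close> at two points close to \<open>p\<close> is close to the derivative at \<open>p\<close>,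
  whose modulus exceeds 1.
\<close>

lemma power_expanding_near:
  assumes rep: "1 < cmod (of_nat D * p ^ (D - 1))"
  obtains \<epsilon> k where "0 < \<epsilon>" "0 < k" "k < 1"
    "\<And>x y. cmod (x - p) < \<epsilon> \<Longrightarrow> cmod (y - p) < \<epsilon> \<Longrightarrow> cmod (x - y) \<le> k * cmod (x ^ D - y ^ D)"
proof -
  define Q where "Q x y = (\<Sum>i<D. y ^ (D - Suc i) * x ^ i)" for x y :: complex
  have fac: "x ^ D - y ^ D = (x - y) * Q x y" for x y
    unfolding Q_def by (rule power_diff_sumr2)
  have Qp: "Q p p = of_nat D * p ^ (D - 1)"
  proof -
    have "Q p p = (\<Sum>i<D. p ^ (D - 1))"
      unfolding Q_def by (intro sum.cong refl) (simp add: power_add[symmetric])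
    then show ?thesis by simp
  qed
  define q where "q = cmod (Q p p)"
  define v where "v = 1 / q"
  define k where "k = (v + 1) / 2"
  have q1: "1 < q" using rep by (simp only: q_def Qp)
  then have q: "1 < q" "0 < q" by linarith+
  then have v: "v < 1" "0 < v" by (auto simp: v_def)
  then have "0 < k" "k < 1" "v < k" by (simp_all add: k_def)
  then have k: "0 < k" "k < 1" "1 / q < k" by (simp_all only: v_def)
  have k1: "1 / k < q"
    using k q by (simp add: field_simps)
  have "isCont (\<lambda>z. Q (fst z) (snd z)) (p, p)"
    unfolding Q_def by (intro continuous_intros)
  then have "isCont (\<lambda>z. cmod (Q (fst z) (snd z))) (p, p)" by (rule continuous_norm)
  then have "\<forall>\<^sub>F z in nhds (p, p). 1 / k < cmod (Q (fst z) (snd z))"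
    using tendsto_at_iff_tendsto_nhds[of "\<lambda>z. cmod (Q (fst z) (snd z))" "(p, p)"] k1
    by (simp add: isCont_def q_def order_tendstoD(1))
  then obtain e where e: "0 < e" "\<And>z. dist z (p, p) < e \<Longrightarrow> 1 / k < cmod (Q (fst z) (snd z))"
    unfolding eventually_nhds_metric by blast
  define \<epsilon>1 where "\<epsilon>1 = e / 2"
  have \<epsilon>1: "0 < \<epsilon>1" using e by (simp add: \<epsilon>1_def)
  have Qbig: "1 / k \<le> cmod (Q x y)" if "cmod (x - p) < \<epsilon>1" "cmod (y - p) < \<epsilon>1" for x y
  proof -
    have "dist (x, y) (p, p) \<le> dist x p + dist y p"
      unfolding dist_Pair_Pair by (rule sqrt_sum_squares_le_sum) auto
    also have "\<dots> < e" using that by (simp add: dist_norm \<epsilon>1_def)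
    finally show ?thesis using e(2)[of "(x, y)"] by simp
  qed
  have contr: "cmod (x - y) \<le> k * cmod (x ^ D - y ^ D)" if "cmod (x - p) < \<epsilon>1" "cmod (y - p) < \<epsilon>1" for x y
  proof -
    have "cmod (x - y) * 1 \<le> cmod (x - y) * (k * cmod (Q x y))"
      using Qbig[OF that] k by (intro mult_left_mono) (auto simp: field_simps)
    then show ?thesis unfolding fac by (simp add: norm_mult mult.left_commute)
  qed
  show thesis using that[OF \<epsilon>1 k(1,2) contr] .
qed

text \<open>
  Changing the parameter moves the fixed point \<open>p\<close>, which costs an additive error of the size of the
  change of \<open>c\<close>. For \<open>p = t0\<close> the moved fixed point is \<open>t\<close> itself, and the branch contracts towards
  \<open>t\<close> without any error.
\<close>

lemma repelling_contraction:
  assumes D: "1 \<le> D" and fix_p: "fixmap D t0 p = p" and rep: "1 < cmod (of_nat D * p ^ (D - 1))"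
    and p0: "p \<noteq> 0" and \<delta>': "0 < \<delta>'"
  obtains \<delta> h k ib where "0 < \<delta>" "\<delta> \<le> \<delta>'" "0 < h" "0 < k" "k < 1"
    "\<And>t w. t \<in> ball t0 h \<Longrightarrow> w \<in> ball p \<delta> \<Longrightarrow> ib t w \<in> ball p \<delta> \<and> fixmap D t (ib t w) = w \<and>
       cmod (ib t w - p) \<le> k * (cmod (w - p) + cmod ((t - t ^ D) - (t0 - t0 ^ D))) \<and>
       (p = t0 \<longrightarrow> cmod (ib t w - t) \<le> k * cmod (w - t))"
    "\<And>A g. A \<subseteq> ball t0 h \<Longrightarrow> g holomorphic_on A \<Longrightarrow> g ` A \<subseteq> ball p \<delta> \<Longrightarrow> (\<lambda>t. ib t (g t)) holomorphic_on A"
proof -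
  obtain \<epsilon>1 k where \<epsilon>1: "0 < \<epsilon>1" and k: "0 < k" "k < 1"
    and contr: "\<And>x y. cmod (x - p) < \<epsilon>1 \<Longrightarrow> cmod (y - p) < \<epsilon>1 \<Longrightarrow> cmod (x - y) \<le> k * cmod (x ^ D - y ^ D)"
    using power_expanding_near[OF rep] by blast
  obtain \<delta>1 h1 ib where 1: "0 < \<delta>1" "0 < h1"
    and ib: "\<And>t w. t \<in> ball t0 h1 \<Longrightarrow> w \<in> ball p \<delta>1 \<Longrightarrow> ib t w \<in> ball p \<epsilon>1 \<and> fixmap D t (ib t w) = w"
    and hol: "\<And>A g. A \<subseteq> ball t0 h1 \<Longrightarrow> g holomorphic_on A \<Longrightarrow> g ` A \<subseteq> ball p \<delta>1 \<Longrightarrow> (\<lambda>t. ib t (g t)) holomorphic_on A"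
    by (rule local_inverse_step[OF D p0 fix_p \<epsilon>1]; rule that; assumption)
  define \<delta> where "\<delta> = min \<delta>' \<delta>1"
  have \<delta>: "0 < \<delta>" "\<delta> \<le> \<delta>'" "\<delta> \<le> \<delta>1" using 1 \<delta>' by (auto simp: \<delta>_def)
  have "isCont (\<lambda>t. t - t ^ D) t0" by (intro continuous_intros)
  moreover have "0 < (1 / k - 1) * \<delta>" using k \<delta> by simp
  ultimately obtain h2 where h2: "0 < h2"
    "\<And>t. cmod (t - t0) < h2 \<Longrightarrow> cmod ((t - t ^ D) - (t0 - t0 ^ D)) < (1 / k - 1) * \<delta>"
    unfolding continuous_at_eps_delta by (metis dist_norm)
  define h where "h = min h1 (min h2 \<epsilon>1)"
  show thesis
  proof (rule that[of \<delta> h k ib])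
    fix t w assume t: "t \<in> ball t0 h" and w: "w \<in> ball p \<delta>"
    have i: "cmod (ib t w - p) < \<epsilon>1" "fixmap D t (ib t w) = w"
      using ib[of t w] t w \<delta> by (auto simp: h_def dist_norm norm_minus_commute)
    have td: "cmod ((t - t ^ D) - (t0 - t0 ^ D)) < (1 / k - 1) * \<delta>" "cmod (t - t0) < \<epsilon>1"
      using h2(2)[of t] t by (auto simp: h_def dist_norm norm_minus_commute)
    have "ib t w ^ D - p ^ D = (w - p) - ((t - t ^ D) - (t0 - t0 ^ D))"
    proof -
      have "ib t w ^ D = w - (t - t ^ D)" using i(2) unfolding fixmap_def umap_def by (metis add_diff_cancel)
      moreover have "p ^ D = p - (t0 - t0 ^ D)" using fix_p unfolding fixmap_def umap_def by (metis add_diff_cancel)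
      ultimately show ?thesis by simp
    qed
    then have "cmod (ib t w ^ D - p ^ D) \<le> cmod (w - p) + cmod ((t - t ^ D) - (t0 - t0 ^ D))"
      by (metis norm_triangle_ineq4)
    then have b: "cmod (ib t w - p) \<le> k * (cmod (w - p) + cmod ((t - t ^ D) - (t0 - t0 ^ D)))"
      using k i \<epsilon>1 by (intro order_trans[OF contr[of "ib t w" p]] mult_left_mono) auto
    also have "\<dots> < k * (\<delta> + (1 / k - 1) * \<delta>)"
      using w td k by (intro mult_strict_left_mono add_strict_mono) (auto simp: dist_norm norm_minus_commute)
    also have "\<dots> = \<delta>" using k by (simp add: field_simps)
    finally have "ib t w \<in> ball p \<delta>" by (simp add: dist_norm norm_minus_commute)
    moreover have "cmod (ib t w - t) \<le> k * cmod (w - t)" if "p = t0"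
    proof -
      have "ib t w ^ D - t ^ D = w - t" using i(2) by (simp add: fixmap_def umap_def algebra_simps)
      then show ?thesis using contr[of "ib t w" t] i td that by simp
    qed
    ultimately show "ib t w \<in> ball p \<delta> \<and> fixmap D t (ib t w) = w \<and>
       cmod (ib t w - p) \<le> k * (cmod (w - p) + cmod ((t - t ^ D) - (t0 - t0 ^ D))) \<and>
       (p = t0 \<longrightarrow> cmod (ib t w - t) \<le> k * cmod (w - t))" using i b by blast
  next
    fix A g assume A: "A \<subseteq> ball t0 h" "g holomorphic_on A" "g ` A \<subseteq> ball p \<delta>"
    have "ball t0 h \<subseteq> ball t0 h1" "ball p \<delta> \<subseteq> ball p \<delta>1" using \<delta> by (auto simp: h_def)
    then show "(\<lambda>t. ib t (g t)) holomorphic_on A" using A by (intro hol) blast+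
  qed (use \<delta> k 1 h2 \<epsilon>1 in \<open>auto simp: h_def\<close>)
qed

section \<open>Derivatives along shadowing orbits\<close>

text \<open>
  The logarithm of \<open>cmod (f' z)\<close>.
\<close>

definition log_expansion :: "nat \<Rightarrow> complex \<Rightarrow> real" where
  "log_expansion D z = ln (real D * cmod z ^ (D - 1))"

text \<open>
  The expansion rates along the first \<open>n\<close> points of the orbit of \<open>z\<close> agree with the model rates \<open>lm\<close>
  up to \<open>e\<close> per step and up to a total \<open>C\<close>. Close to a fixed point the total is the sum of a
  geometric series, and \<open>e\<close> comes from the perturbation of the parameter; a piece of bounded length
  is covered by \<open>C\<close>.
\<close>

definition shadows ::
  "nat \<Rightarrow> complex \<Rightarrow> complex \<Rightarrow> nat \<Rightarrow> (nat \<Rightarrow> real) \<Rightarrow> real \<Rightarrow> real \<Rightarrow> bool" where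
  "shadows D c z n lm e C \<longleftrightarrow> (\<exists>g.
     (\<forall>i<n. (umap D c ^^ i) z \<noteq> 0 \<and> 0 \<le> g i \<and>
       \<bar>log_expansion D ((umap D c ^^ i) z) - lm i\<bar> \<le> e + g i) \<and> (\<Sum>i<n. g i) \<le> C)"

lemma shadows_append:
  assumes "shadows D c z n lm e C" "shadows D c ((umap D c ^^ n) z) n' (\<lambda>i. lm (n + i)) e C'"
  shows "shadows D c z (n + n') lm e (C + C')"
proof -
  obtain g where g: "\<And>i. i < n \<Longrightarrow> (umap D c ^^ i) z \<noteq> 0 \<and> 0 \<le> g i \<and>
       \<bar>log_expansion D ((umap D c ^^ i) z) - lm i\<bar> \<le> e + g i" "(\<Sum>i<n. g i) \<le> C"
    using assms(1) unfolding shadows_def by blast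
  obtain g' where g': "\<And>i. i < n' \<Longrightarrow> (umap D c ^^ i) ((umap D c ^^ n) z) \<noteq> 0 \<and> 0 \<le> g' i \<and>
       \<bar>log_expansion D ((umap D c ^^ i) ((umap D c ^^ n) z)) - lm (n + i)\<bar> \<le> e + g' i" "(\<Sum>i<n'. g' i) \<le> C'"
    using assms(2) unfolding shadows_def by blast
  define h where "h i = (if i < n then g i else g' (i - n))" for i
  have "(umap D c ^^ i) z \<noteq> 0 \<and> 0 \<le> h i \<and> \<bar>log_expansion D ((umap D c ^^ i) z) - lm i\<bar> \<le> e + h i"
    if "i < n + n'" for i
  proof (cases "i < n")
    case True
    then show ?thesis using g(1)[of i] by (simp add: h_def)
  next
    case False
    then obtain k where k: "i = n + k" by (metis add_diff_inverse_nat)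
    have "(umap D c ^^ k) ((umap D c ^^ n) z) = (umap D c ^^ i) z"
      by (simp add: k funpow_add add.commute[of n k])
    then show ?thesis using g'(1)[of k] that by (simp add: h_def k)
  qed
  moreover have "(\<Sum>i<n + n'. h i) = (\<Sum>i<n. h i) + (\<Sum>i<n'. h (n + i))"
    by (induction n') (simp_all add: add.assoc)
  then have "(\<Sum>i<n + n'. h i) \<le> C + C'" using g(2) g'(2) by (simp add: h_def)
  ultimately show ?thesis unfolding shadows_def by blast
qed

lemma shadows_bounded:
  assumes D: "1 \<le> D" and r: "0 < r" and e: "0 \<le> e"
    and bd: "\<And>i. i < n \<Longrightarrow> r \<le> cmod ((umap D c ^^ i) z) \<and> cmod ((umap D c ^^ i) z) \<le> 1 / r"
    and lm: "\<And>i. i < n \<Longrightarrow> lm i = l"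
  shows "shadows D c z n lm e (real n * (ln (real D) + real (D - 1) * ln (1 / r) + \<bar>l\<bar>))"
proof (cases "n = 0")
  case True
  then show ?thesis by (simp add: shadows_def)
next
  case False
  define B where "B = ln (real D) + real (D - 1) * ln (1 / r) + \<bar>l\<bar>"
  have "r \<le> 1 / r" using bd[of 0] False by linarith
  then have "r * r \<le> 1" using r by (simp add: field_simps)
  then have "r \<le> 1" using r abs_square_le_1[of r] by (simp add: power2_eq_square)
  then have lr: "0 \<le> ln (1 / r)" using r by (simp add: ln_ge_zero)
  have lD: "0 \<le> ln (real D)" using D by simp
  have B0: "0 \<le> B" using lr lD by (simp add: B_def)
  show ?thesis
    unfolding shadows_def B_def[symmetric]
  proof (intro exI[of _ "\<lambda>_. B"] conjI allI impI)
    fix i assume i: "i < n"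
    define y where "y = cmod ((umap D c ^^ i) z)"
    have y: "r \<le> y" "y \<le> 1 / r" "0 < y" using bd[OF i] r by (auto simp: y_def)
    show "(umap D c ^^ i) z \<noteq> 0" using y by (auto simp: y_def)
    show "0 \<le> B" by (rule B0)
    have "ln r \<le> ln y" "ln y \<le> ln (1 / r)" using y r by auto
    then have "\<bar>ln y\<bar> \<le> ln (1 / r)" using r by (simp add: ln_div)
    then have "real (D - 1) * \<bar>ln y\<bar> \<le> real (D - 1) * ln (1 / r)" by (intro mult_left_mono) auto
    moreover have "log_expansion D ((umap D c ^^ i) z) = ln (real D) + real (D - 1) * ln y"
      using D y unfolding log_expansion_def y_def[symmetric] by (subst ln_mult) (auto simp: ln_realpow)
    moreover have "\<bar>real (D - 1) * ln y\<bar> = real (D - 1) * \<bar>ln y\<bar>" by (simp add: abs_mult)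
    ultimately have "\<bar>log_expansion D ((umap D c ^^ i) z) - l\<bar> \<le> B" unfolding B_def using lD by linarith
    then show "\<bar>log_expansion D ((umap D c ^^ i) z) - lm i\<bar> \<le> e + B" using lm[OF i] e by simp
  qed simp
qed

lemma log_expansion_lipschitz:
  assumes D: "1 \<le> D" and p: "p \<noteq> 0" and x: "cmod (x - p) \<le> cmod p / 2"
  shows "x \<noteq> 0" "\<bar>log_expansion D x - log_expansion D p\<bar> \<le> 2 * real (D - 1) / cmod p * cmod (x - p)"
proof -
  have xp: "cmod p / 2 \<le> cmod x" using norm_triangle_sub[of p x] x by (simp add: norm_minus_commute)
  have pp: "0 < cmod p" using p by simp
  show x0: "x \<noteq> 0" using xp pp by auto
  then have xx: "0 < cmod x" by simp
  have "ln (cmod x) - ln (cmod p) \<le> (cmod x - cmod p) / cmod p" using ln_diff_le[OF xx pp] .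
  also have "\<dots> \<le> cmod (x - p) / cmod p" using norm_triangle_ineq2[of x p] by (intro divide_right_mono) auto
  also have "\<dots> \<le> cmod (x - p) / (cmod p / 2)" using pp by (intro divide_left_mono) auto
  finally have 1: "ln (cmod x) - ln (cmod p) \<le> cmod (x - p) / (cmod p / 2)" .
  have "ln (cmod p) - ln (cmod x) \<le> (cmod p - cmod x) / cmod x" using ln_diff_le[OF pp xx] .
  also have "\<dots> \<le> cmod (x - p) / cmod x" using norm_triangle_ineq3[of x p] xx by (intro divide_right_mono) auto
  also have "\<dots> \<le> cmod (x - p) / (cmod p / 2)" using pp xx xp by (intro divide_left_mono mult_pos_pos) auto
  finally have "\<bar>ln (cmod x) - ln (cmod p)\<bar> \<le> cmod (x - p) / (cmod p / 2)" using 1 by linarith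
  then have "real (D - 1) * \<bar>ln (cmod x) - ln (cmod p)\<bar> \<le> real (D - 1) * (cmod (x - p) / (cmod p / 2))"
    by (intro mult_left_mono) auto
  moreover have "log_expansion D y = ln (real D) + real (D - 1) * ln (cmod y)" if "y \<noteq> 0" for y
    using D that unfolding log_expansion_def by (subst ln_mult) (auto simp: ln_realpow)
  then have eq: "log_expansion D x - log_expansion D p = real (D - 1) * (ln (cmod x) - ln (cmod p))"
    using x0 p by (simp add: right_diff_distrib)
  ultimately show "\<bar>log_expansion D x - log_expansion D p\<bar> \<le> 2 * real (D - 1) / cmod p * cmod (x - p)"
    unfolding eq abs_mult by (simp add: mult_ac)
qed

lemma sum_power_rev_le:
  assumes "0 < k" "k < (1::real)"
  shows "(\<Sum>i<N. k ^ (N - i)) \<le> 1 / (1 - k)"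
proof -
  have "(\<Sum>i<N. k ^ (N - i)) = (\<Sum>i<N. k ^ Suc i)"
    by (rule sum.reindex_bij_witness[where i = "\<lambda>i. N - Suc i" and j = "\<lambda>i. N - Suc i"]) (auto simp flip: Suc_diff_Suc)
  also have "\<dots> \<le> (\<Sum>i<N. k ^ i)" using assms by (intro sum_mono) (auto simp: mult_left_le_one_le)
  also have "\<dots> \<le> (\<Sum>i. k ^ i)" using assms by (intro sum_le_suminf summable_geometric) auto
  also have "\<dots> = 1 / (1 - k)" using assms by (simp add: suminf_geometric)
  finally show ?thesis .
qed

text \<open>
  The orbit leaves the neighbourhood of \<open>p\<close> geometrically, up to the distance \<open>d\<close> caused by the
  perturbed parameter, and the expansion rate is a Lipschitz function of the point.
\<close>

lemma shadows_near_fixed_point: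
  assumes D: "1 \<le> D" and p: "p \<noteq> 0" and k: "0 < k" "k < 1" and \<delta>: "0 < \<delta>"
    and near: "\<And>i. i < N \<Longrightarrow> cmod ((umap D c ^^ i) z - p) \<le> cmod p / 2 \<and>
        cmod ((umap D c ^^ i) z - p) \<le> k ^ (N - i) * \<delta> + d"
    and lm: "\<And>i. i < N \<Longrightarrow> lm i = log_expansion D p"
  shows "shadows D c z N lm (2 * real (D - 1) / cmod p * d) (2 * real (D - 1) / cmod p * \<delta> / (1 - k))"
proof -
  define A where "A = 2 * real (D - 1) / cmod p"
  have A: "0 \<le> A" by (simp add: A_def)
  show ?thesis
    unfolding shadows_def A_def[symmetric]
  proof (intro exI[of _ "\<lambda>i. A * \<delta> * k ^ (N - i)"] conjI allI impI)
    fix i assume i: "i < N"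
    show "(umap D c ^^ i) z \<noteq> 0" using log_expansion_lipschitz(1)[OF D p] near[OF i] by blast
    show "0 \<le> A * \<delta> * k ^ (N - i)" using A \<delta> k by simp
    have "\<bar>log_expansion D ((umap D c ^^ i) z) - log_expansion D p\<bar> \<le> A * cmod ((umap D c ^^ i) z - p)"
      using log_expansion_lipschitz(2)[OF D p] near[OF i] unfolding A_def by blast
    also have "\<dots> \<le> A * (k ^ (N - i) * \<delta> + d)" using near[OF i] A by (intro mult_left_mono) auto
    also have "\<dots> = A * d + A * \<delta> * k ^ (N - i)" by (simp add: algebra_simps)
    finally show "\<bar>log_expansion D ((umap D c ^^ i) z) - lm i\<bar> \<le> A * d + A * \<delta> * k ^ (N - i)"
      using lm[OF i] by simp
  next
    have "(\<Sum>i<N. A * \<delta> * k ^ (N - i)) = A * \<delta> * (\<Sum>i<N. k ^ (N - i))" by (simp add: sum_distrib_left)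
    also have "\<dots> \<le> A * \<delta> * (1 / (1 - k))"
      using sum_power_rev_le[OF k] A \<delta> by (intro mult_left_mono) auto
    finally show "(\<Sum>i<N. A * \<delta> * k ^ (N - i)) \<le> A * \<delta> / (1 - k)" by simp
  qed
qed

lemma shadows_sums:
  assumes "shadows D c z n lm e C" "I \<subseteq> {..<n}"
  shows "\<bar>(\<Sum>i\<in>I. log_expansion D ((umap D c ^^ i) z)) - (\<Sum>i\<in>I. lm i)\<bar> \<le> e * real (card I) + C"
proof -
  obtain g where g: "\<And>i. i < n \<Longrightarrow> (umap D c ^^ i) z \<noteq> 0 \<and> 0 \<le> g i \<and>
       \<bar>log_expansion D ((umap D c ^^ i) z) - lm i\<bar> \<le> e + g i" "(\<Sum>i<n. g i) \<le> C"
    using assms(1) unfolding shadows_def by blast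
  have fin: "finite I" using assms(2) finite_subset by blast
  have "\<bar>(\<Sum>i\<in>I. log_expansion D ((umap D c ^^ i) z)) - (\<Sum>i\<in>I. lm i)\<bar>
      \<le> (\<Sum>i\<in>I. \<bar>log_expansion D ((umap D c ^^ i) z) - lm i\<bar>)"
    unfolding sum_subtractf[symmetric] by (rule sum_abs)
  also have "\<dots> \<le> (\<Sum>i\<in>I. e + g i)" using g assms(2) by (intro sum_mono) auto
  also have "\<dots> = e * real (card I) + (\<Sum>i\<in>I. g i)" by (simp add: sum.distrib mult.commute)
  also have "(\<Sum>i\<in>I. g i) \<le> (\<Sum>i<n. g i)" using g assms(2) by (intro sum_mono2) auto
  finally show ?thesis using g(2) by linarith
qed

lemma ln_orbit_deriv:
  assumes D: "1 \<le> D" and nz: "\<And>i. i < k \<Longrightarrow> (umap D c ^^ i) c \<noteq> 0"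
  shows "orbit_deriv D c k \<noteq> 0"
    "ln (cmod (orbit_deriv D c k)) = (\<Sum>i<k. log_expansion D ((umap D c ^^ i) c))"
proof -
  have x: "crit_orbit D c (Suc i) = (umap D c ^^ i) c" for i
    using D crit_orbit_add[of D c 1 i] crit_orbit_Suc[of D c 0] by (simp add: power_0_left)
  have "orbit_deriv D c k \<noteq> 0 \<and> ln (cmod (orbit_deriv D c k)) = (\<Sum>i<k. log_expansion D ((umap D c ^^ i) c))"
    using nz
  proof (induction k)
    case 0
    then show ?case by (simp add: orbit_deriv_def)
  next
    case (Suc k)
    have "(umap D c ^^ k) c \<noteq> 0" using Suc.prems by simp
    with Suc D show ?case
      by (simp add: orbit_deriv_Suc x norm_mult norm_power ln_mult log_expansion_def)
  qed
  then show "orbit_deriv D c k \<noteq> 0"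
    "ln (cmod (orbit_deriv D c k)) = (\<Sum>i<k. log_expansion D ((umap D c ^^ i) c))" by auto
qed

text \<open>
  The slopes decrease, from \<open>lb\<close> to \<open>la\<close>, and their total is almost that of the constant slope \<open>ls\<close>.
  So the partial sums form a concave graph, lying above the line of slope \<open>ls\<close> up to a constant.
\<close>

lemma two_rate_partial_sums:
  fixes la lb ls :: real
  assumes "la \<le> ls" "ls \<le> lb" and T: "T \<le> m"
    and bal: "\<bar>real T * lb + real (m - T) * la - real m * ls\<bar> \<le> C" and k: "k \<le> m"
  defines "lm \<equiv> (\<lambda>i. if i < T then lb else la)"
  shows "real k * ls - C \<le> (\<Sum>i<k. lm i)"
    "(\<Sum>i\<in>{k..<m}. lm i) \<le> real (m - k) * ls + 2 * C"
proof -
  have sum: "(\<Sum>i<j. lm i) = real (min j T) * lb + real (j - T) * la" for j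
    by (induction j) (auto simp: lm_def min_def algebra_simps Suc_diff_le)
  show 1: "real k * ls - C \<le> (\<Sum>i<k. lm i)"
  proof (cases "k \<le> T")
    case True
    have "real k * ls \<le> real k * lb" using assms by (intro mult_left_mono) auto
    moreover have "0 \<le> C" using bal by linarith
    ultimately show ?thesis using True by (simp add: sum min_def)
  next
    case False
    have "real (m - k) * la \<le> real (m - k) * ls" using assms by (intro mult_left_mono) auto
    then have "(real m - real k) * la \<le> (real m - real k) * ls" using k by (simp add: of_nat_diff)
    moreover have "real T * lb + (real m - real T) * la \<ge> real m * ls - C" using bal T by (simp add: of_nat_diff)
    ultimately have "real k * ls - C \<le> real T * lb + (real k - real T) * la" by (simp add: algebra_simps)
    then show ?thesis using False by (simp add: sum min_def of_nat_diff)
  qed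
  have "(\<Sum>i<m. lm i) = (\<Sum>i<k. lm i) + (\<Sum>i\<in>{k..<m}. lm i)"
    using k by (metis atLeast0LessThan sum.atLeastLessThan_concat zero_le)
  moreover have "(\<Sum>i<m. lm i) \<le> real m * ls + C" using bal T by (simp add: sum abs_le_iff)
  moreover have "real (m - k) * ls = real m * ls - real k * ls" using k by (simp add: of_nat_diff left_diff_distrib)
  ultimately show "(\<Sum>i\<in>{k..<m}. lm i) \<le> real (m - k) * ls + 2 * C" using 1 by linarith
qed

text \<open>
  Along an orbit that expands first at rate \<open>lb\<close> and then at the smaller rate \<open>la\<close>, the derivative
  of an initial piece is at least about \<open>exp (k * ls)\<close> and that of a final piece of length \<open>k\<close> is at
  most that. These are the hypotheses of the Jentzsch theorem for the radius \<open>exp ls\<close>.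
\<close>

lemma zeros_of_orbit_sums:
  fixes c :: "nat \<Rightarrow> complex" and m T :: "nat \<Rightarrow> nat"
  assumes D: "1 \<le> D"
    and sh: "\<And>j. shadows D (c j) (c j) (m j) (\<lambda>i. if i < T j then lb else la) (e j) C"
    and m: "filterlim m at_top sequentially" and e: "e \<longlonglongrightarrow> 0"
    and T: "\<And>j. T j \<le> m j" and l: "la \<le> ls" "ls \<le> lb"
    and bal: "\<And>j. \<bar>real (T j) * lb + real (m j - T j) * la - real (m j) * ls\<bar> \<le> C'"
    and s0: "cmod s0 = exp ls" and h: "0 < h"
  shows "\<exists>j s. cmod (s - s0) < h \<and> (\<Sum>k\<le>m j. s ^ k / orbit_deriv D (c j) k) = 0"
proof -
  define L where "L j i = log_expansion D ((umap D (c j) ^^ i) (c j))" for j i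
  have nz: "(umap D (c j) ^^ i) (c j) \<noteq> 0" if "i < m j" for i j
    using sh[of j] that unfolding shadows_def by blast
  have od: "orbit_deriv D (c j) k \<noteq> 0" "cmod (orbit_deriv D (c j) k) = exp (\<Sum>i<k. L j i)" if k: "k \<le> m j" for j k
  proof -
    show n: "orbit_deriv D (c j) k \<noteq> 0" using ln_orbit_deriv(1)[OF D, of k "c j"] nz k by auto
    have "ln (cmod (orbit_deriv D (c j) k)) = (\<Sum>i<k. L j i)"
      unfolding L_def using nz k by (intro ln_orbit_deriv(2)[OF D]) auto
    then show "cmod (orbit_deriv D (c j) k) = exp (\<Sum>i<k. L j i)"
      using n by (metis exp_ln zero_less_norm_iff)
  qed
  have pre: "real k * (ls - e j) - (C + C') \<le> (\<Sum>i<k. L j i)" if k: "k \<le> m j" for j k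
  proof -
    have "{..<k} \<subseteq> {..<m j}" using k by auto
    from shadows_sums[OF sh this] have
      "\<bar>(\<Sum>i<k. L j i) - (\<Sum>i<k. if i < T j then lb else la)\<bar> \<le> e j * real k + C"
      by (simp add: L_def)
    moreover have "real k * ls - C' \<le> (\<Sum>i<k. if i < T j then lb else la)"
      by (rule two_rate_partial_sums(1)[OF l T bal k])
    ultimately show ?thesis by (simp add: algebra_simps)
  qed
  have suf: "(\<Sum>i<m j. L j i) - (\<Sum>i<m j - k. L j i) \<le> real k * (ls + e j) + (C + 2 * C')" if k: "k \<le> m j" for j k
  proof -
    have "(\<Sum>i<m j. L j i) = (\<Sum>i<m j - k. L j i) + (\<Sum>i\<in>{m j - k..<m j}. L j i)"
      by (metis atLeast0LessThan diff_le_self sum.atLeastLessThan_concat zero_le)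
    moreover have "{m j - k..<m j} \<subseteq> {..<m j}" by auto
    from shadows_sums[OF sh this] have
      "\<bar>(\<Sum>i\<in>{m j - k..<m j}. L j i) - (\<Sum>i\<in>{m j - k..<m j}. if i < T j then lb else la)\<bar> \<le> e j * real k + C"
      using k by (simp add: L_def)
    moreover have "(\<Sum>i\<in>{m j - k..<m j}. if i < T j then lb else la) \<le> real k * ls + 2 * C'"
      using two_rate_partial_sums(2)[OF l T bal, of "m j - k" j] k by simp
    ultimately show ?thesis by (simp add: algebra_simps)
  qed
  have ev: "\<forall>\<^sub>F j in sequentially. e j < d" if "0 < d" for d
    using e that by (rule order_tendstoD(2))
  have "\<exists>j s. cmod (s - s0) < h \<and> (\<Sum>k\<le>m j. 1 / orbit_deriv D (c j) k * s ^ k) = 0"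
  proof (rule zeros_accumulate_on_circle[OF m _ _ _ _ _ s0 h])
    show "0 < exp ls" by simp
    show "1 / orbit_deriv D (c j) 0 = 1" for j by (simp add: orbit_deriv_def)
    show "1 / orbit_deriv D (c j) (m j) \<noteq> 0" for j using od(1)[of "m j" j] by simp
  next
    fix t :: real assume t: "0 < t" "t < exp ls"
    then have lt: "ln t < ls" by (metis exp_less_cancel_iff exp_ln)
    then have "\<forall>\<^sub>F j in sequentially. e j < ls - ln t" by (intro ev) simp
    then have "\<forall>\<^sub>F j in sequentially. \<forall>k\<le>m j. cmod (1 / orbit_deriv D (c j) k) \<le> exp (C + C') / t ^ k"
    proof eventually_elim
      case (elim j)
      show ?case
      proof (intro allI impI)
        fix k assume k: "k \<le> m j"
        have "t ^ k = exp (real k * ln t)" using t by (metis exp_ln exp_of_nat_mult)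
        also have "\<dots> \<le> exp (real k * (ls - e j))" using elim by (auto intro!: mult_left_mono)
        also have "\<dots> \<le> exp ((C + C') + (\<Sum>i<k. L j i))" using pre[OF k] by simp
        also have "\<dots> = exp (C + C') * cmod (orbit_deriv D (c j) k)" using od(2)[OF k] by (simp add: exp_add)
        finally show "cmod (1 / orbit_deriv D (c j) k) \<le> exp (C + C') / t ^ k"
          using od(1)[OF k] t by (simp add: norm_divide field_simps)
      qed
    qed
    then show "\<exists>Ca. \<forall>\<^sub>F j in sequentially. \<forall>k\<le>m j. cmod (1 / orbit_deriv D (c j) k) \<le> Ca / t ^ k" by blast
  next
    fix t :: real assume t: "exp ls < t"
    then have t0: "0 < t" by (meson exp_gt_zero less_trans)
    with t have lt: "ls < ln t" by (metis exp_less_cancel_iff exp_ln)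
    then have "\<forall>\<^sub>F j in sequentially. e j < ln t - ls" by (intro ev) simp
    then have "\<forall>\<^sub>F j in sequentially. \<forall>k\<le>m j. cmod (1 / orbit_deriv D (c j) (m j - k))
        \<le> exp (C + 2 * C') * t ^ k * cmod (1 / orbit_deriv D (c j) (m j))"
    proof eventually_elim
      case (elim j)
      show ?case
      proof (intro allI impI)
        fix k assume k: "k \<le> m j"
        have "cmod (orbit_deriv D (c j) (m j)) = exp (\<Sum>i<m j. L j i)" by (simp add: od)
        also have "\<dots> \<le> exp (real k * (ls + e j) + (C + 2 * C') + (\<Sum>i<m j - k. L j i))"
          using suf[OF k] by simp
        also have "\<dots> \<le> exp (real k * ln t + (C + 2 * C') + (\<Sum>i<m j - k. L j i))"
          using elim by (auto intro!: mult_left_mono)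
        also have "\<dots> = exp (C + 2 * C') * exp (real k * ln t) * exp (\<Sum>i<m j - k. L j i)"
          by (simp add: exp_add mult_ac)
        also have "exp (real k * ln t) = t ^ k" using t0 by (metis exp_ln exp_of_nat_mult)
        also have "exp (\<Sum>i<m j - k. L j i) = cmod (orbit_deriv D (c j) (m j - k))" by (simp add: od)
        finally show "cmod (1 / orbit_deriv D (c j) (m j - k))
            \<le> exp (C + 2 * C') * t ^ k * cmod (1 / orbit_deriv D (c j) (m j))"
          using od(1)[of "m j" j] od(1)[of "m j - k" j] t0 by (simp add: norm_divide field_simps)
      qed
    qed
    then show "\<exists>Ca. \<forall>\<^sub>F j in sequentially. \<forall>k\<le>m j. cmod (1 / orbit_deriv D (c j) (m j - k))
        \<le> Ca * t ^ k * cmod (1 / orbit_deriv D (c j) (m j))" by blast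
  qed
  then show ?thesis by (simp add: divide_inverse mult.commute)
qed

section \<open>Periodic critical orbits that visit two fixed points\<close>

text \<open>
  Pulling \<open>w\<close> back \<open>n\<close> times towards the fixed point. Read forwards, this is an orbit which leaves
  the neighbourhood of \<open>p\<close> after \<open>n\<close> steps and ends at \<open>w\<close>.
\<close>

lemma contraction_iterates:
  fixes ib :: "complex \<Rightarrow> complex \<Rightarrow> complex"
  assumes k: "0 < k" "k < 1" and t: "t \<in> ball t0 h" and w: "w \<in> ball p \<delta>"
    and ib: "\<And>w. w \<in> ball p \<delta> \<Longrightarrow> ib t w \<in> ball p \<delta> \<and> fixmap D t (ib t w) = w \<and>
       cmod (ib t w - p) \<le> k * (cmod (w - p) + d) \<and>
       (p = t0 \<longrightarrow> cmod (ib t w - t) \<le> k * cmod (w - t))" and d: "0 \<le> d"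
  shows "(ib t ^^ n) w \<in> ball p \<delta>"
    "(fixmap D t ^^ i) ((ib t ^^ (i + j)) w) = (ib t ^^ j) w"
    "cmod ((ib t ^^ n) w - p) \<le> k ^ n * \<delta> + k / (1 - k) * d"
    "p = t0 \<Longrightarrow> cmod ((ib t ^^ n) w - t) \<le> k ^ n * cmod (w - t)"
proof -
  show inb: "(ib t ^^ n) w \<in> ball p \<delta>" for n by (induction n) (use w ib in auto)
  show "(fixmap D t ^^ i) ((ib t ^^ (i + j)) w) = (ib t ^^ j) w"
  proof (induction i)
    case (Suc i)
    have "(fixmap D t ^^ Suc i) ((ib t ^^ (Suc i + j)) w) = (fixmap D t ^^ i) (fixmap D t (ib t ((ib t ^^ (i + j)) w)))"
      by (simp add: funpow_swap1)
    also have "\<dots> = (fixmap D t ^^ i) ((ib t ^^ (i + j)) w)" using ib[OF inb] by simp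
    finally show ?case using Suc by simp
  qed simp
  show "cmod ((ib t ^^ n) w - p) \<le> k ^ n * \<delta> + k / (1 - k) * d"
  proof (induction n)
    case 0
    have "cmod (w - p) < \<delta>" using w by (simp add: dist_norm norm_minus_commute)
    moreover have "0 \<le> k / (1 - k) * d" using k d by simp
    ultimately show ?case by simp
  next
    case (Suc n)
    have "cmod ((ib t ^^ Suc n) w - p) \<le> k * (cmod ((ib t ^^ n) w - p) + d)" using ib[OF inb] by simp
    also have "\<dots> \<le> k * (k ^ n * \<delta> + k / (1 - k) * d + d)" using Suc k by (intro mult_left_mono) auto
    also have "k ^ n * \<delta> + k / (1 - k) * d + d = k ^ n * \<delta> + d / (1 - k)"
      using k by (simp add: field_simps)
    also have "k * (k ^ n * \<delta> + d / (1 - k)) = k ^ Suc n * \<delta> + k / (1 - k) * d"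
      by (simp add: distrib_left mult_ac)
    finally show ?case .
  qed
  show "cmod ((ib t ^^ n) w - t) \<le> k ^ n * cmod (w - t)" if "p = t0"
  proof (induction n)
    case (Suc n)
    have "cmod ((ib t ^^ Suc n) w - t) \<le> k * cmod ((ib t ^^ n) w - t)" using ib[OF inb] that by simp
    also have "\<dots> \<le> k * (k ^ n * cmod (w - t))" using Suc k by (intro mult_left_mono) auto
    finally show ?case by simp
  qed simp
qed

lemma contraction_iterates_holomorphic:
  fixes ib :: "complex \<Rightarrow> complex \<Rightarrow> complex"
  assumes step: "\<And>t w. t \<in> A \<Longrightarrow> w \<in> B \<Longrightarrow> ib t w \<in> B"
    and hol: "\<And>g. g holomorphic_on A \<Longrightarrow> g ` A \<subseteq> B \<Longrightarrow> (\<lambda>t. ib t (g t)) holomorphic_on A"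
    and g: "g holomorphic_on A" "g ` A \<subseteq> B"
  shows "(\<lambda>t. (ib t ^^ n) (g t)) holomorphic_on A \<and> (\<lambda>t. (ib t ^^ n) (g t)) ` A \<subseteq> B"
proof (induction n)
  case (Suc n)
  have "(\<lambda>t. ib t ((ib t ^^ n) (g t))) holomorphic_on A" using Suc by (intro hol) auto
  moreover have "ib t ((ib t ^^ n) (g t)) \<in> B" if "t \<in> A" for t using Suc that step by blast
  ultimately show ?case by auto
qed (use g in auto)

lemma shadows_mono:
  assumes "shadows D c z n lm e C" "e \<le> e'"
  shows "shadows D c z n lm e' C"
  using assms unfolding shadows_def by (meson add_right_mono order_trans)

lemma crit_orbit_fixmap_holomorphic: "(\<lambda>t. crit_orbit D (t - t ^ D) n) holomorphic_on A"
  by (induction n) (auto simp: crit_orbit_Suc intro!: holomorphic_intros)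

lemma bounded_away_near:
  fixes F :: "nat \<Rightarrow> complex \<Rightarrow> complex"
  assumes "\<And>k. k < n \<Longrightarrow> isCont (F k) t0 \<and> F k t0 \<noteq> 0"
  shows "\<exists>r h. 0 < r \<and> 0 < h \<and> (\<forall>t\<in>ball t0 h. \<forall>k<n. r \<le> cmod (F k t) \<and> cmod (F k t) \<le> 1 / r)"
  using assms
proof (induction n)
  case 0
  then show ?case by (intro exI[of _ 1]) auto
next
  case (Suc n)
  then obtain r h where r: "0 < r" "0 < h" "\<forall>t\<in>ball t0 h. \<forall>k<n. r \<le> cmod (F k t) \<and> cmod (F k t) \<le> 1 / r"
    by (metis less_SucI)
  define x where "x = cmod (F n t0)"
  have x: "0 < x" using Suc.prems[of n] by (simp add: x_def)
  have "isCont (\<lambda>t. cmod (F n t)) t0" using Suc.prems[of n] by (auto intro: continuous_norm)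
  then obtain h' where h': "0 < h'" "\<And>t. cmod (t - t0) < h' \<Longrightarrow> \<bar>cmod (F n t) - x\<bar> < x / 2"
    unfolding continuous_at_eps_delta x_def[symmetric] using x by (metis dist_norm half_gt_zero real_norm_def)
  define r' where "r' = min r (min (x / 2) (1 / (2 * x)))"
  have r': "0 < r'" "r' \<le> r" "r' \<le> x / 2" "r' \<le> 1 / (2 * x)" using r x by (auto simp: r'_def)
  have "r' \<le> cmod (F k t) \<and> cmod (F k t) \<le> 1 / r'" if t: "t \<in> ball t0 (min h h')" and k: "k < Suc n" for t k
  proof (cases "k = n")
    case True
    have "\<bar>cmod (F n t) - x\<bar> < x / 2" using h'(2)[of t] t by (auto simp: dist_norm norm_minus_commute)
    then have "x / 2 \<le> cmod (F n t)" "cmod (F n t) \<le> 2 * x" by linarith+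
    moreover have "2 * x \<le> 1 / r'" using r' x by (simp add: field_simps)
    ultimately show ?thesis unfolding True using r' by (intro conjI) linarith+
  next
    case False
    then have "r \<le> cmod (F k t)" "cmod (F k t) \<le> 1 / r" using r(3) t k by auto
    moreover have "1 / r \<le> 1 / r'" using r r' by (intro divide_left_mono) auto
    ultimately show ?thesis using r' by (intro conjI) linarith+
  qed
  moreover have "0 < min h h'" using r h' by simp
  ultimately show ?case using r'(1) by blast
qed

text \<open>
  If the critical point returned to itself it would return infinitely often, also after landing.
\<close>

lemma preperiodic_critical_orbit_nonzero:
  assumes fixed: "umap D c p = p" and p: "p \<noteq> 0" and land: "crit_orbit D c n = p" and k: "1 \<le> k"
  shows "crit_orbit D c k \<noteq> 0"
proof
  assume z: "crit_orbit D c k = 0"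
  have "crit_orbit D c (k * i) = 0" for i
  proof (induction i)
    case (Suc i)
    have "crit_orbit D c (k + k * i) = (umap D c ^^ (k * i)) 0" unfolding crit_orbit_add z ..
    then show ?case using Suc by (simp add: crit_orbit_def)
  qed simp
  moreover have "crit_orbit D c (n + i) = p" for i
    unfolding crit_orbit_add land by (rule umap_funpow_fixed[OF fixed])
  then have "crit_orbit D c (k * Suc n) = p"
    using k by (metis le_add1 le_add_diff_inverse le_trans mult_le_mono1 nat_mult_1 plus_1_eq_Suc add.commute)
  ultimately show False using p by metis
qed

text \<open>
  The functions \<open>Z j\<close> converge to the identity, and the orbit of the critical point lands on the
  fixed point \<open>t0\<close> for the parameter \<open>t0\<close>. By Hurwitz this zero persists. The limit function is not
  constant, because at \<open>t = 1\<close> the parameter is \<open>c = 0\<close> and the critical point is itself fixed.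
\<close>

lemma solve_landing_equation:
  fixes Z :: "nat \<Rightarrow> complex \<Rightarrow> complex"
  assumes h: "0 < h" and hol: "\<And>j. Z j holomorphic_on ball t0 h"
    and lim: "\<And>j t. t \<in> ball t0 h \<Longrightarrow> cmod (Z j t - t) \<le> B * q ^ j" and q: "0 \<le> q" "q < 1"
    and land: "crit_orbit D (t0 - t0 ^ D) n = t0" and D: "1 \<le> D"
  shows "\<exists>j t. n' \<le> j \<and> t \<in> ball t0 h \<and> crit_orbit D (t - t ^ D) n = Z j t"
proof (rule ccontr)
  assume contra: "\<not> ?thesis"
  define g where "g t = crit_orbit D (t - t ^ D) n - t" for t
  define F where "F j t = crit_orbit D (t - t ^ D) n - Z (n' + j) t" for j t
  have holg: "g holomorphic_on A" for A
    unfolding g_def by (intro holomorphic_intros crit_orbit_fixmap_holomorphic)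
  have "g t0 \<noteq> 0"
  proof (rule Hurwitz_no_zeros[of "ball t0 h" F g t0])
    show "F j holomorphic_on ball t0 h" for j
      unfolding F_def by (intro holomorphic_intros crit_orbit_fixmap_holomorphic hol)
    show "g holomorphic_on ball t0 h" by (rule holg)
    show "F j z \<noteq> 0" if "z \<in> ball t0 h" for j z using contra that by (auto simp: F_def)
    show "uniform_limit K F g sequentially" if "compact K" "K \<subseteq> ball t0 h" for K
    proof (rule uniform_limitI)
      fix e :: real assume e: "0 < e"
      have "(\<lambda>j. \<bar>B\<bar> * q ^ j) \<longlonglongrightarrow> \<bar>B\<bar> * 0" using q by (intro tendsto_intros LIMSEQ_realpow_zero) auto
      then have "\<forall>\<^sub>F j in sequentially. \<bar>B\<bar> * q ^ j < e" using e by (simp add: order_tendstoD(2))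
      then have "\<forall>\<^sub>F j in sequentially. \<bar>B\<bar> * q ^ (n' + j) < e"
        using eventually_sequentially_seg[of "\<lambda>j. \<bar>B\<bar> * q ^ j < e" n'] by (simp add: add.commute)
      then show "\<forall>\<^sub>F j in sequentially. \<forall>x\<in>K. dist (F j x) (g x) < e"
      proof eventually_elim
        case (elim j)
        show ?case
        proof
          fix x assume "x \<in> K"
          then have "cmod (Z (n' + j) x - x) \<le> B * q ^ (n' + j)" using lim that by blast
          also have "\<dots> \<le> \<bar>B\<bar> * q ^ (n' + j)" using q by (intro mult_right_mono) auto
          finally show "dist (F j x) (g x) < e" using elim by (simp add: dist_norm F_def g_def norm_minus_commute)
        qed
      qed
    qed
    show "\<not> g constant_on ball t0 h"
    proof
      assume "g constant_on ball t0 h"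
      then have "g t = g t0" if "t \<in> ball t0 h" for t
        using that h unfolding constant_on_def by (metis centre_in_ball)
      then have "g t = 0" if "t \<in> ball t0 h" for t using that land by (simp add: g_def)
      then have "g 1 = 0"
        using analytic_continuation_open[of "ball t0 h" UNIV g "\<lambda>_. 0" 1] h holg by auto
      moreover have "crit_orbit D 0 n = 0" using D by (induction n) (auto simp: crit_orbit_Suc power_0_left)
      ultimately show False by (simp add: g_def)
    qed
  qed (use h in auto)
  then show False using land by (simp add: g_def)
qed

text \<open>
  At the parameter given by \<open>t0\<close> the critical orbit lands on the repelling fixed point \<open>t0\<close>; near
  \<open>t0\<close> there starts an orbit to the fixed point \<open>\<alpha>\<close>, and near \<open>\<alpha>\<close> one to the critical point. For
  nearby parameters there are critical orbits that follow this route and close up, after \<open>a * j\<close>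
  steps near \<open>t0\<close> and \<open>b * j\<close> steps near \<open>\<alpha>\<close>. Both numbers can be prescribed: the whole route is
  pulled back to a function \<open>Z j\<close> of the parameter, and the closing condition is the equation of the
  preceding lemma. As \<open>j\<close> grows, the expansion rate of the periodic critical orbit tends to the
  weighted mean \<open>ls\<close>.
\<close>

lemma eigenvalues_near_circle:
  fixes t0 \<alpha> :: complex
  assumes D: "2 \<le> D" and repB: "1 < cmod (of_nat D * t0 ^ (D - 1))"
    and fixA: "fixmap D t0 \<alpha> = \<alpha>" and repA: "1 < cmod (of_nat D * \<alpha> ^ (D - 1))"
    and le: "cmod \<alpha> \<le> cmod t0"
    and land: "crit_orbit D (t0 - t0 ^ D) (Suc n0) = t0"
    and path1: "\<And>\<epsilon>. 0 < \<epsilon> \<Longrightarrow> \<exists>u k. cmod (u - t0) < \<epsilon> \<and> (fixmap D t0 ^^ k) u = \<alpha> \<and> (\<forall>i<k. (fixmap D t0 ^^ i) u \<noteq> 0)"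
    and path2: "\<And>\<epsilon>. 0 < \<epsilon> \<Longrightarrow> \<exists>u k. cmod (u - \<alpha>) < \<epsilon> \<and> (fixmap D t0 ^^ k) u = 0 \<and> (\<forall>i<k. (fixmap D t0 ^^ i) u \<noteq> 0)"
    and ab: "0 < a" "0 < b"
    and ls: "real (a + b) * ls = real a * log_expansion D t0 + real b * log_expansion D \<alpha>"
    and lsD: "ls \<noteq> ln (real D)" and s0: "cmod s0 = exp ls"
  shows "1 / s0 \<in> closure (Sigma_set D)"
proof -
  have D1: "1 \<le> D" using D by simp
  have t00: "t0 \<noteq> 0" using repB D by (auto simp: power_0_left)
  have \<alpha>0: "\<alpha> \<noteq> 0" using repA D by (auto simp: power_0_left)
  define lb la where "lb = log_expansion D t0" and "la = log_expansion D \<alpha>"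
  have "la \<le> lb"
  proof -
    have "cmod \<alpha> ^ (D - 1) \<le> cmod t0 ^ (D - 1)" using le by (intro power_mono) auto
    then show ?thesis using D \<alpha>0 t00 by (simp add: la_def lb_def log_expansion_def)
  qed
  have l: "la \<le> ls" "ls \<le> lb"
  proof -
    have "real a * la \<le> real a * lb" "real b * la \<le> real b * lb" using \<open>la \<le> lb\<close> by (auto intro: mult_left_mono)
    then have "real (a + b) * la \<le> real (a + b) * ls" "real (a + b) * ls \<le> real (a + b) * lb"
      unfolding ls la_def[symmetric] lb_def[symmetric] by (simp_all add: distrib_right)
    then show "la \<le> ls" "ls \<le> lb" using ab by (auto simp: mult_le_cancel_left)
  qed

  have "0 < cmod t0 / 2" using t00 by simp
  obtain \<delta>B hB kB ibB where B: "0 < \<delta>B" "\<delta>B \<le> cmod t0 / 2" "0 < hB" "0 < kB" "kB < 1"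
    and stepB: "\<And>t w. t \<in> ball t0 hB \<Longrightarrow> w \<in> ball t0 \<delta>B \<Longrightarrow> ibB t w \<in> ball t0 \<delta>B \<and> fixmap D t (ibB t w) = w \<and>
       cmod (ibB t w - t0) \<le> kB * (cmod (w - t0) + cmod ((t - t ^ D) - (t0 - t0 ^ D))) \<and>
       (t0 = t0 \<longrightarrow> cmod (ibB t w - t) \<le> kB * cmod (w - t))"
    and holB: "\<And>A g. A \<subseteq> ball t0 hB \<Longrightarrow> g holomorphic_on A \<Longrightarrow> g ` A \<subseteq> ball t0 \<delta>B \<Longrightarrow> (\<lambda>t. ibB t (g t)) holomorphic_on A"
    by (rule repelling_contraction[OF D1 fixmap_fixed repB t00 \<open>0 < cmod t0 / 2\<close>]; rule that; assumption)
  obtain u ku where u: "cmod (u - t0) < \<delta>B / 2" "(fixmap D t0 ^^ ku) u = \<alpha>" "\<forall>i<ku. (fixmap D t0 ^^ i) u \<noteq> 0"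
    using path1[of "\<delta>B / 2"] B by auto
  obtain \<delta>U hU rU ibU where U: "0 < \<delta>U" "0 < hU" "0 < rU"
    and stepU: "\<forall>t w. t \<in> ball t0 hU \<longrightarrow> w \<in> ball \<alpha> \<delta>U \<longrightarrow> ibU t w \<in> ball u (\<delta>B / 2) \<and> (fixmap D t ^^ ku) (ibU t w) = w \<and>
      (\<forall>i<ku. rU \<le> cmod ((fixmap D t ^^ i) (ibU t w)) \<and> cmod ((fixmap D t ^^ i) (ibU t w)) \<le> 1 / rU)"
    and holU: "\<forall>A g. A \<subseteq> ball t0 hU \<longrightarrow> g holomorphic_on A \<longrightarrow> g ` A \<subseteq> ball \<alpha> \<delta>U \<longrightarrow> (\<lambda>t. ibU t (g t)) holomorphic_on A"
    using pullback_path[OF D1 u(3,2) half_gt_zero[OF B(1)]] by (elim exE conjE) (rule that; assumption)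
  have "0 < min (cmod \<alpha> / 2) \<delta>U" using \<alpha>0 U by simp
  obtain \<delta>A hA kA ibA where A: "0 < \<delta>A" "\<delta>A \<le> min (cmod \<alpha> / 2) \<delta>U" "0 < hA" "0 < kA" "kA < 1"
    and stepA: "\<And>t w. t \<in> ball t0 hA \<Longrightarrow> w \<in> ball \<alpha> \<delta>A \<Longrightarrow> ibA t w \<in> ball \<alpha> \<delta>A \<and> fixmap D t (ibA t w) = w \<and>
       cmod (ibA t w - \<alpha>) \<le> kA * (cmod (w - \<alpha>) + cmod ((t - t ^ D) - (t0 - t0 ^ D))) \<and>
       (\<alpha> = t0 \<longrightarrow> cmod (ibA t w - t) \<le> kA * cmod (w - t))"
    and holA: "\<And>A g. A \<subseteq> ball t0 hA \<Longrightarrow> g holomorphic_on A \<Longrightarrow> g ` A \<subseteq> ball \<alpha> \<delta>A \<Longrightarrow> (\<lambda>t. ibA t (g t)) holomorphic_on A"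
    by (rule repelling_contraction[OF D1 fixA repA \<alpha>0 \<open>0 < min (cmod \<alpha> / 2) \<delta>U\<close>]; rule that; assumption)
  obtain v kv where v: "cmod (v - \<alpha>) < \<delta>A / 2" "(fixmap D t0 ^^ kv) v = 0" "\<forall>i<kv. (fixmap D t0 ^^ i) v \<noteq> 0"
    using path2[of "\<delta>A / 2"] A by auto
  obtain \<delta>V hV rV ibV where V: "0 < \<delta>V" "0 < hV" "0 < rV"
    and stepV: "\<forall>t w. t \<in> ball t0 hV \<longrightarrow> w \<in> ball 0 \<delta>V \<longrightarrow> ibV t w \<in> ball v (\<delta>A / 2) \<and> (fixmap D t ^^ kv) (ibV t w) = w \<and>
      (\<forall>i<kv. rV \<le> cmod ((fixmap D t ^^ i) (ibV t w)) \<and> cmod ((fixmap D t ^^ i) (ibV t w)) \<le> 1 / rV)"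
    and holV: "\<forall>A g. A \<subseteq> ball t0 hV \<longrightarrow> g holomorphic_on A \<longrightarrow> g ` A \<subseteq> ball 0 \<delta>V \<longrightarrow> (\<lambda>t. ibV t (g t)) holomorphic_on A"
    using pullback_path[OF D1 v(3,2) half_gt_zero[OF A(1)]] by (elim exE conjE) (rule that; assumption)
  have fixt0: "umap D (t0 - t0 ^ D) t0 = t0" using fixmap_fixed[of D t0] by (simp add: fixmap_def)
  obtain rI hI where I: "0 < rI" "0 < hI"
    "\<forall>t\<in>ball t0 hI. \<forall>k<n0. rI \<le> cmod (crit_orbit D (t - t ^ D) (Suc k)) \<and> cmod (crit_orbit D (t - t ^ D) (Suc k)) \<le> 1 / rI"
  proof -
    have "isCont (\<lambda>t. crit_orbit D (t - t ^ D) (Suc k)) t0" for k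
      using crit_orbit_fixmap_holomorphic[of D "Suc k" UNIV]
      by (metis UNIV_I continuous_on_eq_continuous_at holomorphic_on_imp_continuous_on open_UNIV)
    moreover have "crit_orbit D (t0 - t0 ^ D) (Suc k) \<noteq> 0" for k
      by (rule preperiodic_critical_orbit_nonzero[OF fixt0 t00 land]) simp
    ultimately show ?thesis using bounded_away_near[where n = n0 and F = "\<lambda>k t. crit_orbit D (t - t ^ D) (Suc k)" and ?t0.0 = t0] that by blast
  qed
  define h where "h = min (min hB hU) (min (min hA hV) hI)"
  have h: "0 < h" using B U A V I by (simp add: h_def)
  have sub: "ball t0 h \<subseteq> ball t0 hB" "ball t0 h \<subseteq> ball t0 hU" "ball t0 h \<subseteq> ball t0 hA"
    "ball t0 h \<subseteq> ball t0 hV" "ball t0 h \<subseteq> ball t0 hI" by (auto simp: h_def)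

  \<comment> \<open>The route, read backwards from the critical point.\<close>
  define wv where "wv t = ibV t 0" for t
  define wA where "wA j t = (ibA t ^^ (b * j)) (wv t)" for j t
  define wu where "wu j t = ibU t (wA j t)" for j t
  define Z where "Z j t = (ibB t ^^ (a * j)) (wu j t)" for j t
  have wv: "wv t \<in> ball \<alpha> \<delta>A" if "t \<in> ball t0 h" for t
  proof -
    have "wv t \<in> ball v (\<delta>A / 2)" using stepV that sub V unfolding wv_def by (meson centre_in_ball subsetD)
    then have "dist \<alpha> (wv t) < \<delta>A / 2 + \<delta>A / 2"
      using v(1) dist_triangle[of \<alpha> "wv t" v] by (simp add: dist_norm norm_minus_commute)
    then show ?thesis by simp
  qed
  have holwv: "wv holomorphic_on ball t0 h"
    using holV[rule_format, of "ball t0 h" "\<lambda>_. 0"] sub(4) V unfolding wv_def[abs_def] by (simp add: image_subset_iff)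
  have wA_hol: "wA j holomorphic_on ball t0 h \<and> wA j ` ball t0 h \<subseteq> ball \<alpha> \<delta>A" for j
    unfolding wA_def[abs_def]
  proof (rule contraction_iterates_holomorphic)
    show "ibA t w \<in> ball \<alpha> \<delta>A" if "t \<in> ball t0 h" "w \<in> ball \<alpha> \<delta>A" for t w using stepA that sub by blast
    show "(\<lambda>t. ibA t (g t)) holomorphic_on ball t0 h" if "g holomorphic_on ball t0 h" "g ` ball t0 h \<subseteq> ball \<alpha> \<delta>A" for g
      using holA that sub by blast
  qed (use wv holwv in auto)
  have \<delta>AU: "ball \<alpha> \<delta>A \<subseteq> ball \<alpha> \<delta>U" using A by auto
  have wu: "wu j t \<in> ball t0 \<delta>B" if "t \<in> ball t0 h" for j t
  proof -
    have "wA j t \<in> wA j ` ball t0 h" using that by (rule imageI)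
    then have "wA j t \<in> ball \<alpha> \<delta>U" using wA_hol[of j] \<delta>AU by (meson subsetD)
    then have "wu j t \<in> ball u (\<delta>B / 2)"
      using stepU[rule_format, of t "wA j t"] subsetD[OF sub(2) that] unfolding wu_def by blast
    then have "dist t0 (wu j t) < \<delta>B / 2 + \<delta>B / 2"
      using u(1) dist_triangle[of t0 "wu j t" u] by (simp add: dist_norm norm_minus_commute)
    then show ?thesis by simp
  qed
  have holwu: "wu j holomorphic_on ball t0 h" for j
    unfolding wu_def[abs_def]
    using holU[rule_format, OF sub(2), of "wA j"] wA_hol[of j] subset_trans[OF _ \<delta>AU] by blast
  have holZ: "Z j holomorphic_on ball t0 h" for j
  proof -
    have "Z j holomorphic_on ball t0 h \<and> Z j ` ball t0 h \<subseteq> ball t0 \<delta>B"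
      unfolding Z_def[abs_def]
    proof (rule contraction_iterates_holomorphic)
      show "ibB t w \<in> ball t0 \<delta>B" if "t \<in> ball t0 h" "w \<in> ball t0 \<delta>B" for t w using stepB that sub by blast
      show "(\<lambda>t. ibB t (g t)) holomorphic_on ball t0 h" if "g holomorphic_on ball t0 h" "g ` ball t0 h \<subseteq> ball t0 \<delta>B" for g
        using holB that sub by blast
    qed (use wu holwu in auto)
    then show ?thesis by blast
  qed
  define dist_c where "dist_c t = cmod ((t - t ^ D) - (t0 - t0 ^ D))" for t
  have dc: "0 \<le> dist_c t" for t by (simp add: dist_c_def)
  have itB: "t \<in> ball t0 h \<Longrightarrow> t \<in> ball t0 hB"
    "\<And>w. t \<in> ball t0 h \<Longrightarrow> w \<in> ball t0 \<delta>B \<Longrightarrow> ibB t w \<in> ball t0 \<delta>B \<and> fixmap D t (ibB t w) = w \<and>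
       cmod (ibB t w - t0) \<le> kB * (cmod (w - t0) + dist_c t) \<and>
       (t0 = t0 \<longrightarrow> cmod (ibB t w - t) \<le> kB * cmod (w - t))" for t
    using sub stepB unfolding dist_c_def by blast+
  have itA: "t \<in> ball t0 h \<Longrightarrow> t \<in> ball t0 hA"
    "\<And>w. t \<in> ball t0 h \<Longrightarrow> w \<in> ball \<alpha> \<delta>A \<Longrightarrow> ibA t w \<in> ball \<alpha> \<delta>A \<and> fixmap D t (ibA t w) = w \<and>
       cmod (ibA t w - \<alpha>) \<le> kA * (cmod (w - \<alpha>) + dist_c t) \<and>
       (\<alpha> = t0 \<longrightarrow> cmod (ibA t w - t) \<le> kA * cmod (w - t))" for t
    using sub stepA unfolding dist_c_def by blast+
  note iterB = contraction_iterates[where ib = ibB and k = kB and p = t0 and ?t0.0 = t0 and h = hB and \<delta> = \<delta>B and D = D, OF B(4,5)]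
  note iterA = contraction_iterates[where ib = ibA and k = kA and p = \<alpha> and ?t0.0 = t0 and h = hA and \<delta> = \<delta>A and D = D, OF A(4,5)]
  have limZ: "cmod (Z j t - t) \<le> (\<delta>B + h) * (kB ^ a) ^ j" if t: "t \<in> ball t0 h" for j t
  proof -
    have "cmod (Z j t - t) \<le> kB ^ (a * j) * cmod (wu j t - t)"
      unfolding Z_def
      by (rule iterB(4)[OF itB(1)[OF t] wu[OF t] itB(2)[OF t] dc refl])
    also have "\<dots> \<le> kB ^ (a * j) * (\<delta>B + h)"
    proof (intro mult_left_mono)
      show "cmod (wu j t - t) \<le> \<delta>B + h"
        using wu[OF t, of j] t dist_triangle[of "wu j t" t t0] by (simp add: dist_norm norm_minus_commute)
    qed (use B in auto)
    finally show ?thesis by (simp add: power_mult mult.commute)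
  qed
  have "\<exists>j t. n \<le> j \<and> t \<in> ball t0 (min h (1 / real (Suc n))) \<and> crit_orbit D (t - t ^ D) (Suc n0) = Z j t" for n
  proof (rule solve_landing_equation[OF _ _ _ _ _ land D1])
    show "Z j holomorphic_on ball t0 (min h (1 / real (Suc n)))" for j
      by (rule holomorphic_on_subset[OF holZ]) auto
    show "cmod (Z j t - t) \<le> (\<delta>B + h) * (kB ^ a) ^ j" if "t \<in> ball t0 (min h (1 / real (Suc n)))" for j t
      using that by (intro limZ) auto
    show "kB ^ a < 1" using B ab by (simp add: power_less_one_iff)
  qed (use h B in auto)
  then obtain J tt where J: "\<And>n. n \<le> J n" and tt: "\<And>n. tt n \<in> ball t0 (min h (1 / real (Suc n)))"
    and eqn: "\<And>n. crit_orbit D (tt n - tt n ^ D) (Suc n0) = Z (J n) (tt n)" by metis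
  have tth: "tt n \<in> ball t0 h" for n using tt[of n] by simp
  have tt_lim: "tt \<longlonglongrightarrow> t0"
  proof -
    have "\<forall>\<^sub>F n in sequentially. cmod (tt n - t0) \<le> 1 / real (Suc n)"
      using tt by (intro always_eventually allI less_imp_le) (simp add: dist_norm norm_minus_commute)
    then have "(\<lambda>n. tt n - t0) \<longlonglongrightarrow> 0"
      by (rule Lim_null_comparison) (rule lim_1_over_n[THEN LIMSEQ_Suc])
    then show ?thesis by (rule LIM_zero_cancel)
  qed
  have dist_c_lim: "(\<lambda>n. dist_c (tt n)) \<longlonglongrightarrow> 0"
  proof -
    have "(\<lambda>n. dist_c (tt n)) \<longlonglongrightarrow> cmod ((t0 - t0 ^ D) - (t0 - t0 ^ D))"
      unfolding dist_c_def by (intro tendsto_intros tt_lim)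
    then show ?thesis by simp
  qed
  define c where "c n = tt n - tt n ^ D" for n
  let ?f = "\<lambda>n. umap D (c n)"
  let ?LB = "2 * real (D - 1) / cmod t0"
  let ?LA = "2 * real (D - 1) / cmod \<alpha>"
  \<comment> \<open>The orbit of the critical value has five pieces, of lengths \<open>n0\<close>, \<open>a * J n\<close>, \<open>ku\<close>, \<open>b * J n\<close> and \<open>kv\<close>;
    only the second and the fourth have unbounded length.\<close>
  define T where "T n = n0 + a * J n" for n
  define m where "m n = n0 + (a * J n + (ku + (b * J n + kv)))" for n
  define EB EA where "EB = ?LB * (kB / (1 - kB))"
    and "EA = ?LA * (kA / (1 - kA))"
  have E0: "0 \<le> EB" "0 \<le> EA" using B A by (auto simp: EB_def EA_def)
  define e where "e n = (EB + EA) * dist_c (tt n)" for n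
  have e0: "0 \<le> e n" for n using E0 dc by (simp add: e_def)
  have fm: "fixmap D (tt n) = ?f n" for n by (simp add: fixmap_def c_def)
  have x: "crit_orbit D (c n) (Suc i) = (?f n ^^ i) (c n)" for n i
    using D crit_orbit_add[of D "c n" 1 i] crit_orbit_Suc[of D "c n" 0] by (simp add: power_0_left)
  define lm where "lm n i = (if i < T n then lb else la)" for n i
  define bd where "bd r n l = real n * (ln (real D) + real (D - 1) * ln (1 / r) + \<bar>l\<bar>)" for r n l
  define C where "C = bd rI n0 lb + (?LB * \<delta>B / (1 - kB) +
     (bd rU ku la + (?LA * \<delta>A / (1 - kA) + bd rV kv la)))"
  have orb1: "(?f n ^^ n0) (c n) = Z (J n) (tt n)" for n
    using eqn[of n] x[of n n0] by (simp add: c_def)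
  have orb2: "(?f n ^^ (a * J n)) (Z (J n) (tt n)) = wu (J n) (tt n)" for n
    using iterB(2)[where i = "a * J n" and j = 0, OF itB(1)[OF tth[of n]] wu[OF tth, of "J n"] itB(2)[OF tth] dc]
    by (simp add: Z_def fm)
  have wAU: "wA (J n) (tt n) \<in> ball \<alpha> \<delta>U" for n using wA_hol tth \<delta>AU by blast
  have U': "(?f n ^^ ku) (wu (J n) (tt n)) = wA (J n) (tt n)"
    "i < ku \<Longrightarrow> rU \<le> cmod ((?f n ^^ i) (wu (J n) (tt n))) \<and> cmod ((?f n ^^ i) (wu (J n) (tt n))) \<le> 1 / rU" for n i
    using stepU[rule_format, of "tt n" "wA (J n) (tt n)"] tth[of n] sub wAU[of n] unfolding wu_def fm by blast+
  have orb4: "(?f n ^^ (b * J n)) (wA (J n) (tt n)) = wv (tt n)" for n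
    using iterA(2)[where i = "b * J n" and j = 0, OF itA(1)[OF tth[of n]] wv[OF tth] itA(2)[OF tth] dc]
    by (simp add: wA_def fm)
  have V': "(?f n ^^ kv) (wv (tt n)) = 0"
    "i < kv \<Longrightarrow> rV \<le> cmod ((?f n ^^ i) (wv (tt n))) \<and> cmod ((?f n ^^ i) (wv (tt n))) \<le> 1 / rV" for n i
    using stepV[rule_format, of "tt n" 0] tth[of n] sub V unfolding wv_def fm by auto
  have sh1: "shadows D (c n) (c n) n0 (lm n) (e n) (bd rI n0 lb)" for n
    unfolding bd_def
  proof (rule shadows_bounded[OF D1 I(1) e0])
    show "rI \<le> cmod ((?f n ^^ i) (c n)) \<and> cmod ((?f n ^^ i) (c n)) \<le> 1 / rI" if "i < n0" for i
      using I(3) tth[of n] sub(5) that x[of n i] unfolding c_def by (metis subsetD)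
    show "lm n i = lb" if "i < n0" for i using that by (simp add: lm_def T_def)
  qed
  have sh2: "shadows D (c n) (Z (J n) (tt n)) (a * J n) (\<lambda>i. lm n (n0 + i)) (e n) (?LB * \<delta>B / (1 - kB))" for n
  proof (rule shadows_mono[OF shadows_near_fixed_point[OF D1 t00 B(4,5,1)]])
    fix i assume i: "i < a * J n"
    have "(?f n ^^ i) (Z (J n) (tt n)) = (ibB (tt n) ^^ (a * J n - i)) (wu (J n) (tt n))"
      using iterB(2)[where i = i and j = "a * J n - i", OF itB(1)[OF tth[of n]] wu[OF tth, of "J n"] itB(2)[OF tth] dc] i
      by (simp add: Z_def fm)
    moreover have "(ibB (tt n) ^^ (a * J n - i)) (wu (J n) (tt n)) \<in> ball t0 \<delta>B"
      "cmod ((ibB (tt n) ^^ (a * J n - i)) (wu (J n) (tt n)) - t0) \<le> kB ^ (a * J n - i) * \<delta>B + kB / (1 - kB) * dist_c (tt n)"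
      using iterB(1,3)[OF itB(1)[OF tth] wu[OF tth] itB(2)[OF tth] dc] by blast+
    ultimately show "cmod ((?f n ^^ i) (Z (J n) (tt n)) - t0) \<le> cmod t0 / 2 \<and>
        cmod ((?f n ^^ i) (Z (J n) (tt n)) - t0) \<le> kB ^ (a * J n - i) * \<delta>B + kB / (1 - kB) * dist_c (tt n)"
      using B(2) by (auto simp: dist_norm norm_minus_commute)
    show "lm n (n0 + i) = log_expansion D t0" using i by (simp add: lm_def T_def lb_def)
  next
    have "?LB * (kB / (1 - kB) * dist_c (tt n)) = EB * dist_c (tt n)" by (simp add: EB_def)
    also have "\<dots> \<le> e n" using E0 dc by (simp add: e_def mult_right_mono)
    finally show "?LB * (kB / (1 - kB) * dist_c (tt n)) \<le> e n" .
  qed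
  have sh3: "shadows D (c n) (wu (J n) (tt n)) ku (\<lambda>i. lm n (n0 + (a * J n + i))) (e n) (bd rU ku la)" for n
    unfolding bd_def by (rule shadows_bounded[OF D1 U(3) e0 U'(2)]) (auto simp: lm_def T_def)
  have sh4: "shadows D (c n) (wA (J n) (tt n)) (b * J n) (\<lambda>i. lm n (n0 + (a * J n + (ku + i)))) (e n) (?LA * \<delta>A / (1 - kA))" for n
  proof (rule shadows_mono[OF shadows_near_fixed_point[OF D1 \<alpha>0 A(4,5,1)]])
    fix i assume i: "i < b * J n"
    have "(?f n ^^ i) (wA (J n) (tt n)) = (ibA (tt n) ^^ (b * J n - i)) (wv (tt n))"
      using iterA(2)[where i = i and j = "b * J n - i", OF itA(1)[OF tth[of n]] wv[OF tth] itA(2)[OF tth] dc] i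
      by (simp add: wA_def fm)
    moreover have "(ibA (tt n) ^^ (b * J n - i)) (wv (tt n)) \<in> ball \<alpha> \<delta>A"
      "cmod ((ibA (tt n) ^^ (b * J n - i)) (wv (tt n)) - \<alpha>) \<le> kA ^ (b * J n - i) * \<delta>A + kA / (1 - kA) * dist_c (tt n)"
      using iterA(1,3)[OF itA(1)[OF tth] wv[OF tth] itA(2)[OF tth] dc] by blast+
    ultimately show "cmod ((?f n ^^ i) (wA (J n) (tt n)) - \<alpha>) \<le> cmod \<alpha> / 2 \<and>
        cmod ((?f n ^^ i) (wA (J n) (tt n)) - \<alpha>) \<le> kA ^ (b * J n - i) * \<delta>A + kA / (1 - kA) * dist_c (tt n)"
      using A(2) by (auto simp: dist_norm norm_minus_commute)
    show "lm n (n0 + (a * J n + (ku + i))) = log_expansion D \<alpha>" by (simp add: lm_def T_def la_def)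
  next
    have "?LA * (kA / (1 - kA) * dist_c (tt n)) = EA * dist_c (tt n)" by (simp add: EA_def)
    also have "\<dots> \<le> e n" using E0 dc by (simp add: e_def mult_right_mono)
    finally show "?LA * (kA / (1 - kA) * dist_c (tt n)) \<le> e n" .
  qed
  have sh5: "shadows D (c n) (wv (tt n)) kv (\<lambda>i. lm n (n0 + (a * J n + (ku + (b * J n + i))))) (e n) (bd rV kv la)" for n
    unfolding bd_def by (rule shadows_bounded[OF D1 V(3) e0 V'(2)]) (auto simp: lm_def T_def)
  have sh: "shadows D (c n) (c n) (m n) (lm n) (e n) C" for n
    unfolding m_def C_def
    by (intro shadows_append sh1, unfold orb1, intro shadows_append sh2, unfold orb2,
        intro shadows_append sh3, unfold U'(1), intro shadows_append sh4, unfold orb4, rule sh5)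
  have nz: "crit_orbit D (c n) k \<noteq> 0" if k: "1 \<le> k" "k \<le> m n" for n k
  proof -
    obtain i where i: "k = Suc i" using k(1) by (cases k) auto
    with k(2) have "i < m n" by simp
    with i show ?thesis using sh[of n] x[of n i] unfolding shadows_def by metis
  qed
  have period: "crit_orbit D (c n) (Suc (m n)) = 0" for n
  proof -
    have "(?f n ^^ m n) (c n) = (?f n ^^ kv) ((?f n ^^ (b * J n)) ((?f n ^^ ku)
        ((?f n ^^ (a * J n)) ((?f n ^^ n0) (c n)))))"
      unfolding m_def by (simp add: funpow_add[symmetric, THEN fun_cong, unfolded o_def] add_ac)
    then show ?thesis unfolding x orb1 orb2 U'(1) orb4 V'(1) .
  qed
  have Tm: "T n \<le> m n" for n by (simp add: T_def m_def)
  define C' where "C' = \<bar>real n0 * lb + real (ku + kv) * la - real (n0 + ku + kv) * ls\<bar>"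
  have bal: "\<bar>real (T n) * lb + real (m n - T n) * la - real (m n) * ls\<bar> \<le> C'" for n
  proof -
    have "m n - T n = ku + kv + b * J n" by (simp add: m_def T_def)
    then have "real (T n) * lb + real (m n - T n) * la - real (m n) * ls
      = real n0 * lb + real (ku + kv) * la - real (n0 + ku + kv) * ls
        + real (J n) * (real a * lb + real b * la - real (a + b) * ls)"
      by (simp add: T_def m_def algebra_simps)
    also have "\<dots> = real n0 * lb + real (ku + kv) * la - real (n0 + ku + kv) * ls"
      using ls by (simp add: la_def lb_def)
    finally show ?thesis by (simp add: C'_def)
  qed
  have m_lim: "filterlim m at_top sequentially"
  proof (rule filterlim_at_top_mono[OF filterlim_ident])
    have "n \<le> m n" for n
    proof -
      have "n \<le> a * J n" using J[of n] ab by (metis One_nat_def Suc_leI le_trans mult_le_mono1 nat_mult_1)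
      then show ?thesis unfolding m_def by linarith
    qed
    then show "\<forall>\<^sub>F n in sequentially. n \<le> m n" by simp
  qed
  have e_lim: "e \<longlonglongrightarrow> 0" unfolding e_def[abs_def] using tendsto_mult_right_zero[OF dist_c_lim] by simp

  show ?thesis
    unfolding closure_approachable
  proof (intro allI impI)
    fix \<epsilon> :: real assume \<epsilon>: "0 < \<epsilon>"
    have s00: "s0 \<noteq> 0" using s0 by (metis exp_not_eq_zero norm_zero)
    have sD: "s0 \<noteq> of_nat D"
    proof
      assume "s0 = of_nat D"
      then have "exp ls = real D" using s0 by simp
      then show False using lsD by (metis ln_exp)
    qed
    have "isCont (\<lambda>s. 1 / s) s0" using s00 by (intro continuous_intros)
    then obtain d where d: "0 < d" "\<And>s. dist s s0 < d \<Longrightarrow> dist (1 / s) (1 / s0) < \<epsilon>"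
      unfolding continuous_at_eps_delta using \<epsilon> by metis
    define h' where "h' = min d (min (cmod s0) (cmod (s0 - of_nat D)))"
    have "0 < h'" using d s00 sD by (simp add: h'_def)
    then obtain n s where s: "cmod (s - s0) < h'" "(\<Sum>k\<le>m n. s ^ k / orbit_deriv D (c n) k) = 0"
      using zeros_of_orbit_sums[OF D1 sh[unfolded lm_def] m_lim e_lim Tm l bal s0] by blast
    have "s \<noteq> 0" "s \<noteq> of_nat D" using s(1) by (auto simp: h'_def norm_minus_commute)
    then have "1 / s \<in> Sigma_set D"
      by (intro eigenvalue_criterion[OF D period nz s(2)]) auto
    moreover have "dist (1 / s) (1 / s0) < \<epsilon>" using d(2)[of s] s(1) by (simp add: h'_def dist_norm)
    ultimately show "\<exists>y\<in>Sigma_set D. dist y (1 / s0) < \<epsilon>" by blast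
  qed
qed

lemma path_to_critical_point:
  assumes D: "1 \<le> D" and fix_p: "fixmap D t0 p = p" and rep: "1 < cmod (of_nat D * p ^ (D - 1))"
    and c: "t0 - t0 ^ D \<noteq> 0" and \<epsilon>: "0 < \<epsilon>"
  shows "\<exists>u k. cmod (u - p) < \<epsilon> \<and> (fixmap D t0 ^^ k) u = 0 \<and> (\<forall>i<k. (fixmap D t0 ^^ i) u \<noteq> 0)"
proof -
  obtain y where y: "y ^ D = - (t0 - t0 ^ D)"
  proof -
    have "card {z. z ^ D = - (t0 - t0 ^ D)} = D" using c D by (intro card_nth_roots) auto
    then have "{z. z ^ D = - (t0 - t0 ^ D)} \<noteq> {}" using D by (metis card.empty not_one_le_zero)
    then show ?thesis using that by blast
  qed
  have y0: "0 \<noteq> y" using y c D by (auto simp: power_0_left)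
  have "umap D (t0 - t0 ^ D) y = 0" using y by (simp add: umap_def)
  from preimages_accumulate_at_repelling[OF fix_p[unfolded fixmap_def] rep y0 this \<epsilon>]
  obtain n z where z: "cmod (z - p) < \<epsilon>" "(umap D (t0 - t0 ^ D) ^^ n) z = 0"
    by blast
  then have "(fixmap D t0 ^^ n) z = 0" by (simp add: fixmap_def)
  from first_visit_to_0[OF this] obtain l where "(fixmap D t0 ^^ l) z = 0" "\<forall>i<l. (fixmap D t0 ^^ i) z \<noteq> 0"
    by blast
  with z(1) show ?thesis by (intro exI[of _ z] exI[of _ l] conjI)
qed

section \<open>Circles from a single fixed point\<close>

text \<open>
  The circles are described in the variable \<open>s\<close>, the inverse of the eigenvalue.
\<close>

definition limit_circle :: "nat \<Rightarrow> real \<Rightarrow> bool" where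
  "limit_circle D x \<longleftrightarrow> 0 < x \<and> (\<forall>s. cmod s = x \<longrightarrow> 1 / s \<in> closure (Sigma_set D))"

lemma limit_circle_closed:
  assumes x: "0 < x" and ap: "\<And>\<epsilon>. 0 < \<epsilon> \<Longrightarrow> \<exists>y. limit_circle D y \<and> \<bar>y - x\<bar> < \<epsilon>"
  shows "limit_circle D x"
  unfolding limit_circle_def
proof (intro conjI allI impI)
  fix s assume s: "cmod s = x"
  have "\<exists>y. limit_circle D y \<and> \<bar>y - x\<bar> < 1 / real (Suc n)" for n by (rule ap) simp
  then obtain y where y: "\<And>n. limit_circle D (y n)" "\<And>n. \<bar>y n - x\<bar> < 1 / real (Suc n)" by metis
  have "(\<lambda>n. y n - x) \<longlonglongrightarrow> 0"
    by (rule Lim_null_comparison[OF _ lim_1_over_n[THEN LIMSEQ_Suc]])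
       (use y(2) in \<open>auto intro!: always_eventually less_imp_le\<close>)
  then have yx: "y \<longlonglongrightarrow> x" by (rule LIM_zero_cancel)
  have "1 / (s * of_real (y n / x)) \<in> closure (Sigma_set D)" for n
  proof -
    have "0 < y n" using y(1) by (simp add: limit_circle_def)
    then have "cmod (s * of_real (y n / x)) = y n" using s x by (simp only: norm_mult norm_of_real) simp
    then show ?thesis using y(1) unfolding limit_circle_def by blast
  qed
  moreover have "(\<lambda>n. 1 / (s * of_real (y n / x))) \<longlonglongrightarrow> 1 / (s * of_real (x / x))"
    using x s by (intro tendsto_intros yx) auto
  ultimately have "1 / (s * of_real (x / x)) \<in> closure (Sigma_set D)"
    by (rule closed_sequentially[OF closed_closure, of "\<lambda>n. 1 / (s * of_real (y n / x))"])
  then show "1 / s \<in> closure (Sigma_set D)" using x by simp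
qed (rule x)

lemma fixmap_diff: "crit_orbit D (t - t ^ D) (Suc n) - t = crit_orbit D (t - t ^ D) n ^ D - t ^ D"
  by (simp add: crit_orbit_Suc)

lemma power_diff_bound:
  fixes x y :: complex
  assumes "cmod x \<le> M" "cmod y \<le> M"
  shows "cmod (x ^ D - y ^ D) \<le> real D * M ^ (D - 1) * cmod (x - y)"
proof -
  have M: "0 \<le> M" using assms norm_ge_zero order_trans by blast
  have "cmod (\<Sum>i<D. y ^ (D - Suc i) * x ^ i) \<le> (\<Sum>i<D. M ^ (D - 1))"
  proof (rule sum_norm_le)
    fix i assume i: "i \<in> {..<D}"
    have "cmod (y ^ (D - Suc i) * x ^ i) \<le> M ^ (D - Suc i) * M ^ i"
      unfolding norm_mult norm_power using assms M by (intro mult_mono power_mono) auto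
    also have "\<dots> = M ^ (D - 1)" using i by (simp add: power_add[symmetric])
    finally show "cmod (y ^ (D - Suc i) * x ^ i) \<le> M ^ (D - 1)" .
  qed
  also have "\<dots> = real D * M ^ (D - 1)" by simp
  finally have "cmod (x - y) * cmod (\<Sum>i<D. y ^ (D - Suc i) * x ^ i) \<le> cmod (x - y) * (real D * M ^ (D - 1))"
    by (intro mult_left_mono) auto
  then show ?thesis unfolding power_diff_sumr2[of x D y] norm_mult by (simp add: mult_ac)
qed

text \<open>
  For small \<open>t\<close> the fixed point \<open>t\<close> is attracting and attracts the critical point.
\<close>

lemma crit_orbit_converges_small:
  assumes D: "2 \<le> D" and t: "cmod t \<le> 1 / (4 * real D)"
  shows "(\<lambda>n. crit_orbit D (t - t ^ D) n) \<longlonglongrightarrow> t"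
proof -
  let ?x = "crit_orbit D (t - t ^ D)"
  define M where "M = 1 / (2 * real D)"
  have M: "0 \<le> M" "M \<le> 1" using D by (auto simp: M_def)
  have DM: "real D * M ^ (D - 1) \<le> 1 / 2"
  proof -
    have "M ^ (D - 1) \<le> M ^ 1" using M D by (intro power_decreasing) auto
    then have "real D * M ^ (D - 1) \<le> real D * M" by (intro mult_left_mono) auto
    then show ?thesis using D by (simp add: M_def)
  qed
  have tM: "2 * cmod t \<le> M" using t D by (simp add: M_def field_simps)
  have b: "cmod (?x n - t) \<le> (1 / 2) ^ n * cmod t" for n
  proof (induction n)
    case (Suc n)
    have "(1 / 2) ^ n * cmod t \<le> 1 * cmod t" by (intro mult_right_mono power_le_one) auto
    then have "cmod (?x n - t) \<le> cmod t" using Suc by linarith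
    then have "cmod (?x n) \<le> M"
      using norm_triangle_sub[of "?x n" t] tM by linarith
    moreover have "cmod t \<le> M" using tM norm_ge_zero[of t] by linarith
    ultimately have "cmod (?x (Suc n) - t)
        \<le> real D * M ^ (D - 1) * cmod (?x n - t)"
      unfolding fixmap_diff by (rule power_diff_bound)
    also have "\<dots> \<le> 1 / 2 * ((1 / 2) ^ n * cmod t)" using DM Suc by (intro mult_mono) auto
    finally show ?case by simp
  qed simp
  have "(\<lambda>n. (1 / 2) ^ n * cmod t) \<longlonglongrightarrow> 0 * cmod t"
    by (intro tendsto_intros LIMSEQ_realpow_zero) auto
  then have lim: "(\<lambda>n. (1 / 2) ^ n * cmod t) \<longlonglongrightarrow> 0" by simp
  have "\<forall>\<^sub>F n in sequentially. cmod (?x n - t) \<le> (1 / 2) ^ n * cmod t"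
    by (intro always_eventually allI b)
  then have "(\<lambda>n. ?x n - t) \<longlonglongrightarrow> 0"
    using lim by (rule Lim_null_comparison)
  then show ?thesis by (rule LIM_zero_cancel)
qed

text \<open>
  Otherwise the identity would hold for all \<open>t\<close>; but \<open>t = 1\<close> gives \<open>z^D\<close>, whose critical orbit stays
  at 0.
\<close>

lemma crit_orbit_not_locally_fixed:
  assumes D: "1 \<le> D" and U: "open U" "U \<noteq> {}"
  shows "\<exists>t\<in>U. crit_orbit D (t - t ^ D) n \<noteq> t"
proof (rule ccontr)
  assume "\<not> ?thesis"
  moreover have "(\<lambda>t. crit_orbit D (t - t ^ D) n - t) holomorphic_on UNIV"
    by (intro holomorphic_intros crit_orbit_fixmap_holomorphic)
  ultimately have "crit_orbit D (1 - 1 ^ D) n - 1 = (0 :: complex)"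
    using analytic_continuation_open[of U UNIV "\<lambda>t. crit_orbit D (t - t ^ D) n - t" "\<lambda>_. 0" 1] U
    by auto
  moreover have "crit_orbit D 0 n = 0" using D by (induction n) (auto simp: crit_orbit_Suc power_0_left)
  ultimately show False by simp
qed

text \<open>
  A Vitali argument: the polynomials converge to \<open>t\<close> near 0, so by normality every limit function is
  the identity.
\<close>

lemma bounded_crit_orbits_converge:
  assumes D: "2 \<le> D" and R: "0 < R"
    and bd: "\<And>n t. t \<in> ball 0 R \<Longrightarrow> cmod (crit_orbit D (t - t ^ D) n) \<le> B"
    and K: "compact K" "K \<subseteq> ball 0 R" and e: "0 < e"
  shows "\<exists>n0. \<forall>n\<ge>n0. \<forall>t\<in>K. cmod (crit_orbit D (t - t ^ D) n - t) < e"
proof (rule ccontr)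
  define p where "p n t = crit_orbit D (t - t ^ D) n" for n t
  assume "\<not> ?thesis"
  then have "\<forall>n. \<exists>n'\<ge>n. \<exists>t\<in>K. e \<le> cmod (p n' t - t)" by (auto simp: p_def not_less)
  then obtain \<nu> where \<nu>: "\<And>n. n \<le> \<nu> n" "\<And>n. \<exists>t\<in>K. e \<le> cmod (p (\<nu> n) t - t)" by metis
  obtain g r where g: "g holomorphic_on ball 0 R" "strict_mono (r :: nat \<Rightarrow> nat)"
    "\<And>z. z \<in> ball 0 R \<Longrightarrow> (\<lambda>n. p (\<nu> (r n)) z) \<longlonglongrightarrow> g z"
    "\<And>K. compact K \<Longrightarrow> K \<subseteq> ball 0 R \<Longrightarrow> uniform_limit K ((\<lambda>n. p (\<nu> n)) \<circ> r) g sequentially"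
  proof (rule Montel_eventually[of "ball 0 R" "\<lambda>n. p (\<nu> n)"])
    show "p (\<nu> j) holomorphic_on ball 0 R" for j unfolding p_def by (rule crit_orbit_fixmap_holomorphic)
    show "\<exists>B. \<forall>\<^sub>F j in sequentially. \<forall>z\<in>K. cmod (p (\<nu> j) z) \<le> B" if "compact K" "K \<subseteq> ball 0 R" for K
      using bd that by (intro exI[of _ B] always_eventually) (auto simp: p_def)
  qed auto
  have "filterlim \<nu> at_top sequentially"
    by (rule filterlim_at_top_mono[OF filterlim_ident]) (use \<nu> in auto)
  then have \<nu>r: "filterlim (\<lambda>n. \<nu> (r n)) at_top sequentially"
    by (rule filterlim_compose) (rule filterlim_subseq[OF g(2)])
  define \<rho> where "\<rho> = min R (1 / (4 * real D))"
  have \<rho>: "0 < \<rho>" using R D by (simp add: \<rho>_def)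
  have "g z = z" if z: "z \<in> ball 0 \<rho>" for z
  proof -
    have "(\<lambda>n. p n z) \<longlonglongrightarrow> z" unfolding p_def using z by (intro crit_orbit_converges_small[OF D]) (auto simp: \<rho>_def)
    then have "(\<lambda>n. p (\<nu> (r n)) z) \<longlonglongrightarrow> z" by (rule filterlim_compose[OF _ \<nu>r])
    moreover have "(\<lambda>n. p (\<nu> (r n)) z) \<longlonglongrightarrow> g z" using z by (intro g(3)) (auto simp: \<rho>_def)
    ultimately show ?thesis using LIMSEQ_unique by blast
  qed
  moreover have "ball 0 \<rho> \<subseteq> ball (0::complex) R" by (auto simp: \<rho>_def)
  ultimately have gz: "g z = z" if "z \<in> ball 0 R" for z
    using analytic_continuation_open[of "ball 0 \<rho>" "ball 0 R" g "\<lambda>z. z" z] that \<rho> R g(1)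
    by auto
  have "\<forall>\<^sub>F n in sequentially. \<forall>x\<in>K. dist (p (\<nu> (r n)) x) (g x) < e"
    using uniform_limitD[OF g(4)[OF K] e] by simp
  then obtain n where n: "\<forall>x\<in>K. dist (p (\<nu> (r n)) x) (g x) < e"
    using eventually_happens[of _ sequentially] by auto
  have "\<forall>x\<in>K. cmod (p (\<nu> (r n)) x - x) < e"
  proof
    fix x assume x: "x \<in> K"
    then have "g x = x" using gz K(2) by blast
    then show "cmod (p (\<nu> (r n)) x - x) < e" using n x by (metis dist_norm)
  qed
  then show False using \<nu>(2)[of "r n"] by (meson not_le)
qed

text \<open>
  Otherwise the critical orbits would converge to \<open>t\<close> on the whole disc, which reaches values of \<open>t\<close>
  for which \<open>t\<close> is repelling. An orbit that converges to a repelling fixed point lands on it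
  exactly, here after the same number of steps for an open set of parameters.
\<close>

lemma unbounded_crit_orbits:
  assumes D: "2 \<le> D" and R: "0 < R" "1 < real D * R ^ (D - 1)"
  shows "\<exists>n t. t \<in> ball 0 R \<and> B < cmod (crit_orbit D (t - t ^ D) n)"
proof (rule ccontr)
  assume "\<not> ?thesis"
  then have bd: "\<And>n t. t \<in> ball 0 R \<Longrightarrow> cmod (crit_orbit D (t - t ^ D) n) \<le> B" by (meson not_le)
  have "isCont (\<lambda>x. real D * x ^ (D - 1)) R" by (intro continuous_intros)
  then have "((\<lambda>x. real D * x ^ (D - 1)) \<longlongrightarrow> real D * R ^ (D - 1)) (at_left R)"
    unfolding isCont_def by (rule tendsto_within_subset) auto
  then have "\<forall>\<^sub>F x in at_left R. 1 < real D * x ^ (D - 1)" using R(2) by (rule order_tendstoD(1))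
  moreover have "\<forall>\<^sub>F x in at_left R. x \<in> {0<..<R}" using R(1) by (rule eventually_at_left_real)
  ultimately have "\<forall>\<^sub>F x in at_left R. 1 < real D * x ^ (D - 1) \<and> x \<in> {0<..<R}" by (rule eventually_conj)
  then obtain x where x: "1 < real D * x ^ (D - 1)" "0 < x" "x < R"
    using eventually_happens[of _ "at_left R"] by (auto simp: trivial_limit_at_left_real)
  define p where "p = complex_of_real x"
  have rep: "1 < cmod (of_nat D * p ^ (D - 1))" using x by (simp add: p_def norm_mult norm_power)
  obtain \<epsilon> \<kappa> where \<epsilon>: "0 < \<epsilon>" "0 < \<kappa>" "\<kappa> < 1"
    and ex: "\<And>x y. cmod (x - p) < \<epsilon> \<Longrightarrow> cmod (y - p) < \<epsilon> \<Longrightarrow> cmod (x - y) \<le> \<kappa> * cmod (x ^ D - y ^ D)"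
    using power_expanding_near[OF rep] by blast
  define d where "d = min (\<epsilon> / 2) ((R - x) / 2)"
  have d: "0 < d" "d \<le> \<epsilon> / 2" using \<epsilon> x by (auto simp: d_def)
  have sub: "cball p d \<subseteq> ball 0 R"
  proof
    fix z assume "z \<in> cball p d"
    then have "cmod z \<le> cmod p + d" using norm_triangle_sub[of z p] by (simp add: dist_norm norm_minus_commute)
    also have "cmod p + d < R"
    proof -
      have "d \<le> (R - x) / 2" unfolding d_def by (rule min.cobounded2)
      then have "d * 2 \<le> R - x" by simp
      moreover have "cmod p = x" using x by (simp add: p_def)
      ultimately show ?thesis using x by linarith
    qed
    finally show "z \<in> ball 0 R" by simp
  qed
  have "\<exists>n0. \<forall>n\<ge>n0. \<forall>t\<in>cball p d. cmod (crit_orbit D (t - t ^ D) n - t) < \<epsilon> / 2"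
    by (rule bounded_crit_orbits_converge[OF D R(1) bd compact_cball sub half_gt_zero[OF \<epsilon>(1)]])
  then obtain n0 where n0: "\<And>n t. n \<ge> n0 \<Longrightarrow> t \<in> cball p d \<Longrightarrow> cmod (crit_orbit D (t - t ^ D) n - t) < \<epsilon> / 2"
    by blast
  have "crit_orbit D (t - t ^ D) n0 = t" if t: "t \<in> ball p d" for t
  proof -
    let ?x = "crit_orbit D (t - t ^ D)"
    have tp: "cmod (t - p) < \<epsilon> / 2" using t d by (simp add: dist_norm norm_minus_commute)
    have step: "cmod (?x n - t) \<le> \<kappa> * cmod (?x (Suc n) - t)" if "n \<ge> n0" for n
    proof -
      have "cmod (?x n - t) < \<epsilon> / 2" using n0[OF that] t by simp
      then have "cmod (?x n - p) < \<epsilon>"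
        using tp norm_triangle_ineq[of "?x n - t" "t - p"] by simp
      then show ?thesis unfolding fixmap_diff using tp \<epsilon> by (intro ex) auto
    qed
    have "cmod (?x n0 - t) \<le> \<kappa> ^ k * cmod (?x (n0 + k) - t)" for k
    proof (induction k)
      case (Suc k)
      have "\<kappa> ^ k * cmod (?x (n0 + k) - t)
          \<le> \<kappa> ^ k * (\<kappa> * cmod (?x (Suc (n0 + k)) - t))"
        using step[of "n0 + k"] \<epsilon> by (intro mult_left_mono) auto
      with Suc show ?case by (simp add: mult_ac)
    qed simp
    moreover have "\<kappa> ^ k * cmod (?x (n0 + k) - t) \<le> \<kappa> ^ k * (\<epsilon> / 2)" for k
      using n0[of "n0 + k" t] t \<epsilon> by (intro mult_left_mono) auto
    ultimately have le: "cmod (?x n0 - t) \<le> \<kappa> ^ k * (\<epsilon> / 2)" for k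
      using order_trans by blast
    have "(\<lambda>k. \<kappa> ^ k * (\<epsilon> / 2)) \<longlonglongrightarrow> 0 * (\<epsilon> / 2)"
      using \<epsilon> by (intro tendsto_intros LIMSEQ_realpow_zero) auto
    then have "cmod (?x n0 - t) \<le> 0 * (\<epsilon> / 2)"
      by (rule LIMSEQ_le_const) (use le in blast)
    then show ?thesis by simp
  qed
  then show False using crit_orbit_not_locally_fixed[of D "ball p d" n0] D d by auto
qed

text \<open>
  If the critical orbit never landed on \<open>t\<close> or, one step earlier, on \<open>w * t\<close>, then the functions
  \<open>crit_orbit / t\<close> would omit 1 and \<open>w\<close> on an annulus. At \<open>t = R\<close> they are bounded, since the
  interval from 0 to \<open>R\<close> is then invariant. So they would be bounded on the circle of radius \<open>R\<close>,
  and inside it by the maximum principle, against the preceding lemma.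
\<close>

lemma landing_parameters_near_circle:
  assumes D: "2 \<le> D" and R: "0 < R" "R < 1" "1 < real D * R ^ (D - 1)"
    and w: "w ^ D = 1" "1 \<le> cmod (w - 1)" and \<eta>: "0 < \<eta>"
  shows "\<exists>t n. \<bar>cmod t - R\<bar> < \<eta> \<and> t \<noteq> 0 \<and> crit_orbit D (t - t ^ D) n = t"
proof (rule ccontr)
  assume contra: "\<not> ?thesis"
  define p where "p n t = crit_orbit D (t - t ^ D) n" for n t
  define \<eta>' where "\<eta>' = min \<eta> (R / 2)"
  define A where "A = {z :: complex. R - \<eta>' < cmod (z - 0) \<and> cmod (z - 0) < R + \<eta>'}"
  have \<eta>': "0 < \<eta>'" "\<eta>' < R" using \<eta> R by (auto simp: \<eta>'_def)
  have A0: "t \<noteq> 0" if "t \<in> A" for t using that \<eta>' by (auto simp: A_def)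
  have p1: "p n t \<noteq> t" if "t \<in> A" for n t
  proof -
    have "\<bar>cmod t - R\<bar> < \<eta>'" using that by (auto simp: A_def)
    then have "\<bar>cmod t - R\<bar> < \<eta>" by (simp add: \<eta>'_def)
    then show ?thesis using contra A0[OF that] unfolding p_def by blast
  qed
  have p2: "p n t \<noteq> w * t" if "t \<in> A" for n t
  proof
    assume "p n t = w * t"
    then have "p (Suc n) t = t" by (simp add: p_def crit_orbit_Suc power_mult_distrib w)
    then show False using p1[OF that] by blast
  qed
  have w1: "w - 1 \<noteq> 0" using w(2) by auto
  define h where "h n t = (p n t / t - 1) / (w - 1)" for n t
  define r where "r = complex_of_real R"
  obtain B where B: "\<And>f z. f \<in> range h \<Longrightarrow> z \<in> sphere 0 R \<Longrightarrow> cmod (f z) \<le> B"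
  proof (rule GPicard3[of A r "range h" "range h" "sphere 0 R"])
    show "open A" unfolding A_def by (intro open_Collect_conj open_Collect_less continuous_intros)
    show "connected A" unfolding A_def by (rule connected_annulus) simp
    show "r \<in> A" using R \<eta>' by (simp add: A_def r_def)
    show "f holomorphic_on A" if "f \<in> range h" for f
      using that w1 A0 unfolding h_def p_def by (auto intro!: holomorphic_intros crit_orbit_fixmap_holomorphic)
    show "f z \<noteq> 0 \<and> f z \<noteq> 1" if "f \<in> range h" "z \<in> A" for f z
      using that(1) w1 p1[OF that(2)] p2[OF that(2)] A0[OF that(2)] by (auto simp: h_def field_simps)
    show "cmod (f r) \<le> 1" if fh: "f \<in> range h" for f
    proof -
      obtain n where f: "f = h n" using fh by blast
      have "\<exists>y. p n r = complex_of_real y \<and> 0 \<le> y \<and> y \<le> R"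
      proof (induction n)
        case (Suc n)
        then obtain y where y: "p n r = complex_of_real y" "0 \<le> y" "y \<le> R" by blast
        have "p (Suc n) r = complex_of_real (y ^ D + (R - R ^ D))"
          using y by (simp add: p_def crit_orbit_Suc r_def)
        moreover have "y ^ D \<le> R ^ D" using y by (intro power_mono) auto
        moreover have "R ^ D \<le> R ^ 1" using R D by (intro power_decreasing) auto
        moreover have "0 \<le> y ^ D" using y by simp
        ultimately show ?case by (intro exI[of _ "y ^ D + (R - R ^ D)"]) auto
      qed (use R in \<open>auto simp: p_def intro!: exI[of _ 0]\<close>)
      then obtain y where y: "p n r = complex_of_real y" "0 \<le> y" "y \<le> R" by blast
      have "p n r / r - 1 = complex_of_real (y / R - 1)" using y by (simp add: r_def)
      then have "cmod (p n r / r - 1) = \<bar>y / R - 1\<bar>" by (metis norm_of_real)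
      also have "\<dots> \<le> 1" using y R by (simp add: abs_le_iff field_simps)
      finally have "cmod (p n r / r - 1) \<le> 1" .
      then have "cmod (p n r / r - 1) / cmod (w - 1) \<le> 1" using w(2) by (simp add: divide_le_eq_1)
      then show ?thesis by (simp add: f h_def norm_divide)
    qed
    show "sphere 0 R \<subseteq> A" using \<eta>' by (auto simp: A_def)
  qed auto
  have bound: "cmod (p n t) \<le> R * (B * cmod (w - 1) + 1)" if t: "t \<in> ball 0 R" for n t
  proof (rule maximum_modulus_frontier[of "p n" "ball 0 R"])
    show "p n holomorphic_on interior (ball 0 R)" unfolding p_def by (rule crit_orbit_fixmap_holomorphic)
    show "continuous_on (closure (ball 0 R)) (p n)"
      unfolding p_def by (intro holomorphic_on_imp_continuous_on crit_orbit_fixmap_holomorphic)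
    fix z :: complex assume "z \<in> frontier (ball 0 R)"
    then have z: "cmod z = R" using R by simp
    then have "cmod (h n z) \<le> B" by (intro B) auto
    then have "cmod (p n z / z - 1) \<le> B * cmod (w - 1)" using w1 by (simp add: h_def norm_divide field_simps)
    then have "cmod (p n z / z) \<le> B * cmod (w - 1) + 1"
      using norm_triangle_sub[of "p n z / z" 1] by simp
    then show "cmod (p n z) \<le> R * (B * cmod (w - 1) + 1)" using z R by (simp add: norm_divide field_simps)
  qed (use t in auto)
  then show False
    using unbounded_crit_orbits[OF D R(1,3), of "R * (B * cmod (w - 1) + 1)"] unfolding p_def by (meson not_le)
qed

text \<open>
  Here both fixed points of the route coincide, and all steps take place near one fixed point.
\<close>

lemma limit_circle_below:
  assumes D: "2 \<le> D" and R: "0 < R" "R < 1" "1 < real D * R ^ (D - 1)"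
    and w: "w ^ D = 1" "1 \<le> cmod (w - 1)"
  shows "limit_circle D (real D * R ^ (D - 1))"
proof (rule limit_circle_closed)
  show "0 < real D * R ^ (D - 1)" using R D by simp
  fix \<epsilon> :: real assume \<epsilon>: "0 < \<epsilon>"
  have "isCont (\<lambda>x. real D * x ^ (D - 1)) R" by (intro continuous_intros)
  moreover have "0 < min \<epsilon> (real D * R ^ (D - 1) - 1)" using \<epsilon> R by simp
  ultimately obtain \<eta> where \<eta>: "0 < \<eta>"
    "\<And>x. \<bar>x - R\<bar> < \<eta> \<Longrightarrow> \<bar>real D * x ^ (D - 1) - real D * R ^ (D - 1)\<bar> < min \<epsilon> (real D * R ^ (D - 1) - 1)"
    unfolding continuous_at_eps_delta by (metis dist_real_def)
  obtain t n where t: "\<bar>cmod t - R\<bar> < min \<eta> (1 - R)" "t \<noteq> 0" "crit_orbit D (t - t ^ D) n = t"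
    using landing_parameters_near_circle[OF D R w, of "min \<eta> (1 - R)"] \<eta> R by auto
  define x where "x = real D * cmod t ^ (D - 1)"
  have h: "\<bar>x - real D * R ^ (D - 1)\<bar> < min \<epsilon> (real D * R ^ (D - 1) - 1)"
    using \<eta>(2)[of "cmod t"] t(1) by (simp add: x_def)
  then have "\<bar>x - real D * R ^ (D - 1)\<bar> < real D * R ^ (D - 1) - 1" by simp
  then have "1 < x" unfolding abs_less_iff by linarith
  with h have x: "\<bar>x - real D * R ^ (D - 1)\<bar> < \<epsilon>" "1 < x" by simp_all
  have t1: "cmod t < 1" using t(1) by linarith
  have rep: "1 < cmod (of_nat D * t ^ (D - 1))" using x by (simp add: x_def norm_mult norm_power)
  obtain n' where n': "n = Suc n'" using t(2,3) by (cases n) auto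
  have tD: "cmod t ^ (D - 1) < 1" using t1 D by (simp add: power_less_one_iff)
  have c: "t - t ^ D \<noteq> 0"
  proof
    assume "t - t ^ D = 0"
    then have "t * t ^ (D - 1) = t" using D by (metis Suc_1 Suc_le_D diff_Suc_1 eq_iff_diff_eq_0 power_Suc)
    then have "t ^ (D - 1) = 1" using t(2) by simp
    then show False using tD by (metis less_irrefl norm_one norm_power)
  qed
  have "limit_circle D x"
    unfolding limit_circle_def
  proof (intro conjI allI impI)
    fix s assume s: "cmod s = x"
    show "1 / s \<in> closure (Sigma_set D)"
    proof (rule eigenvalues_near_circle[where ?t0.0 = t and \<alpha> = t and a = 1 and b = 1 and ls = "log_expansion D t"])
      show "crit_orbit D (t - t ^ D) (Suc n') = t" using t n' by simp
      show "\<exists>u k. cmod (u - t) < \<epsilon> \<and> (fixmap D t ^^ k) u = t \<and> (\<forall>i<k. (fixmap D t ^^ i) u \<noteq> 0)" if "0 < \<epsilon>" for \<epsilon>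
        using that by (intro exI[of _ t] exI[of _ 0]) auto
      show "\<exists>u k. cmod (u - t) < \<epsilon> \<and> (fixmap D t ^^ k) u = 0 \<and> (\<forall>i<k. (fixmap D t ^^ i) u \<noteq> 0)" if "0 < \<epsilon>" for \<epsilon>
        by (rule path_to_critical_point[OF _ fixmap_fixed rep c that]) (use D in simp)
      have le: "log_expansion D t = ln x" by (simp add: log_expansion_def x_def)
      have "x \<noteq> real D" using tD D by (auto simp: x_def)
      then show "log_expansion D t \<noteq> ln (real D)" using x D by (simp add: le)
      show "cmod s = exp (log_expansion D t)" using s x by (simp add: le)
    qed (use D rep fixmap_fixed in auto)
  qed (use x in simp)
  then show "\<exists>y. limit_circle D y \<and> \<bar>y - real D * R ^ (D - 1)\<bar> < \<epsilon>" using x by blast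
qed

section \<open>Circles from two fixed points\<close>

text \<open>
  The best choice is \<open>-1\<close> for even \<open>D\<close>, and one of the two roots of unity closest to \<open>-1\<close> for odd
  \<open>D\<close>. The constant \<open>r_radius\<close> is thus the inverse of \<open>D\<close> times the maximal distance of a \<open>D\<close>-th
  root of unity from 1. The bound by 3 serves to exclude fixed points that do not repel.
\<close>

lemma exists_root_of_unity_far_from_1:
  assumes D: "2 \<le> D"
  defines "m \<equiv> 1 / (real D * r_radius D)"
  obtains w :: complex where "w ^ D = 1" "cmod (1 - w) = m" "1 < m" "3 < real D * m"
proof (cases "even D")
  case True
  have m: "m = 2" using True D by (simp add: m_def r_radius_def)
  show thesis
    by (rule that[of "-1"]) (use True D m in \<open>auto simp: uminus_power_if\<close>)
next
  case False
  define x where "x = pi / (2 * real D)"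
  have D3: "3 \<le> D" using False D by (cases "D = 2") auto
  have m: "m = 2 * cos x" using False D by (simp add: m_def r_radius_def x_def)
  have x: "0 \<le> x" "x < pi / 3" using D3 pi_gt_zero by (auto simp: x_def field_simps)
  have "cos (pi / 3) < cos x" using x pi_gt_zero by (intro cos_monotone_0_pi) auto
  then have m1: "1 < m" by (simp add: m cos_60)
  define w where "w = cis (pi - 2 * x)"
  have "real D * (pi - 2 * x) = real (D - 1) * pi" using D by (simp add: x_def right_diff_distrib of_nat_diff left_diff_distrib)
  then have "w ^ D = cis (real (D - 1) * pi)" by (simp add: w_def Complex.DeMoivre)
  also have "\<dots> = (-1) ^ (D - 1)" by (metis Complex.DeMoivre cis_pi)
  also have "\<dots> = 1" using False D by simp
  finally have "w ^ D = 1" .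
  moreover have "cmod (1 - w) = m"
  proof -
    have "(cmod (1 - w))\<^sup>2 = (1 + cos (2 * x))\<^sup>2 + (sin (2 * x))\<^sup>2"
      unfolding cmod_power2 by (simp add: w_def)
    also have "\<dots> = 2 + 2 * cos (2 * x)" using sin_cos_squared_add[of "2 * x"] by (simp add: power2_eq_square algebra_simps)
    also have "\<dots> = m\<^sup>2" unfolding cos_double_cos m by (simp add: power2_eq_square)
    finally show ?thesis using m1 by (simp add: power2_eq_iff_nonneg)
  qed
  moreover have "3 < real D * m"
  proof -
    have "3 * 1 < real D * m" using D3 m1 by (intro mult_le_less_imp_less) auto
    then show ?thesis by simp
  qed
  ultimately show thesis using m1 that by blast
qed

lemma prod_mset_gt_1:
  fixes A :: "complex multiset"
  assumes "\<And>x. x \<in># A \<Longrightarrow> 1 < cmod x" "A \<noteq> {#}"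
  shows "1 < cmod (\<Prod>x\<in>#A. - x)"
  using assms
proof (induction A)
  case (add x A)
  show ?case
  proof (cases "A = {#}")
    case False
    then have "1 < cmod (\<Prod>x\<in>#A. - x)" using add by auto
    moreover have "1 < cmod x" using add.prems by auto
    ultimately show ?thesis by (simp add: norm_mult less_1_mult)
  qed (use add.prems in auto)
qed simp

lemma monic_small_root:
  fixes q :: "complex poly"
  assumes "lead_coeff q = 1" "0 < degree q" "cmod (poly q 0) \<le> 1"
  obtains x where "poly q x = 0" "cmod x \<le> 1"
proof -
  have "q \<noteq> 0" using assms(2) by auto
  then obtain A where A: "size A = degree q" "q = smult (lead_coeff q) (\<Prod>x\<in>#A. [:-x, 1:])"
    using alg_closed_imp_factorization by blast
  have pq: "poly q z = (\<Prod>x\<in>#A. z - x)" for z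
  proof -
    have "poly (\<Prod>x\<in>#A. [:-x, 1:]) z = (\<Prod>x\<in>#A. z - x)" by (induction A) (auto simp: algebra_simps)
    then show ?thesis using A(2) assms(1) by (metis smult_1_left)
  qed
  have "A \<noteq> {#}" using A(1) assms(2) by auto
  have "\<exists>x. x \<in># A \<and> cmod x \<le> 1"
  proof (rule ccontr)
    assume "\<not> ?thesis"
    then have "1 < cmod (\<Prod>x\<in>#A. - x)" using \<open>A \<noteq> {#}\<close> by (intro prod_mset_gt_1) (auto simp: not_le)
    then show False using pq[of 0] assms(3) by simp
  qed
  then obtain x where x: "x \<in># A" "cmod x \<le> 1" by blast
  have "poly q x = 0" unfolding pq using x(1) by (auto simp: prod_mset_zero_iff)
  with x that show thesis by blast
qed

text \<open>
  The critical orbit of \<open>z^D + w * b\<close> is \<open>0, w * b, b, b, \<dots>\<close>, and \<open>b\<close> is a fixed point of derivative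
  \<open>D * (1 - w)\<close>. The other fixed points have a product of modulus 1, so one of them, \<open>\<alpha>\<close>, has
  derivative of modulus at most \<open>D\<close>. Orbits that visit both realize the means of the two rates with
  rational weights, and these are dense.
\<close>

lemma limit_circle_above:
  assumes D: "2 \<le> D" and w: "w ^ D = 1" "cmod (1 - w) = m" "1 < m" "3 < real D * m"
    and x: "real D < x" "x < real D * m"
  shows "limit_circle D x"
proof -
  have w1: "w \<noteq> 1" using w by auto
  have w_norm: "cmod w = 1" using power_eq_1_iff[OF w(1)] D by auto
  obtain b where b: "b ^ (D - 1) = 1 - w"
  proof -
    have "card {z. z ^ (D - 1) = 1 - w} = D - 1" using w1 D by (intro card_nth_roots) auto
    moreover have "D - 1 \<noteq> 0" using D by simp
    ultimately have "{z. z ^ (D - 1) = 1 - w} \<noteq> {}" by (metis card.empty)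
    then show ?thesis using that by blast
  qed
  have DS: "z ^ D = z ^ (D - 1) * z" for z :: complex
    using D by (metis Suc_1 Suc_le_D diff_Suc_1 power_Suc2)
  have c: "b - b ^ D = w * b" unfolding DS[of b] b by (simp add: algebra_simps)
  have bm: "cmod b ^ (D - 1) = m" using b w(2) by (metis norm_power)
  have b1: "1 < cmod b"
  proof (rule ccontr)
    assume "\<not> 1 < cmod b"
    then have "cmod b ^ (D - 1) \<le> 1" by (intro power_le_one) auto
    with bm w(3) show False by simp
  qed
  have b0: "b \<noteq> 0" using b1 by auto
  have w0: "w \<noteq> 0" using w_norm by auto

  \<comment> \<open>The fixed point equation divided by \<open>z - b\<close>; its value at 0 is \<open>-w\<close>, of modulus 1.\<close>
  define q where "q = (\<Sum>i<D. monom (b ^ (D - Suc i)) i) - 1"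
  have cq: "coeff q i = (if i < D then b ^ (D - Suc i) else 0) - (if i = 0 then 1 else 0)" for i
    unfolding q_def by (simp add: coeff_sum)
  have dq: "degree q = D - 1"
  proof (rule antisym)
    show "degree q \<le> D - 1" by (rule degree_le) (use D in \<open>auto simp: cq\<close>)
    show "D - 1 \<le> degree q" by (rule le_degree) (use D in \<open>auto simp: cq\<close>)
  qed
  obtain \<alpha> where \<alpha>: "poly q \<alpha> = 0" "cmod \<alpha> \<le> 1"
  proof (rule monic_small_root[of q])
    show "lead_coeff q = 1" using D by (simp add: dq cq)
    show "0 < degree q" using D by (simp add: dq)
    have "poly q 0 = - w" using D b by (simp add: poly_0_coeff_0 cq)
    then show "cmod (poly q 0) \<le> 1" using w_norm by simp
  qed
  have fa: "\<alpha> ^ D - b ^ D = \<alpha> - b"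
  proof -
    have "poly q \<alpha> = (\<Sum>i<D. b ^ (D - Suc i) * \<alpha> ^ i) - 1" by (simp add: q_def poly_sum poly_monom)
    then have "(\<Sum>i<D. b ^ (D - Suc i) * \<alpha> ^ i) = 1" using \<alpha>(1) by simp
    then show ?thesis unfolding power_diff_sumr2[of \<alpha> D b] by simp
  qed
  have fixA: "fixmap D b \<alpha> = \<alpha>" using fa by (simp add: fixmap_def umap_def algebra_simps)
  have \<alpha>0: "\<alpha> \<noteq> 0"
  proof
    assume "\<alpha> = 0"
    then have "b - b ^ D = 0" using fa D by (simp add: power_0_left)
    then show False using c w0 b0 by simp
  qed
  have repA: "1 < cmod (of_nat D * \<alpha> ^ (D - 1))"
  proof (rule ccontr)
    assume "\<not> ?thesis"
    then have "real D * cmod \<alpha> ^ (D - 1) \<le> 1" by (simp add: norm_mult norm_power)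
    then have a1: "cmod \<alpha> ^ (D - 1) \<le> 1 / real D" using D by (simp add: field_simps)
    \<comment> \<open>If \<open>\<alpha>\<close> did not repel, the modulus of \<open>\<alpha>\<close> would be almost that of \<open>b\<close>, and the derivatives at \<open>\<alpha>\<close> and at \<open>b\<close>
      would differ by a factor of at most 3.\<close>
    have "\<alpha> ^ D = \<alpha> - w * b"
    proof -
      have "\<alpha> ^ D = \<alpha> - (b - b ^ D)" using fa by (simp add: algebra_simps)
      then show ?thesis by (simp only: c)
    qed
    then have "w * b = \<alpha> - \<alpha> ^ D" by simp
    then have "cmod b \<le> cmod \<alpha> + cmod (\<alpha> ^ D)"
      by (metis norm_triangle_ineq4 norm_mult w_norm mult_1)
    also have "cmod (\<alpha> ^ D) = cmod \<alpha> ^ (D - 1) * cmod \<alpha>" unfolding DS by (simp add: norm_mult norm_power)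
    also have "cmod \<alpha> + cmod \<alpha> ^ (D - 1) * cmod \<alpha> \<le> cmod \<alpha> + 1 / real D * cmod \<alpha>"
      using a1 by (intro add_left_mono mult_right_mono) auto
    also have "\<dots> = (1 + 1 / real D) * cmod \<alpha>" by (simp add: algebra_simps)
    finally have "cmod b ^ (D - 1) \<le> ((1 + 1 / real D) * cmod \<alpha>) ^ (D - 1)" by (intro power_mono) auto
    also have "\<dots> = (1 + 1 / real D) ^ (D - 1) * cmod \<alpha> ^ (D - 1)" by (simp add: power_mult_distrib)
    also have "\<dots> \<le> 3 * (1 / real D)"
    proof (intro mult_mono a1)
      have "(1 + 1 / real D) ^ (D - 1) \<le> exp (1 / real D) ^ (D - 1)"
        by (intro power_mono exp_ge_add_one_self) auto
      also have "\<dots> = exp (real (D - 1) * (1 / real D))" by (rule exp_of_nat_mult[symmetric])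
      also have "\<dots> \<le> exp 1" using D by simp
      also have "\<dots> \<le> 3" by (rule exp_le)
      finally show "(1 + 1 / real D) ^ (D - 1) \<le> 3" .
    qed auto
    finally show False using bm w(4) D by (simp add: field_simps)
  qed
  have repB: "1 < cmod (of_nat D * b ^ (D - 1))" using w(4) bm by (simp add: norm_mult norm_power)
  have orb: "crit_orbit D (b - b ^ D) 1 = w * b" "crit_orbit D (b - b ^ D) (Suc (Suc n)) = b" for n
  proof -
    show 1: "crit_orbit D (b - b ^ D) 1 = w * b" using D c by (simp add: crit_orbit_Suc power_0_left)
    show "crit_orbit D (b - b ^ D) (Suc (Suc n)) = b"
    proof (induction n)
      case 0
      then show ?case using 1 by (simp add: crit_orbit_Suc power_mult_distrib w(1))
    next
      case (Suc n)
      then show ?case by (simp add: crit_orbit_Suc)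
    qed
  qed
  have path: "\<exists>u k. cmod (u - b) < \<epsilon> \<and> (fixmap D b ^^ k) u = \<alpha> \<and> (\<forall>i<k. (fixmap D b ^^ i) u \<noteq> 0)"
    if e: "0 < \<epsilon>" for \<epsilon>
  proof -
    have "\<alpha> \<noteq> w * \<alpha>" using w1 \<alpha>0 by simp
    moreover have "umap D (b - b ^ D) (w * \<alpha>) = \<alpha>"
      using fixA by (simp add: fixmap_def umap_def power_mult_distrib w(1))
    ultimately obtain n z where z: "cmod (z - b) < \<epsilon>" "(umap D (b - b ^ D) ^^ n) z = \<alpha>"
      using preimages_accumulate_at_repelling[OF fixmap_fixed[unfolded fixmap_def] repB _ _ e] by blast
    have "(fixmap D b ^^ i) z \<noteq> 0" if i: "i < n" for i
    proof
      \<comment> \<open>The critical orbit stays outside the closed unit disc, so an orbit through 0 does not reach \<open>\<alpha>\<close>.\<close>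
      assume z0: "(fixmap D b ^^ i) z = 0"
      have "n = (n - i) + i" using i by simp
      then have "(umap D (b - b ^ D) ^^ n) z = (umap D (b - b ^ D) ^^ (n - i)) ((umap D (b - b ^ D) ^^ i) z)"
        by (metis comp_apply funpow_add)
      then have "\<alpha> = crit_orbit D (b - b ^ D) (n - i)" using z(2) z0 by (simp add: fixmap_def crit_orbit_def)
      moreover obtain k where k: "n - i = Suc k" using i by (metis Suc_diff_Suc)
      moreover have "cmod (crit_orbit D (b - b ^ D) (Suc k)) = cmod b"
        using orb w_norm by (cases k) (auto simp: norm_mult)
      ultimately show False using \<alpha>(2) b1 by simp
    qed
    moreover have "(fixmap D b ^^ n) z = \<alpha>" using z(2) by (simp add: fixmap_def)
    ultimately show ?thesis using z(1) by blast
  qed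
  define la lb where "la = log_expansion D \<alpha>" and "lb = log_expansion D b"
  have la: "la \<le> ln (real D)"
  proof -
    have "real D * cmod \<alpha> ^ (D - 1) \<le> real D * 1"
      using \<alpha>(2) by (intro mult_left_mono power_le_one) auto
    moreover have "0 < real D * cmod \<alpha> ^ (D - 1)" using \<alpha>0 D by simp
    ultimately show ?thesis unfolding la_def log_expansion_def by (metis ln_mono mult.right_neutral)
  qed
  have lb: "lb = ln (real D * m)" using bm by (simp add: lb_def log_expansion_def)
  have rat: "limit_circle D (exp ((real i * lb + real j * la) / real (i + j)))"
    if ij: "0 < i" "0 < j" and ne: "(real i * lb + real j * la) / real (i + j) \<noteq> ln (real D)" for i j :: nat
    unfolding limit_circle_def
  proof (intro conjI allI impI)
    fix s assume s: "cmod s = exp ((real i * lb + real j * la) / real (i + j))"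
    show "1 / s \<in> closure (Sigma_set D)"
    proof (rule eigenvalues_near_circle[OF D repB fixA repA _ _ path _ ij _ ne s])
      show "cmod \<alpha> \<le> cmod b" using \<alpha>(2) b1 by simp
      show "crit_orbit D (b - b ^ D) (Suc 1) = b" using orb(2)[of 0] by simp
      show "\<exists>u k. cmod (u - \<alpha>) < \<epsilon> \<and> (fixmap D b ^^ k) u = 0 \<and> (\<forall>i<k. (fixmap D b ^^ i) u \<noteq> 0)" if "0 < \<epsilon>" for \<epsilon>
        by (rule path_to_critical_point[OF _ fixA repA _ that]) (use D c w0 b0 in auto)
      show "real (i + j) * ((real i * lb + real j * la) / real (i + j)) = real i * log_expansion D b + real j * log_expansion D \<alpha>"
        using ij by (simp add: la_def lb_def)
    qed
  qed simp
  show ?thesis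
  proof (rule limit_circle_closed)
    show x0: "0 < x" using x D by linarith
    fix \<epsilon> :: real assume \<epsilon>: "0 < \<epsilon>"
    have lx: "ln (real D) < ln x" "ln x < lb" using x x0 D unfolding lb by auto
    have "isCont exp (ln x)" by (rule isCont_exp)
    then obtain d where d: "0 < d" "\<And>y. \<bar>y - ln x\<bar> < d \<Longrightarrow> \<bar>exp y - exp (ln x)\<bar> < \<epsilon>"
      unfolding continuous_at_eps_delta using \<epsilon> by (metis dist_real_def)
    \<comment> \<open>A weighted mean of \<open>la\<close> and \<open>lb\<close> with rational weights, between \<open>lo\<close> and \<open>ln x\<close>.\<close>
    define lo where "lo = max (ln (real D)) (ln x - d)"
    have lo: "lo < ln x" "la \<le> lo" using lx d la by (auto simp: lo_def)
    have lalb: "la < lb" using la lx by linarith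
    have "(lo - la) / (lb - la) < (ln x - la) / (lb - la)" using lo lalb by (intro divide_strict_right_mono) auto
    then obtain r :: rat where r: "(lo - la) / (lb - la) < of_rat r" "of_rat r < (ln x - la) / (lb - la)"
      using of_rat_dense by blast
    have "0 \<le> (lo - la) / (lb - la)" using lo lalb by simp
    then have r0: "0 < (of_rat r :: real)" using r by linarith
    have "(ln x - la) / (lb - la) < 1" using lx lalb by simp
    then have r1: "(of_rat r :: real) < 1" using r by linarith
    obtain p q where pq: "quotient_of r = (p, q)" by (cases "quotient_of r")
    have q0: "0 < q" using quotient_of_denom_pos[OF pq] .
    have rpq: "(of_rat r :: real) = real_of_int p / real_of_int q" using quotient_of_div[OF pq] by (simp add: of_rat_divide)
    have p: "0 < p" "p < q" using r0 r1 q0 unfolding rpq by (auto simp: zero_less_divide_iff)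
    define i j where "i = nat p" and "j = nat (q - p)"
    have ij: "0 < i" "0 < j" using p by (auto simp: i_def j_def)
    have iR: "real i = real_of_int p" "real j = real_of_int q - real_of_int p" using p by (auto simp: i_def j_def)
    define y where "y = (real i * lb + real j * la) / real (i + j)"
    have y: "y = la + of_rat r * (lb - la)"
      unfolding y_def rpq of_nat_add iR using q0 by (simp add: field_simps)
    have ya: "lo < y"
    proof -
      have "lo - la < of_rat r * (lb - la)" using r(1) lalb by (simp add: pos_divide_less_eq)
      then show ?thesis unfolding y by linarith
    qed
    have yb: "y < ln x"
    proof -
      have "of_rat r * (lb - la) < ln x - la" using r(2) lalb by (simp add: pos_less_divide_eq)
      then show ?thesis unfolding y by linarith
    qed
    have "y \<noteq> ln (real D)" using ya by (simp add: lo_def)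
    then have "limit_circle D (exp y)" unfolding y_def by (rule rat[OF ij])
    moreover have "\<bar>y - ln x\<bar> < d" using ya yb by (simp add: lo_def)
    then have "\<bar>exp y - x\<bar> < \<epsilon>" using d(2)[of y] x0 by simp
    ultimately show "\<exists>y. limit_circle D y \<and> \<bar>y - x\<bar> < \<epsilon>" by blast
  qed
qed

section \<open>The annulus\<close>

theorem theorem4:
  fixes D :: nat
  assumes "D \<ge> 2"
  shows "{l :: complex. r_radius D \<le> cmod l \<and> cmod l \<le> 1} \<subseteq> closure (Sigma_set D)"
proof
  fix l :: complex assume "l \<in> {l. r_radius D \<le> cmod l \<and> cmod l \<le> 1}"
  then have l: "r_radius D \<le> cmod l" "cmod l \<le> 1" by auto
  define m where "m = 1 / (real D * r_radius D)"
  obtain w :: complex where w: "w ^ D = 1" "cmod (1 - w) = m" "1 < m" "3 < real D * m"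
    using exists_root_of_unity_far_from_1[OF assms] unfolding m_def by blast
  have D0: "0 < real D" using assms by simp
  have r: "0 < r_radius D" "1 / r_radius D = real D * m"
  proof -
    show "0 < r_radius D" using w(3) D0 by (metis m_def less_trans zero_less_divide_1_iff zero_less_mult_pos zero_less_one)
    then show "1 / r_radius D = real D * m" using D0 by (simp add: m_def)
  qed
  have l0: "0 < cmod l" using r l by linarith
  have circle_below: "limit_circle D x" if x: "1 < x" "x < real D" for x
  proof -
    define R where "R = root (D - 1) (x / real D)"
    have n: "0 < D - 1" using assms by simp
    have q: "0 < x / real D" "x / real D < 1" using x D0 by auto
    have R: "R ^ (D - 1) = x / real D" unfolding R_def using n q by (simp add: real_root_pow_pos2)
    have "0 < R" unfolding R_def using n q by simp
    moreover have "R < 1" unfolding R_def using n q by simp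
    moreover have DR: "real D * R ^ (D - 1) = x" using R D0 by simp
    moreover have "1 \<le> cmod (w - 1)" using w by (simp add: norm_minus_commute)
    ultimately show ?thesis using limit_circle_below[OF assms, of R w] w(1) x by simp
  qed
  have "limit_circle D (1 / cmod l)"
  proof (rule limit_circle_closed)
    define x where "x = 1 / cmod l"
    have "1 / cmod l \<le> 1 / r_radius D" using l l0 r(1) by (intro divide_left_mono) auto
    then have x: "1 \<le> x" "x \<le> real D * m" using l l0 r(2) by (auto simp: x_def)
    fix \<epsilon> :: real assume \<epsilon>: "0 < \<epsilon>"
    have "real D < real D * m" using w(3) D0 by simp
    \<comment> \<open>The circles of radius 1, \<open>D\<close> and \<open>D * m\<close> are limits of the others.\<close>
    have "\<exists>y. 1 < y \<and> y < real D * m \<and> y \<noteq> real D \<and> \<bar>y - x\<bar> < \<epsilon>"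
    proof -
      have "1 < real D * m" using w(4) by simp
      then have "max 1 (x - \<epsilon>) < min (real D * m) (x + \<epsilon>)" using x \<epsilon> by auto
      then have "infinite {max 1 (x - \<epsilon>)<..<min (real D * m) (x + \<epsilon>)}" by (simp add: infinite_Ioo)
      then have "infinite ({max 1 (x - \<epsilon>)<..<min (real D * m) (x + \<epsilon>)} - {real D})" by simp
      then obtain y where "y \<in> {max 1 (x - \<epsilon>)<..<min (real D * m) (x + \<epsilon>)} - {real D}"
        by (metis ex_in_conv finite.emptyI)
      then show ?thesis by (intro exI[of _ y]) auto
    qed
    then obtain y where y: "1 < y" "y < real D * m" "y \<noteq> real D" "\<bar>y - x\<bar> < \<epsilon>" by blast
    have "limit_circle D y"
      using circle_below[of y] limit_circle_above[OF assms w, of y] y by (cases "y < real D") auto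
    then show "\<exists>y. limit_circle D y \<and> \<bar>y - 1 / cmod l\<bar> < \<epsilon>" using y unfolding x_def by blast
  qed (use l0 in simp)
  then have "1 / (1 / l) \<in> closure (Sigma_set D)"
    unfolding limit_circle_def by (metis norm_divide norm_one)
  then show "l \<in> closure (Sigma_set D)" by simp
qed

end
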